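(* The Hurwitz invariant of a NET map $f$ is an invariant of the modular group Hurwitz class of $f$. Conversely, two modular group Hurwitz classes of NET maps with equal Hurwitz invariants are equal. Thus the Hurwitz invariant is a complete invariant of modular group Hurwitz classes of NET maps.
   Context: A Thurston map is an orientation-preserving branched covering $f\colon S^2\to S^2$ of degree at least $2$ whose postcritical set $P_f=\bigcup_{k\ge 1}f^{k}(C_f)$ is finite, where $C_f$ is the set of critical points. A nearly Euclidean Thurston (NET) map is a Thurston map each of whose critical points is simple (local degree $2$) and whose postcritical set has exactly four points. Presentations. For every NET map $f$ the set $P_1$ of noncritical points in $f^{-1}(P_f)$ has exactly four elements, and there exist lattices $\Lambda_1\subseteq\Lambda_2$ in $\mathbb{R}^2$ and orientation-preserving branched coverings $\pi_1,\pi_2\colon\mathbb{R}^2\to S^2$ with $f\circ\pi_1=\pi_2$ such that $\pi_i$ is a normal covering with deck group $\Gamma_i=\{x\mapsto 2\lambda\pm x:\lambda\in\Lambda_i\}$ for $i=1,2$, $\pi_1(\Lambda_1)=P_1$ and $\pi_2(\Lambda_2)=P_f$. NET maps $f,f'$ with postcritical sets $P,P'$ are Hurwitz equivalent for the modular group if there are orientation-preserving homeomorphisms $\varphi,\psi\colon(S^2,P)\to(S^2,P')$ (so $\varphi(P)=\psi(P)=P'$) with $\varphi\circ f=f'\circ\psi$. Equivalence classes are modular group Hurwitz classes. Hurwitz structure sets. For lattices $\Lambda_1\subseteq\Lambda_2$ put $\mathcal{A}=\Lambda_2/2\Lambda_1$. A Hurwitz structure set in $\mathcal{A}$ is a subset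 which is a disjoint union $\{\pm h_1\}\amalg\{\pm h_2\}\amalg\{\pm h_3\}\amalg\{\pm h_4\}$ with $h_i\in\mathcal{A}$ ($h_i=-h_i$ is allowed, but $h_i\ne\pm h_j$ for $i\neq j$). Given a presentation of a NET map $f$, that is, lattices $\Lambda_1\subseteq\Lambda_2$ in $\mathbb{R}^2$ and orientation-preserving branched coverings $\pi_1,\pi_2\colon\mathbb{R}^2\to S^2$ with $f\circ\pi_1=\pi_2$ such that $\pi_i$ is a normal covering with deck group $\Gamma_i$ for $i=1,2$, $\pi_1(\Lambda_1)=P_1$ and $\pi_2(\Lambda_2)=P_f$, the set $\Delta=\pi_1^{-1}(P_f)$ is contained in $\Lambda_2$, and its image $\mathcal{HS}$ in $\mathcal{A}$ is a Hurwitz structure set, the Hurwitz structure set of this presentation of $f$. Equivalence. Given lattices $\Lambda_1\subseteq\Lambda_2$ and $\Lambda_1'\subseteq\Lambda_2'$, Hurwitz structure sets $\mathcal{HS}\subseteq\Lambda_2/2\Lambda_1$ and $\mathcal{HS}'\subseteq\Lambda'_2/2\Lambda'_1$ are equivalent if there is an orientation-preserving affine isomorphism $\Psi\colon\Lambda_2\to\Lambda_2'$ with $\Psi(\Lambda_1)=\Lambda_1'$ whose induced affine bijection $\overline{\Psi}\colon\Lambda_2/2\Lambda_1\to\Lambda_2'/2\Lambda_1'$ satisfies $\overline{\Psi}(\mathcal{HS})=\mathcal{HS}'$. The Hurwitz invariant of $f$ is the equivalence class of the Hurwitz structure set of a presentation of $f$. *)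

theory Defs
  imports "HOL-Complex_Analysis.Complex_Analysis"
begin

section \<open>Oriented surfaces\<close>

text \<open>
  The plane is \<^typ>\<open>complex\<close>.  The two-sphere is the unit sphere of
  \<^typ>\<open>complex \<times> real\<close>, i.e. of three-space.  An oriented surface is given by a set together
  with a set of injective, positively oriented parametrizations by the plane, whose ranges are
  open and cover it.
\<close>

definition S2 :: "(complex \<times> real) set" where
  "S2 = sphere 0 1"

text \<open>
  Inverse stereographic projection from \<open>(0, 1)\<close>, and the conjugate of inverse stereographic
  projection from \<open>(0, -1)\<close>.  The change of parameter is \<open>w \<mapsto> 1 / w\<close>, so the two parametrizations
  induce the same orientation, that of the Riemann sphere.
\<close>

definition param_north :: "complex \<Rightarrow> complex \<times> real" where
  "param_north w =
     (2 * w / of_real ((cmod w)\<^sup>2 + 1), ((cmod w)\<^sup>2 - 1) / ((cmod w)\<^sup>2 + 1))"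

definition param_south :: "complex \<Rightarrow> complex \<times> real" where
  "param_south w =
     (2 * cnj w / of_real ((cmod w)\<^sup>2 + 1), (1 - (cmod w)\<^sup>2) / ((cmod w)\<^sup>2 + 1))"

definition S2_params :: "(complex \<Rightarrow> complex \<times> real) set" where
  "S2_params = {param_north, param_south}"

definition plane_params :: "(complex \<Rightarrow> complex) set" where
  "plane_params = {id}"

text \<open>
  For a continuous injective map on an open subset of the plane, preserving the orientation means
  that the image of a small positively oriented circle winds once, positively, around the image
  of its centre.
\<close>

definition preserves_winding :: "complex set \<Rightarrow> (complex \<Rightarrow> complex) \<Rightarrow> bool" where
  "preserves_winding U h \<longleftrightarrow>
     (\<forall>z r. 0 < r \<and> cball z r \<subseteq> U \<longrightarrow> winding_number (h \<circ> circlepath z r) (h z) = 1)"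

text \<open>
  Orientation-preserving homeomorphisms from \<open>U\<close> onto \<open>V\<close>, where \<open>U\<close> and \<open>V\<close> are open subsets of
  surfaces oriented by the parametrizations \<open>P\<close> and \<open>Q\<close>.
\<close>

definition oriented_homeo ::
  "(complex \<Rightarrow> 'a::topological_space) set \<Rightarrow> 'a set \<Rightarrow>
   (complex \<Rightarrow> 'b::topological_space) set \<Rightarrow> 'b set \<Rightarrow> ('a \<Rightarrow> 'b) \<Rightarrow> bool" where
  "oriented_homeo P U Q V \<phi> \<longleftrightarrow>
     (\<exists>\<phi>'. homeomorphism U V \<phi> \<phi>') \<and>
     (\<forall>\<sigma>\<in>P. \<forall>\<tau>\<in>Q.
        preserves_winding {z. \<sigma> z \<in> U \<and> \<phi> (\<sigma> z) \<in> range \<tau>} (inv \<tau> \<circ> \<phi> \<circ> \<sigma>))"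

definition oriented_disc_chart ::
  "(complex \<Rightarrow> 'a::topological_space) set \<Rightarrow> 'a set \<Rightarrow> 'a set \<Rightarrow> ('a \<Rightarrow> complex) \<Rightarrow> bool" where
  "oriented_disc_chart P X U \<alpha> \<longleftrightarrow>
     openin (top_of_set X) U \<and> oriented_homeo P U plane_params (ball 0 1) \<alpha>"


section \<open>Branched coverings\<close>

text \<open>
  Every point of the target has a disc neighbourhood \<open>V\<close> over which each component of the preimage
  is a disc mapped to \<open>V\<close> as \<open>z \<mapsto> z ^ d\<close>, in orientation-preserving coordinates.  The number of
  components may be infinite.
\<close>

definition oriented_branched_covering ::
  "(complex \<Rightarrow> 'a::topological_space) set \<Rightarrow> 'a set \<Rightarrow>
   (complex \<Rightarrow> 'b::topological_space) set \<Rightarrow> 'b set \<Rightarrow> ('a \<Rightarrow> 'b) \<Rightarrow> bool" where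
  "oriented_branched_covering P X Q Y f \<longleftrightarrow>
     continuous_on X f \<and> f ` X = Y \<and>
     (\<forall>y\<in>Y. \<exists>V \<beta>. y \<in> V \<and> oriented_disc_chart Q Y V \<beta> \<and> \<beta> y = 0 \<and>
        (\<forall>U\<in>components (X \<inter> f -` V). \<exists>\<alpha> d. 0 < d \<and> oriented_disc_chart P X U \<alpha> \<and>
           (\<forall>x\<in>U. \<beta> (f x) = \<alpha> x ^ d)))"

definition has_local_degree ::
  "(complex \<Rightarrow> 'a::topological_space) set \<Rightarrow> 'a set \<Rightarrow>
   (complex \<Rightarrow> 'b::topological_space) set \<Rightarrow> 'b set \<Rightarrow> ('a \<Rightarrow> 'b) \<Rightarrow> 'a \<Rightarrow> nat \<Rightarrow> bool" where
  "has_local_degree P X Q Y f x d \<longleftrightarrow>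
     0 < d \<and>
     (\<exists>U \<alpha> V \<beta>. oriented_disc_chart P X U \<alpha> \<and> x \<in> U \<and> \<alpha> x = 0 \<and>
        oriented_disc_chart Q Y V \<beta> \<and> f ` U \<subseteq> V \<and> \<beta> (f x) = 0 \<and>
        (\<forall>u\<in>U. \<beta> (f u) = \<alpha> u ^ d))"


section \<open>Thurston maps and NET maps\<close>

text \<open>
  Maps of the sphere are total functions on \<^typ>\<open>complex \<times> real\<close>; only their restrictions to
  \<^const>\<open>S2\<close> matter.
\<close>

type_synonym sphere_map = "complex \<times> real \<Rightarrow> complex \<times> real"

definition critical_points :: "sphere_map \<Rightarrow> (complex \<times> real) set" where
  "critical_points f = {x \<in> S2. \<exists>d\<ge>2. has_local_degree S2_params S2 S2_params S2 f x d}"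

definition covering_degree :: "sphere_map \<Rightarrow> nat" where
  "covering_degree f =
     (THE d. \<forall>y \<in> S2 - f ` critical_points f. card {x \<in> S2. f x = y} = d)"

definition postcritical_set :: "sphere_map \<Rightarrow> (complex \<times> real) set" where
  "postcritical_set f = (\<Union>k\<in>{1..}. (f ^^ k) ` critical_points f)"

definition Thurston_map :: "sphere_map \<Rightarrow> bool" where
  "Thurston_map f \<longleftrightarrow>
     oriented_branched_covering S2_params S2 S2_params S2 f \<and>
     2 \<le> covering_degree f \<and> finite (postcritical_set f)"

definition NET_map :: "sphere_map \<Rightarrow> bool" where
  "NET_map f \<longleftrightarrow>
     Thurston_map f \<and>
     (\<forall>c \<in> critical_points f. has_local_degree S2_params S2 S2_params S2 f c 2) \<and>
     card (postcritical_set f) = 4"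


section \<open>Modular group Hurwitz classes\<close>

definition Hurwitz_equivalent :: "sphere_map \<Rightarrow> sphere_map \<Rightarrow> bool" where
  "Hurwitz_equivalent f f' \<longleftrightarrow>
     (\<exists>\<phi> \<psi>. oriented_homeo S2_params S2 S2_params S2 \<phi> \<and>
            oriented_homeo S2_params S2 S2_params S2 \<psi> \<and>
            \<phi> ` postcritical_set f = postcritical_set f' \<and>
            \<psi> ` postcritical_set f = postcritical_set f' \<and>
            (\<forall>x\<in>S2. \<phi> (f x) = f' (\<psi> x)))"

definition modular_Hurwitz_class :: "sphere_map \<Rightarrow> sphere_map set" where
  "modular_Hurwitz_class f = {g. NET_map g \<and> Hurwitz_equivalent f g}"


section \<open>Presentations\<close>

definition is_lattice :: "complex set \<Rightarrow> bool" where
  "is_lattice \<Lambda> \<longleftrightarrow>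
     (\<exists>a b. a \<noteq> b \<and> independent {a, b} \<and>
        \<Lambda> = {of_int m * a + of_int n * b | m n. True})"

definition Gamma_group :: "complex set \<Rightarrow> (complex \<Rightarrow> complex) set" where
  "Gamma_group \<Lambda> = {(\<lambda>x. 2 * l + x) | l. l \<in> \<Lambda>} \<union> {(\<lambda>x. 2 * l - x) | l. l \<in> \<Lambda>}"

definition deck_group :: "(complex \<Rightarrow> complex \<times> real) \<Rightarrow> (complex \<Rightarrow> complex) set" where
  "deck_group \<pi> = {g. (\<exists>g'. homeomorphism UNIV UNIV g g') \<and> \<pi> \<circ> g = \<pi>}"

definition oriented_normal_branched_covering :: "(complex \<Rightarrow> complex \<times> real) \<Rightarrow> bool" where
  "oriented_normal_branched_covering \<pi> \<longleftrightarrow>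
     oriented_branched_covering plane_params UNIV S2_params S2 \<pi> \<and>
     (\<forall>x y. \<pi> x = \<pi> y \<longrightarrow> (\<exists>g\<in>deck_group \<pi>. g x = y))"

definition P1_set :: "sphere_map \<Rightarrow> (complex \<times> real) set" where
  "P1_set f = {x \<in> S2. f x \<in> postcritical_set f \<and> x \<notin> critical_points f}"

definition is_presentation ::
  "sphere_map \<Rightarrow> complex set \<Rightarrow> complex set \<Rightarrow>
   (complex \<Rightarrow> complex \<times> real) \<Rightarrow> (complex \<Rightarrow> complex \<times> real) \<Rightarrow> bool" where
  "is_presentation f \<Lambda>1 \<Lambda>2 \<pi>1 \<pi>2 \<longleftrightarrow>
     is_lattice \<Lambda>1 \<and> is_lattice \<Lambda>2 \<and> \<Lambda>1 \<subseteq> \<Lambda>2 \<and>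
     oriented_normal_branched_covering \<pi>1 \<and> deck_group \<pi>1 = Gamma_group \<Lambda>1 \<and>
     oriented_normal_branched_covering \<pi>2 \<and> deck_group \<pi>2 = Gamma_group \<Lambda>2 \<and>
     f \<circ> \<pi>1 = \<pi>2 \<and>
     \<pi>1 ` \<Lambda>1 = P1_set f \<and> \<pi>2 ` \<Lambda>2 = postcritical_set f"


section \<open>Hurwitz structure sets and the Hurwitz invariant\<close>

text \<open>
  Elements of \<open>\<Lambda>2 / 2 \<Lambda>1\<close> are cosets, as sets of complex numbers; the negative of a coset \<open>h\<close> is
  \<open>uminus ` h\<close>.
\<close>

definition coset2 :: "complex set \<Rightarrow> complex \<Rightarrow> complex set" where
  "coset2 \<Lambda>1 x = {x + 2 * l | l. l \<in> \<Lambda>1}"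

definition quotient2 :: "complex set \<Rightarrow> complex set \<Rightarrow> complex set set" where
  "quotient2 \<Lambda>1 \<Lambda>2 = coset2 \<Lambda>1 ` \<Lambda>2"

definition is_Hurwitz_structure_set ::
  "complex set \<Rightarrow> complex set \<Rightarrow> complex set set \<Rightarrow> bool" where
  "is_Hurwitz_structure_set \<Lambda>1 \<Lambda>2 H \<longleftrightarrow>
     (\<exists>h :: nat \<Rightarrow> complex set.
        (\<forall>i<4. h i \<in> quotient2 \<Lambda>1 \<Lambda>2) \<and>
        H = (\<Union>i<4. {h i, uminus ` h i}) \<and>
        (\<forall>i<4. \<forall>j<4. i \<noteq> j \<longrightarrow> {h i, uminus ` h i} \<inter> {h j, uminus ` h j} = {}))"

definition Hurwitz_structure_set_of ::
  "sphere_map \<Rightarrow> complex set \<Rightarrow> (complex \<Rightarrow> complex \<times> real) \<Rightarrow> complex set set" where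
  "Hurwitz_structure_set_of f \<Lambda>1 \<pi>1 = coset2 \<Lambda>1 ` (\<pi>1 -` postcritical_set f)"

text \<open>The determinant, in the basis \<open>1, \<i>\<close>, of a real-linear map of the plane.\<close>

definition plane_det :: "(complex \<Rightarrow> complex) \<Rightarrow> real" where
  "plane_det L = Re (L 1) * Im (L \<i>) - Re (L \<i>) * Im (L 1)"

text \<open>
  An affine isomorphism between lattices is the restriction of a unique real-affine map of the
  plane, which is the map quantified over here.  It acts on cosets by taking images.
\<close>

definition equivalent_structures ::
  "complex set \<times> complex set \<times> complex set set \<Rightarrow>
   complex set \<times> complex set \<times> complex set set \<Rightarrow> bool" where
  "equivalent_structures = (\<lambda>(\<Lambda>1, \<Lambda>2, H) (\<Lambda>1', \<Lambda>2', H').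
     \<exists>\<Psi> L b. linear L \<and> 0 < plane_det L \<and> \<Psi> = (\<lambda>x. L x + b) \<and>
       \<Psi> ` \<Lambda>2 = \<Lambda>2' \<and> \<Psi> ` \<Lambda>1 = \<Lambda>1' \<and> (\<lambda>h. \<Psi> ` h) ` H = H')"

definition structure_class ::
  "complex set \<times> complex set \<times> complex set set \<Rightarrow>
   (complex set \<times> complex set \<times> complex set set) set" where
  "structure_class s =
     {(\<Lambda>1, \<Lambda>2, H). is_lattice \<Lambda>1 \<and> is_lattice \<Lambda>2 \<and> \<Lambda>1 \<subseteq> \<Lambda>2 \<and>
        is_Hurwitz_structure_set \<Lambda>1 \<Lambda>2 H \<and> equivalent_structures s (\<Lambda>1, \<Lambda>2, H)}"

text \<open>
  A relation rather than a function: that \<open>C\<close> does not depend on the presentation is not built in.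
\<close>

definition is_Hurwitz_invariant ::
  "sphere_map \<Rightarrow> (complex set \<times> complex set \<times> complex set set) set \<Rightarrow> bool" where
  "is_Hurwitz_invariant f C \<longleftrightarrow>
     (\<exists>\<Lambda>1 \<Lambda>2 \<pi>1 \<pi>2. is_presentation f \<Lambda>1 \<Lambda>2 \<pi>1 \<pi>2 \<and>
        C = structure_class (\<Lambda>1, \<Lambda>2, Hurwitz_structure_set_of f \<Lambda>1 \<pi>1))"

end

theory Submission imports Defs begin

text \<open>
  Let \<open>\<phi> \<circ> f = f' \<circ> \<psi>\<close>.  Since \<open>\<psi>\<close> matches the branch values of \<open>\<pi>1\<close> and \<open>\<pi>1'\<close>, all of order two, it
  lifts to a homeomorphism \<open>h\<close> of the plane with \<open>\<pi>1' \<circ> h = \<psi> \<circ> \<pi>1\<close>; automatically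
  \<open>\<pi>2' \<circ> h = \<phi> \<circ> \<pi>2\<close>, so \<open>h\<close> conjugates both deck groups.  The half turn about a lattice point
  \<open>l\<close> goes to the half turn about \<open>h l\<close>, which makes \<open>h\<close> affine on \<open>\<Lambda>2\<close>.  The affine map is at
  bounded distance from \<open>h\<close>, and winding numbers of large circles show that it preserves
  orientation.  Conversely an affine equivalence conjugates the deck groups and descends to \<open>\<phi>\<close>
  and \<open>\<psi>\<close>; they preserve orientation because the quotient maps have positive local degrees.
\<close>

section \<open>Local degrees of plane maps\<close>

text \<open>Three obstacles shape the proof. Orientation is given by winding numbers of circles in
  charts, a condition meant for injective maps. It is recast as an integer degree at a point, tested
  on all loops in a punctured disc. This degree is multiplicative under composition and exists for
  the branched quotient maps too, so the sign of a homeomorphism can be read off an equation n d = e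
  with d, e > 0.

  The quotient maps are branched, so unbranched covering theory does not give lifts on the whole
  plane. Lifts are made locally, near branch points by means of half turns, and glued along growing
  discs; any two of them differ by a single group element.

  The lift \<open>h\<close> is forced to be affine only at lattice points, so the sign of the
  determinant cannot be seen near a point. It is seen from far away, where the bounded error is
  negligible. Lattice values are enough for the invariant, since the preimage of the postcritical
  set lies in \<open>\<Lambda>2\<close>.\<close>

lemma continuous_diff_in_periods_constant:
  fixes d :: "'a::topological_space \<Rightarrow> complex"
  assumes "connected S" "continuous_on S d" "c > 0"
    and "\<And>x y. x \<in> S \<Longrightarrow> y \<in> S \<Longrightarrow> d x \<noteq> d y \<Longrightarrow> c \<le> cmod (d x - d y)"
    and "x \<in> S" "y \<in> S"
  shows "d x = d y"
proof -
  have "d constant_on S"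
  proof (rule continuous_discrete_range_constant[OF assms(1,2)])
    fix u assume "u \<in> S"
    then show "\<exists>e>0. \<forall>y. y \<in> S \<and> d y \<noteq> d u \<longrightarrow> e \<le> cmod (d y - d u)"
      using assms(3,4) by (intro exI[of _ c]) auto
  qed
  then show ?thesis
    using assms(5,6) by (auto simp: constant_on_def)
qed

lemma exp_eq_1_imp_period:
  assumes "exp (a::complex) = 1"
  obtains n :: int where "a = \<i> * of_real (2 * pi * of_int n)"
proof -
  obtain n :: int where "Re a = 0" "Im a = of_int (2 * n) * pi"
    using assms unfolding exp_eq_1 by blast
  then have "a = \<i> * of_real (2 * pi * of_int n)" by (simp add: complex_eq_iff)
  then show ?thesis using that by blast
qed

lemma exp_eq_imp_dist_ge:
  fixes a b c d :: complex
  assumes "exp (a - b) = 1" "exp (c - d) = 1" "a - b \<noteq> c - d"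
  shows "1 \<le> cmod ((a - b) - (c - d))"
proof -
  obtain m n :: int where m: "a - b = \<i> * of_real (2 * pi * of_int m)"
    and n: "c - d = \<i> * of_real (2 * pi * of_int n)"
    by (rule exp_eq_1_imp_period[OF assms(1)], rule exp_eq_1_imp_period[OF assms(2)])
  have "(a - b) - (c - d) = \<i> * of_real (2 * pi * of_int (m - n))"
    by (simp add: m n algebra_simps)
  then have "cmod ((a - b) - (c - d)) = 2 * pi * \<bar>of_int (m - n)\<bar>"
    by (simp only: norm_mult norm_ii norm_of_real abs_mult) simp
  moreover have "m \<noteq> n" using assms(3) unfolding m n by blast
  then have "1 \<le> \<bar>of_int (m - n)::real\<bar>" by linarith
  moreover have "1 \<le> 2 * pi" using pi_gt3 by simp
  ultimately show ?thesis
    using mult_mono[of 1 "2 * pi" 1 "\<bar>of_int (m - n)::real\<bar>"] by simp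
qed

text \<open>Two continuous logarithms of one path differ by a continuous function with values in the
  periods of \<open>exp\<close>, hence by a constant. So any logarithm \<open>q\<close>, not only
  the one that the library provides, computes the winding number from its endpoints.\<close>

lemma winding_number_exp:
  assumes "path q"
  shows "winding_number (\<lambda>t. z + exp (q t)) z = (pathfinish q - pathstart q) / (2 * of_real pi * \<i>)"
proof -
  let ?p = "\<lambda>t. z + exp (q t)"
  have p: "path ?p" using assms unfolding path_def by (intro continuous_intros)
  have z: "z \<notin> path_image ?p" by (auto simp: path_image_def)
  from winding_number_as_continuous_log[OF p z] obtain r where r: "path r"
    "pathfinish r - pathstart r = 2 * of_real pi * \<i> * winding_number ?p z"
    "\<And>t. t \<in> {0..1} \<Longrightarrow> z + exp (q t) = z + exp (r t)"
    by blast
  have e: "exp (q t - r t) = 1" if "t \<in> {0..1}" for t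
    using r(3)[OF that] by (simp add: exp_diff)
  have "q 1 - r 1 = q 0 - r 0"
  proof (rule continuous_diff_in_periods_constant[where S = "{0..1}" and c = 1 and d = "\<lambda>t. q t - r t"])
    show "continuous_on {0..1} (\<lambda>t. q t - r t)"
      using assms r(1) unfolding path_def by (intro continuous_intros)
    show "1 \<le> cmod ((q x - r x) - (q y - r y))"
      if "x \<in> {0..1}" "y \<in> {0..1}" "q x - r x \<noteq> q y - r y" for x y
      using exp_eq_imp_dist_ge[OF e[OF that(1)] e[OF that(2)] that(3)] .
  qed auto
  then have "pathfinish q - pathstart q = pathfinish r - pathstart r"
    by (simp add: pathfinish_def pathstart_def algebra_simps)
  then show ?thesis using r(2) by simp
qed

section \<open>The degree of a plane map at a point\<close>

definition punctured_loop :: "complex \<Rightarrow> real \<Rightarrow> (real \<Rightarrow> complex) \<Rightarrow> bool" where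
  "punctured_loop z R \<gamma> \<longleftrightarrow>
     path \<gamma> \<and> pathfinish \<gamma> = pathstart \<gamma> \<and> path_image \<gamma> \<subseteq> ball z R - {z}"

text \<open>All loops are tested and not only circles, because a map sends circles to general loops;
  this is what makes the degree multiplicative. Asking only that \<open>g z\<close> is not attained
  elsewhere in the disc admits branched maps such as powers.\<close>

definition turning_on :: "real \<Rightarrow> (complex \<Rightarrow> complex) \<Rightarrow> complex \<Rightarrow> int \<Rightarrow> bool" where
  "turning_on R g z n \<longleftrightarrow>
     0 < R \<and> continuous_on (ball z R) g \<and> (\<forall>w\<in>ball z R - {z}. g w \<noteq> g z) \<and>
     (\<forall>\<gamma>. punctured_loop z R \<gamma> \<longrightarrow>
        winding_number (g \<circ> \<gamma>) (g z) = of_int n * winding_number \<gamma> z)"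

definition turning :: "(complex \<Rightarrow> complex) \<Rightarrow> complex \<Rightarrow> int \<Rightarrow> bool" where
  "turning g z n \<longleftrightarrow> (\<exists>R. turning_on R g z n)"

lemma punctured_loop_mono: "punctured_loop z r \<gamma> \<Longrightarrow> r \<le> R \<Longrightarrow> punctured_loop z R \<gamma>"
  unfolding punctured_loop_def by auto

lemma turning_on_mono:
  assumes "turning_on R g z n" "0 < r" "r \<le> R"
  shows "turning_on r g z n"
  using assms punctured_loop_mono[of z r _ R]
    continuous_on_subset[of "ball z R" g "ball z r", OF _ subset_ball[OF assms(3)]]
  unfolding turning_on_def by auto

lemma punctured_loop_circlepath:
  assumes "0 < r" "r < R"
  shows "punctured_loop z R (circlepath z r)"
  using assms by (auto simp: punctured_loop_def path_image_circlepath)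

lemma turning_on_circlepath:
  assumes "turning_on R g z n" "0 < r" "r < R"
  shows "winding_number (g \<circ> circlepath z r) (g z) = of_int n"
  using assms punctured_loop_circlepath[OF assms(2,3)]
  by (simp add: turning_on_def winding_number_circlepath_centre)

lemma turning_unique:
  assumes "turning g z m" "turning g z n"
  shows "m = n"
proof -
  obtain R R' where R: "turning_on R g z m" "turning_on R' g z n"
    using assms by (auto simp: turning_def)
  then have "0 < R" "0 < R'" by (auto simp: turning_on_def)
  then have "complex_of_int m = of_int n"
    using turning_on_circlepath[OF R(1), of "min R R' / 2"]
      turning_on_circlepath[OF R(2), of "min R R' / 2"]
    by (simp add: min_def split: if_splits)
  then show ?thesis by simp
qed

text \<open>The left half-plane \<open>S\<close> covers the punctured disc by the exponential
  function and is convex, so \<open>g - g z\<close> has a logarithm \<open>H\<close> there. One turn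
  in the source, the shift by \<open>p\<close>, adds a constant multiple \<open>of_int n * p\<close>
  to \<open>H\<close>, and this \<open>n\<close> is the degree. For a loop with logarithm
  \<open>q\<close>, the path \<open>H \<circ> q\<close> is a logarithm of its image.\<close>

lemma turning_on_exists:
  assumes "0 < R" and g: "continuous_on (ball z R) g" "\<And>w. w \<in> ball z R - {z} \<Longrightarrow> g w \<noteq> g z"
  shows "\<exists>n. turning_on R g z n"
proof -
  define S where "S = {s. Re s < ln R}"
  have S: "convex S" unfolding S_def by (rule convex_halfspace_Re_lt)
  have inS: "s \<in> S \<longleftrightarrow> z + exp s \<in> ball z R" for s
    using \<open>0 < R\<close> exp_less_cancel_iff[of "Re s" "ln R"] by (simp add: S_def dist_norm)
  have "continuous_on S (\<lambda>s. g (z + exp s) - g z)"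
    by (intro continuous_intros continuous_on_compose2[OF g(1)]) (auto simp: inS)
  moreover have "contractible S" using S by (rule convex_imp_contractible)
  moreover have "g (z + exp s) - g z \<noteq> 0" if "s \<in> S" for s
    using g(2)[of "z + exp s"] that inS by auto
  ultimately obtain H where H: "continuous_on S H" "\<And>s. s \<in> S \<Longrightarrow> g (z + exp s) - g z = exp (H s)"
    using continuous_logarithm_on_contractible[of S "\<lambda>s. g (z + exp s) - g z"] by blast
  define p where "p = 2 * of_real pi * \<i>"
  have p0: "p \<noteq> 0" by (simp add: p_def)
  have ep: "exp p = 1" by (simp add: p_def exp_eq_1)
  have pS: "s + p \<in> S \<longleftrightarrow> s \<in> S" for s by (simp add: S_def p_def)
  define s0 where "s0 = complex_of_real (ln R - 1)"
  have s0: "s0 \<in> S" by (simp add: S_def s0_def)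
  have e1: "exp (H (s + p) - H s) = 1" if "s \<in> S" for s
    using H(2)[OF that] H(2)[of "s + p"] that pS by (simp add: exp_diff exp_add ep)
  obtain n :: int where n: "H (s0 + p) - H s0 = of_int n * p"
  proof -
    obtain n :: int where "H (s0 + p) - H s0 = \<i> * of_real (2 * pi * of_int n)"
      using exp_eq_1_imp_period[OF e1[OF s0]] by blast
    then show thesis using that[of n] by (simp add: p_def algebra_simps)
  qed
  have step: "H (s + p) = H s + of_int n * p" if "s \<in> S" for s
  proof -
    have "H (s + p) - H s = H (s0 + p) - H s0"
    proof (rule continuous_diff_in_periods_constant[where S = S and c = 1 and d = "\<lambda>s. H (s + p) - H s"])
      show "connected S" using S by (rule convex_connected)
      show "continuous_on S (\<lambda>s. H (s + p) - H s)"
        by (intro continuous_intros H(1) continuous_on_compose2[OF H(1)]) (auto simp: pS)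
      show "1 \<le> cmod ((H (x + p) - H x) - (H (y + p) - H y))"
        if "x \<in> S" "y \<in> S" "H (x + p) - H x \<noteq> H (y + p) - H y" for x y
        using exp_eq_imp_dist_ge[OF e1[OF that(1)] e1[OF that(2)] that(3)] .
    qed (use that s0 in auto)
    then show ?thesis using n by (simp add: algebra_simps)
  qed
  have steps: "H (s + of_int k * p) = H s + of_int k * of_int n * p" if "s \<in> S" for s and k :: int
  proof -
    have nat: "s + of_nat k * p \<in> S \<and> H (s + of_nat k * p) = H s + of_nat k * of_int n * p"
      if "s \<in> S" for s and k :: nat
    proof (induction k)
      case (Suc k)
      then show ?case
        using step[of "s + of_nat k * p"] pS[of "s + of_nat k * p"] by (simp add: algebra_simps)
    qed (use that in simp)
    show ?thesis
    proof (cases "k \<ge> 0")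
      case True
      then show ?thesis using nat[OF \<open>s \<in> S\<close>, of "nat k"] by simp
    next
      case False
      \<comment> \<open>A negative number of turns is counted from its endpoint: the natural case is
        applied at the shifted point with \<open>-k\<close> turns.\<close>
      have "s + of_int k * p \<in> S" using \<open>s \<in> S\<close> by (simp add: S_def p_def)
      then show ?thesis using nat[of "s + of_int k * p" "nat (-k)"] False by (simp add: algebra_simps)
    qed
  qed
  have "winding_number (g \<circ> \<gamma>) (g z) = of_int n * winding_number \<gamma> z" if "punctured_loop z R \<gamma>" for \<gamma>
  proof -
    have \<gamma>: "path \<gamma>" "pathfinish \<gamma> = pathstart \<gamma>" "path_image \<gamma> \<subseteq> ball z R - {z}"
      using that by (auto simp: punctured_loop_def)
    then have "z \<notin> path_image \<gamma>" by auto
    from winding_number_as_continuous_log[OF \<gamma>(1) this] obtain q where q: "path q"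
      "pathfinish q - pathstart q = p * winding_number \<gamma> z"
      "\<And>t. t \<in> {0..1} \<Longrightarrow> \<gamma> t = z + exp (q t)"
      unfolding p_def by metis
    obtain k :: int where k: "winding_number \<gamma> z = of_int k"
      using integer_winding_number[OF \<gamma>(1,2)] \<open>z \<notin> path_image \<gamma>\<close> by (auto elim: Ints_cases)
    have qS: "q t \<in> S" if "t \<in> {0..1}" for t
    proof -
      have "\<gamma> t \<in> path_image \<gamma>" using that by (simp add: path_image_def)
      then have "\<gamma> t \<in> ball z R" using \<gamma>(3) by blast
      then show ?thesis using q(3)[OF that] inS[of "q t"] by simp
    qed
    have "path (H \<circ> q)" unfolding path_def
      by (intro continuous_on_compose continuous_on_subset[OF H(1)])
        (use q(1) qS in \<open>auto simp: path_def\<close>)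
    have "winding_number (g \<circ> \<gamma>) (g z) = winding_number (\<lambda>t. g z + exp ((H \<circ> q) t)) (g z)"
    proof (rule winding_number_cong)
      fix t :: real assume "0 \<le> t" "t \<le> 1"
      then show "(g \<circ> \<gamma>) t = g z + exp ((H \<circ> q) t)"
        using q(3)[of t] qS[of t] H(2)[of "q t"] by (simp add: diff_eq_eq add.commute)
    qed
    also have "\<dots> = (H (q 1) - H (q 0)) / p"
      by (subst winding_number_exp[OF \<open>path (H \<circ> q)\<close>]) (simp add: pathfinish_def pathstart_def p_def)
    also have "q 1 = q 0 + of_int k * p"
      using q(2) k by (simp add: pathfinish_def pathstart_def algebra_simps)
    also have "H \<dots> = H (q 0) + of_int k * of_int n * p" by (rule steps) (use qS in auto)
    finally show ?thesis using p0 k by (simp add: comp_def)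
  qed
  then show ?thesis using assms by (auto simp: turning_on_def)
qed

lemma turning_exists:
  assumes "open U" "z \<in> U" "continuous_on U g" "\<And>w. w \<in> U - {z} \<Longrightarrow> g w \<noteq> g z"
  shows "\<exists>n. turning g z n"
proof -
  obtain R where R: "0 < R" "ball z R \<subseteq> U" using assms(1,2) openE by blast
  have "\<exists>n. turning_on R g z n"
    using R by (intro turning_on_exists continuous_on_subset[OF assms(3)]) (use assms(4) in auto)
  then show ?thesis by (auto simp: turning_def)
qed

text \<open>On a disc so small that \<open>g\<close> maps it into the disc of \<open>h\<close>, a
  loop avoiding \<open>z\<close> has an image avoiding \<open>g z\<close>, to which the degree of
  \<open>h\<close> applies.\<close>

lemma turning_compose:
  assumes "turning g z m" "turning h (g z) n"
  shows "turning (h \<circ> g) z (n * m)"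
proof -
  obtain R S where R: "turning_on R g z m" and S: "turning_on S h (g z) n"
    using assms by (auto simp: turning_def)
  have pos: "0 < R" "0 < S" using R S by (auto simp: turning_on_def)
  have "continuous_on (ball z R) g" using R by (auto simp: turning_on_def)
  then have "open (ball z R \<inter> g -` ball (g z) S)"
    by (rule continuous_open_preimage) auto
  then obtain r where r: "0 < r" "ball z r \<subseteq> ball z R \<inter> g -` ball (g z) S"
    using pos openE[of "ball z R \<inter> g -` ball (g z) S" z] by auto
  then have "r \<le> R" using ball_subset_ball_iff[of z r z R] by auto
  have Rr: "turning_on r g z m" using turning_on_mono R r(1) \<open>r \<le> R\<close> by blast
  have "turning_on r (h \<circ> g) z (n * m)"
    unfolding turning_on_def
  proof (intro conjI ballI allI impI)
    show "continuous_on (ball z r) (h \<circ> g)"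
    proof (rule continuous_on_compose)
      show "continuous_on (ball z r) g" using Rr by (simp add: turning_on_def)
      have "continuous_on (ball (g z) S) h" using S by (simp add: turning_on_def)
      then show "continuous_on (g ` ball z r) h"
        by (rule continuous_on_subset) (use r(2) in blast)
    qed
    show "(h \<circ> g) w \<noteq> (h \<circ> g) z" if "w \<in> ball z r - {z}" for w
    proof -
      have "g w \<noteq> g z" using that Rr by (simp add: turning_on_def)
      moreover have "g w \<in> ball (g z) S" using that r(2) by auto
      ultimately show ?thesis using S by (simp add: turning_on_def)
    qed
    fix \<gamma> assume \<gamma>: "punctured_loop z r \<gamma>"
    then have im: "path_image \<gamma> \<subseteq> ball z r - {z}" by (simp add: punctured_loop_def)
    have gi: "g ` path_image \<gamma> \<subseteq> ball (g z) S - {g z}"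
    proof
      fix y assume "y \<in> g ` path_image \<gamma>"
      then obtain w where w: "w \<in> ball z r - {z}" "y = g w" using im by blast
      then have "g w \<noteq> g z" using Rr by (simp add: turning_on_def)
      then show "y \<in> ball (g z) S - {g z}" using w r(2) by auto
    qed
    have "path (g \<circ> \<gamma>)"
    proof (rule path_continuous_image)
      show "path \<gamma>" using \<gamma> by (simp add: punctured_loop_def)
      have "continuous_on (ball z r) g" using Rr by (simp add: turning_on_def)
      then show "continuous_on (path_image \<gamma>) g"
        by (rule continuous_on_subset) (use im in blast)
    qed
    have "punctured_loop (g z) S (g \<circ> \<gamma>)"
      using gi \<gamma> \<open>path (g \<circ> \<gamma>)\<close> unfolding punctured_loop_def
      by (simp add: path_image_compose pathstart_compose pathfinish_compose)
    then have "winding_number (h \<circ> (g \<circ> \<gamma>)) (h (g z)) = of_int n * winding_number (g \<circ> \<gamma>) (g z)"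
      using S unfolding turning_on_def by blast
    also have "winding_number (g \<circ> \<gamma>) (g z) = of_int m * winding_number \<gamma> z"
      using Rr \<gamma> unfolding turning_on_def by blast
    finally show "winding_number (h \<circ> g \<circ> \<gamma>) ((h \<circ> g) z) = of_int (n * m) * winding_number \<gamma> z"
      by (simp add: comp_def)
  qed (use r in auto)
  then show ?thesis by (auto simp: turning_def)
qed

lemma turning_cong:
  assumes "turning g z n" "open U" "z \<in> U" and eq: "\<And>w. w \<in> U \<Longrightarrow> h w = g w"
  shows "turning h z n"
proof -
  obtain R where R: "turning_on R g z n" using assms by (auto simp: turning_def)
  obtain r where r: "0 < r" "ball z r \<subseteq> U" using assms(2,3) openE by blast
  define s where "s = min r R"
  have s: "turning_on s g z n"
    using R r by (intro turning_on_mono[OF R]) (auto simp: s_def turning_on_def)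
  have eq': "h w = g w" if "w \<in> ball z s" for w
    using that r(2) by (intro eq) (auto simp: s_def)
  have "turning_on s h z n"
    unfolding turning_on_def
  proof (intro conjI ballI allI impI)
    show "0 < s" "continuous_on (ball z s) h"
      using s eq' unfolding turning_on_def by (auto cong: continuous_on_cong_simp)
    show "h w \<noteq> h z" if "w \<in> ball z s - {z}" for w
      using that s eq'[of w] eq'[of z] by (auto simp: turning_on_def)
    fix \<gamma> assume \<gamma>: "punctured_loop z s \<gamma>"
    have "winding_number (h \<circ> \<gamma>) (h z) = winding_number (g \<circ> \<gamma>) (g z)"
      using \<gamma> eq' \<open>0 < s\<close>
      by (subst eq'[of z]) (force simp: punctured_loop_def path_image_def intro!: winding_number_cong)+
    then show "winding_number (h \<circ> \<gamma>) (h z) = of_int n * winding_number \<gamma> z"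
      using s \<gamma> by (auto simp: turning_on_def)
  qed
  then show ?thesis by (auto simp: turning_def)
qed

lemma turning_id: "turning (\<lambda>w. w) z 1"
  unfolding turning_def turning_on_def by (intro exI[of _ 1]) (auto simp: comp_def)

lemma turning_power:
  assumes "0 < d"
  shows "turning (\<lambda>w. w ^ d) 0 (int d)"
proof -
  have "winding_number ((\<lambda>w. w ^ d) \<circ> \<gamma>) 0 = of_nat d * winding_number \<gamma> 0"
    if "punctured_loop 0 1 \<gamma>" for \<gamma>
  proof -
    have "path \<gamma>" "0 \<notin> path_image \<gamma>" using that by (auto simp: punctured_loop_def)
    from winding_number_as_continuous_log[OF this] obtain q where q: "path q"
      "pathfinish q - pathstart q = 2 * of_real pi * \<i> * winding_number \<gamma> 0"
      "\<And>t. t \<in> {0..1} \<Longrightarrow> \<gamma> t = 0 + exp (q t)"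
      by metis
    have "path (\<lambda>t. of_nat d * q t)" using q(1) unfolding path_def by (intro continuous_intros)
    have "winding_number ((\<lambda>w. w ^ d) \<circ> \<gamma>) 0 = winding_number (\<lambda>t. 0 + exp (of_nat d * q t)) 0"
      by (rule winding_number_cong) (simp add: q(3) exp_of_nat_mult)
    also have "\<dots> = of_nat d * ((pathfinish q - pathstart q) / (2 * of_real pi * \<i>))"
      by (subst winding_number_exp[OF \<open>path (\<lambda>t. of_nat d * q t)\<close>])
        (simp add: pathfinish_def pathstart_def algebra_simps)
    finally show ?thesis using q(2) by simp
  qed
  then show ?thesis
    using assms unfolding turning_def turning_on_def
    by (intro exI[of _ 1]) (auto intro!: continuous_intros simp: power_0_left)
qed

text \<open>Injectivity of \<open>k\<close> guarantees that it has a degree; the composite is the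
  identity near \<open>z\<close>, so the product of the degrees is 1. Over the integers this leaves
  only two units.\<close>

lemma turning_inverse:
  assumes U: "open U" "z \<in> U" and V: "open V" "continuous_on V k" "g ` U \<subseteq> V"
    and kg: "\<And>w. w \<in> U \<Longrightarrow> k (g w) = w"
    and inj: "inj_on k V" and t: "turning g z m"
  shows "\<exists>n. turning k (g z) n \<and> n * m = 1"
proof -
  have gz: "g z \<in> V" using U V by auto
  have "k w \<noteq> k (g z)" if "w \<in> V - {g z}" for w
    using that gz inj_onD[OF inj, of w "g z"] by auto
  then obtain n where n: "turning k (g z) n"
    using turning_exists[OF V(1) gz V(2)] by blast
  have "turning (k \<circ> g) z (n * m)" by (rule turning_compose[OF t n])
  moreover have "turning (k \<circ> g) z 1"
    by (rule turning_cong[OF turning_id U]) (simp add: kg)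
  ultimately show ?thesis using n turning_unique by blast
qed

text \<open>The two sides differ in scale: winding is tested on circles of any radius that bound a
  disc in \<open>U\<close>, the degree on arbitrarily small discs. They agree because a single
  integer serves a whole punctured disc on which \<open>h\<close> is injective.\<close>

lemma preserves_winding_iff:
  assumes "open U" "continuous_on U h" "inj_on h U"
  shows "preserves_winding U h \<longleftrightarrow> (\<forall>z\<in>U. turning h z 1)"
proof
  have ex: "\<exists>n. turning_on R h z n" if "0 < R" "ball z R \<subseteq> U" for z R
  proof (rule turning_on_exists[OF that(1)])
    show "continuous_on (ball z R) h" using that assms by (meson continuous_on_subset)
    show "h w \<noteq> h z" if "w \<in> ball z R - {z}" for w
      using that \<open>ball z R \<subseteq> U\<close> \<open>0 < R\<close> assms(3)
      by (metis DiffD1 DiffD2 centre_in_ball inj_onD insertI1 subsetD)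
  qed
  {
    assume L: "preserves_winding U h"
    show "\<forall>z\<in>U. turning h z 1"
    proof
      fix z assume "z \<in> U"
      then obtain R where R: "0 < R" "ball z R \<subseteq> U" using assms(1) openE by blast
      then obtain n where n: "turning_on R h z n" using ex by blast
      have "cball z (R/2) \<subseteq> ball z R" using R by (auto simp: subset_iff)
      then have "winding_number (h \<circ> circlepath z (R/2)) (h z) = 1"
        using L R unfolding preserves_winding_def by (meson dual_order.trans half_gt_zero)
      moreover have "winding_number (h \<circ> circlepath z (R/2)) (h z) = of_int n"
        using turning_on_circlepath[OF n] R by simp
      ultimately have "n = 1" by (metis of_int_eq_1_iff)
      then show "turning h z 1" using n by (auto simp: turning_def)
    qed
  }
  {
    assume R: "\<forall>z\<in>U. turning h z 1"
    show "preserves_winding U h"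
      unfolding preserves_winding_def
    proof (intro allI impI)
      fix z r assume zr: "0 < r \<and> cball z r \<subseteq> U"
      \<comment> \<open>The degree lives on open discs, so the closed disc is first thickened inside
        \<open>U\<close>, using compactness.\<close>
      obtain e where e: "0 < e" "(\<Union>x\<in>cball z r. ball x e) \<subseteq> U"
        using compact_subset_open_imp_ball_epsilon_subset[of "cball z r" U] zr assms(1) by auto
      have "ball z (r + e) \<subseteq> U"
      proof
        fix w assume w: "w \<in> ball z (r + e)"
        show "w \<in> U"
        proof (cases "w \<in> cball z r")
          case True then show ?thesis using zr by auto
        next
          case False
          then have wz: "r < cmod (w - z)" by (simp add: dist_norm norm_minus_commute)
          \<comment> \<open>The radial projection of \<open>w\<close> to the circle of radius
            \<open>r\<close>; it lies at distance \<open>cmod (w - z) - r\<close> from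
            \<open>w\<close>.\<close>
          define u where "u = z + of_real (r / cmod (w - z)) * (w - z)"
          have "w \<noteq> z" using wz zr by auto
          then have "cmod (u - z) = r" using zr by (simp add: u_def norm_mult norm_divide)
          then have "u \<in> cball z r" by (simp add: dist_norm norm_minus_commute)
          moreover have "w - u = of_real (1 - r / cmod (w - z)) * (w - z)"
            by (simp add: u_def algebra_simps)
          then have "cmod (w - u) = (1 - r / cmod (w - z)) * cmod (w - z)"
            using wz zr by (simp only: norm_mult norm_of_real) (simp add: field_simps)
          then have "cmod (w - u) = cmod (w - z) - r" using \<open>w \<noteq> z\<close> by (simp add: left_diff_distrib)
          then have "w \<in> ball u e" using w by (simp add: dist_norm norm_minus_commute)
          ultimately show ?thesis using e(2) by blast
        qed
      qed
      then obtain n where n: "turning_on (r + e) h z n" using ex[of "r + e" z] zr e by auto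
      have "z \<in> U" using zr by auto
      moreover have "turning h z n" using n by (auto simp: turning_def)
      ultimately have "n = 1" using R turning_unique by blast
      then show "winding_number (h \<circ> circlepath z r) (h z) = 1"
        using turning_on_circlepath[OF n, of r] zr e by simp
    qed
  }
qed

section \<open>Local degrees of maps between oriented surfaces\<close>

definition oriented_surface :: "(complex \<Rightarrow> 'a::topological_space) set \<Rightarrow> 'a set \<Rightarrow> bool" where
  "oriented_surface P X \<longleftrightarrow>
     X = (\<Union>\<sigma>\<in>P. range \<sigma>) \<and>
     (\<forall>\<sigma>\<in>P. openin (top_of_set X) (range \<sigma>) \<and> homeomorphism UNIV (range \<sigma>) \<sigma> (inv \<sigma>))"

text \<open>One integer has to serve every pair of charts about \<open>x\<close> and
  \<open>F x\<close>, so agreement of the orientations of overlapping charts is part of the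
  condition.\<close>

definition local_degree ::
  "(complex \<Rightarrow> 'a) set \<Rightarrow> (complex \<Rightarrow> 'b) set \<Rightarrow> ('a \<Rightarrow> 'b) \<Rightarrow> 'a \<Rightarrow> int \<Rightarrow> bool" where
  "local_degree P Q F x n \<longleftrightarrow>
     (\<forall>\<sigma>\<in>P. \<forall>\<tau>\<in>Q. \<forall>z. \<sigma> z = x \<and> F x \<in> range \<tau> \<longrightarrow> turning (inv \<tau> \<circ> F \<circ> \<sigma>) z n)"

lemma oriented_surface_plane: "oriented_surface plane_params UNIV"
  unfolding oriented_surface_def plane_params_def
  by (auto simp: inv_id homeomorphism_def)

lemma homeomorphism_UNIV_inv:
  assumes "homeomorphism UNIV Y \<sigma> \<sigma>'"
  shows "homeomorphism UNIV (range \<sigma>) \<sigma> (inv \<sigma>)"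
proof -
  have Y: "Y = range \<sigma>" using assms by (auto simp: homeomorphism_def)
  have "inj \<sigma>" using assms by (metis UNIV_I homeomorphism_apply1 injI)
  then have "\<sigma>' y = inv \<sigma> y" if "y \<in> Y" for y
    using that Y assms by (metis UNIV_I f_inv_into_f homeomorphism_apply1)
  then show ?thesis using assms Y by (metis homeomorphism_cong)
qed

lemma oriented_surfaceD:
  assumes "oriented_surface P X" "\<sigma> \<in> P"
  shows "continuous_on UNIV \<sigma>" "continuous_on (range \<sigma>) (inv \<sigma>)" "inj \<sigma>" "range \<sigma> \<subseteq> X"
    "openin (top_of_set X) (range \<sigma>)"
proof -
  have h: "homeomorphism UNIV (range \<sigma>) \<sigma> (inv \<sigma>)"
    using assms by (simp add: oriented_surface_def)
  then show "continuous_on UNIV \<sigma>" "continuous_on (range \<sigma>) (inv \<sigma>)"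
    by (auto simp: homeomorphism_def)
  show "inj \<sigma>" using h by (metis UNIV_I homeomorphism_apply1 injI)
  show "range \<sigma> \<subseteq> X" "openin (top_of_set X) (range \<sigma>)"
    using assms by (auto simp: oriented_surface_def)
qed

lemma
  assumes P: "oriented_surface P X" and Q: "oriented_surface Q Y"
    and N: "openin (top_of_set X) N" "continuous_on N F" "F ` N \<subseteq> Y" and "\<sigma> \<in> P" "\<tau> \<in> Q"
  shows open_coordinate_domain: "open {z. \<sigma> z \<in> N \<and> F (\<sigma> z) \<in> range \<tau>}" (is "open ?D")
    and continuous_on_coordinates: "continuous_on {z. \<sigma> z \<in> N \<and> F (\<sigma> z) \<in> range \<tau>} (inv \<tau> \<circ> F \<circ> \<sigma>)"
proof -
  note \<sigma> = oriented_surfaceD[OF P \<open>\<sigma> \<in> P\<close>] and \<tau> = oriented_surfaceD[OF Q \<open>\<tau> \<in> Q\<close>]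
  obtain W where W: "open W" "N = X \<inter> W" using N(1) by (auto simp: openin_open)
  obtain W' where W': "open W'" "range \<tau> = Y \<inter> W'" using \<tau>(5) by (auto simp: openin_open)
  have "open (\<sigma> -` W)" using W(1) \<sigma>(1) by (rule open_vimage)
  moreover have eqN: "\<sigma> -` W = {z. \<sigma> z \<in> N}" using W(2) \<sigma>(4) by auto
  ultimately have A: "open {z. \<sigma> z \<in> N}" by simp
  have cF: "continuous_on {z. \<sigma> z \<in> N} (F \<circ> \<sigma>)"
    by (intro continuous_on_compose continuous_on_subset[OF \<sigma>(1)] continuous_on_subset[OF N(2)]) auto
  then have "open ({z. \<sigma> z \<in> N} \<inter> (F \<circ> \<sigma>) -` W')"
    by (rule continuous_open_preimage[OF _ A W'(1)])
  moreover have "{z. \<sigma> z \<in> N} \<inter> (F \<circ> \<sigma>) -` W' = ?D" using W'(2) N(3) by auto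
  ultimately show "open ?D" by simp
  have "continuous_on ?D (inv \<tau> \<circ> (F \<circ> \<sigma>))"
    by (intro continuous_on_compose continuous_on_subset[OF cF] continuous_on_subset[OF \<tau>(2)]) auto
  then show "continuous_on ?D (inv \<tau> \<circ> F \<circ> \<sigma>)" by (simp add: comp_assoc)
qed

text \<open>Near \<open>z\<close> the chart \<open>\<rho>\<close> and its inverse can be inserted
  after \<open>F\<close>, and degrees multiply. The map \<open>h\<close> into the plane is
  arbitrary, so the lemma serves maps between surfaces as well as quotient maps.\<close>

lemma turning_through_coordinate:
  assumes P: "oriented_surface P X" and Q: "oriented_surface Q Y"
    and N: "openin (top_of_set X) N" "continuous_on N F" "F ` N \<subseteq> Y" "\<sigma> z \<in> N"
    and "\<sigma> \<in> P" "\<rho> \<in> Q" "F (\<sigma> z) \<in> range \<rho>"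
    and m: "turning (inv \<rho> \<circ> F \<circ> \<sigma>) z m"
    and n: "turning (h \<circ> \<rho>) (inv \<rho> (F (\<sigma> z))) n"
  shows "turning (h \<circ> F \<circ> \<sigma>) z (n * m)"
proof (rule turning_cong)
  show "turning ((h \<circ> \<rho>) \<circ> (inv \<rho> \<circ> F \<circ> \<sigma>)) z (n * m)"
    by (rule turning_compose[OF m]) (use n in simp)
  show "open {z. \<sigma> z \<in> N \<and> F (\<sigma> z) \<in> range \<rho>}"
    using open_coordinate_domain[OF P Q N(1,2,3)] assms by blast
qed (use assms in \<open>auto simp: f_inv_into_f\<close>)

lemma local_degree_compose:
  assumes P: "oriented_surface P X" and Q: "oriented_surface Q Y"
    and N: "openin (top_of_set X) N" "continuous_on N F" "F ` N \<subseteq> Y" "x \<in> N"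
    and m: "local_degree P Q F x m" and n: "local_degree Q R G (F x) n"
  shows "local_degree P R (G \<circ> F) x (n * m)"
  unfolding local_degree_def
proof (intro ballI allI impI)
  fix \<sigma> \<tau> z assume \<sigma>: "\<sigma> \<in> P" and \<tau>: "\<tau> \<in> R" and z: "\<sigma> z = x \<and> (G \<circ> F) x \<in> range \<tau>"
  have "F x \<in> Y" using N by auto
  then obtain \<rho> where \<rho>: "\<rho> \<in> Q" "F x \<in> range \<rho>" using Q by (auto simp: oriented_surface_def)
  have "turning ((inv \<tau> \<circ> G) \<circ> F \<circ> \<sigma>) z (n * m)"
  proof (rule turning_through_coordinate[OF P Q N(1,2,3)])
    show "turning (inv \<rho> \<circ> F \<circ> \<sigma>) z m"
      using m \<sigma> \<rho> z by (auto simp: local_degree_def)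
    have "\<rho> (inv \<rho> (F (\<sigma> z))) = F x" using \<rho> z by (simp add: f_inv_into_f)
    then show "turning (inv \<tau> \<circ> G \<circ> \<rho>) (inv \<rho> (F (\<sigma> z))) n"
      using n \<tau> \<rho> z by (simp add: local_degree_def)
  qed (use \<sigma> \<rho> z N in auto)
  then show "turning (inv \<tau> \<circ> (G \<circ> F) \<circ> \<sigma>) z (n * m)" by (simp add: comp_assoc)
qed

lemma local_degree_cong:
  assumes P: "oriented_surface P X" and n: "local_degree P Q F x n"
    and N: "openin (top_of_set X) N" "x \<in> N" and eq: "\<And>u. u \<in> N \<Longrightarrow> G u = F u"
  shows "local_degree P Q G x n"
  unfolding local_degree_def
proof (intro ballI allI impI)
  fix \<sigma> \<tau> z assume \<sigma>: "\<sigma> \<in> P" and \<tau>: "\<tau> \<in> Q" and z: "\<sigma> z = x \<and> G x \<in> range \<tau>"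
  obtain W where W: "open W" "N = X \<inter> W" using N(1) by (auto simp: openin_open)
  show "turning (inv \<tau> \<circ> G \<circ> \<sigma>) z n"
  proof (rule turning_cong)
    show "turning (inv \<tau> \<circ> F \<circ> \<sigma>) z n"
      using n \<sigma> \<tau> z eq[OF N(2)] by (auto simp: local_degree_def)
    show "open (\<sigma> -` W)" using oriented_surfaceD(1)[OF P \<sigma>] W(1) by (metis open_vimage)
    show "z \<in> \<sigma> -` W" using z N W by auto
    show "(inv \<tau> \<circ> G \<circ> \<sigma>) w = (inv \<tau> \<circ> F \<circ> \<sigma>) w" if "w \<in> \<sigma> -` W" for w
    proof -
      have "\<sigma> w \<in> N" using that W(2) oriented_surfaceD(4)[OF P \<sigma>] by auto
      then show ?thesis using eq by simp
    qed
  qed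
qed

section \<open>Orientation-preserving homeomorphisms as homeomorphisms of degree one\<close>

lemma turning_homeomorphism_coordinates:
  assumes P: "oriented_surface P X" and Q: "oriented_surface Q Y"
    and U: "openin (top_of_set X) U" and V: "openin (top_of_set Y) V"
    and h: "homeomorphism U V \<phi> \<phi>'"
    and c: "\<sigma> \<in> P" "\<tau> \<in> Q" "\<sigma> z \<in> U" "\<phi> (\<sigma> z) \<in> range \<tau>"
    and m: "turning (inv \<tau> \<circ> \<phi> \<circ> \<sigma>) z m"
  shows "\<exists>n. turning (inv \<sigma> \<circ> \<phi>' \<circ> \<tau>) (inv \<tau> (\<phi> (\<sigma> z))) n \<and> n * m = 1"
proof -
  let ?A = "{z. \<sigma> z \<in> U \<and> \<phi> (\<sigma> z) \<in> range \<tau>}" and ?B = "{z. \<tau> z \<in> V \<and> \<phi>' (\<tau> z) \<in> range \<sigma>}"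
  have sub: "U \<subseteq> X" "V \<subseteq> Y" using U V openin_imp_subset by auto
  note h' = h[unfolded homeomorphism_def]
  note \<sigma> = oriented_surfaceD[OF P c(1)] and \<tau> = oriented_surfaceD[OF Q c(2)]
  have oA: "open ?A" by (rule open_coordinate_domain[OF P Q U]) (use h' sub c in auto)
  have oB: "open ?B" "continuous_on ?B (inv \<sigma> \<circ> \<phi>' \<circ> \<tau>)"
    using open_coordinate_domain[OF Q P V _ _ c(2,1), of \<phi>']
      continuous_on_coordinates[OF Q P V _ _ c(2,1), of \<phi>'] h' sub by auto
  have "inj_on (inv \<sigma> \<circ> \<phi>' \<circ> \<tau>) ?B"
  proof (rule inj_onI)
    fix a b assume a: "a \<in> ?B" and b: "b \<in> ?B" and "(inv \<sigma> \<circ> \<phi>' \<circ> \<tau>) a = (inv \<sigma> \<circ> \<phi>' \<circ> \<tau>) b"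
    then have "\<sigma> (inv \<sigma> (\<phi>' (\<tau> a))) = \<sigma> (inv \<sigma> (\<phi>' (\<tau> b)))" by simp
    then have "\<phi>' (\<tau> a) = \<phi>' (\<tau> b)" using a b by (simp add: f_inv_into_f)
    then have "\<tau> a = \<tau> b" using a b h by (metis (lifting) homeomorphism_apply2 mem_Collect_eq)
    then show "a = b" using \<tau>(3) by (simp add: inj_eq)
  qed
  note inj = this
  have "\<exists>n. turning (inv \<sigma> \<circ> \<phi>' \<circ> \<tau>) ((inv \<tau> \<circ> \<phi> \<circ> \<sigma>) z) n \<and> n * m = 1"
  proof (rule turning_inverse[OF oA _ oB _ _ inj m])
    show "z \<in> ?A" using c by auto
    show "(inv \<tau> \<circ> \<phi> \<circ> \<sigma>) ` ?A \<subseteq> ?B"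
    proof safe
      fix w b assume "\<sigma> w \<in> U" "\<phi> (\<sigma> w) = \<tau> b"
      moreover then have "\<tau> (inv \<tau> (\<phi> (\<sigma> w))) = \<phi> (\<sigma> w)" by (simp add: f_inv_into_f)
      ultimately show "\<tau> ((inv \<tau> \<circ> \<phi> \<circ> \<sigma>) w) \<in> V" "\<phi>' (\<tau> ((inv \<tau> \<circ> \<phi> \<circ> \<sigma>) w)) \<in> range \<sigma>"
        using h' by (metis comp_apply image_eqI, metis comp_apply rangeI)
    qed
    show "(inv \<sigma> \<circ> \<phi>' \<circ> \<tau>) ((inv \<tau> \<circ> \<phi> \<circ> \<sigma>) w) = w" if "w \<in> ?A" for w
      using that h' \<sigma>(3) by (auto simp: f_inv_into_f)
  qed
  then show ?thesis by simp
qed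

text \<open>The bridge from the winding condition in charts to degrees at points. Inverses,
  composites and restrictions of orientation-preserving homeomorphisms then reduce to
  multiplicativity of the degree.\<close>

lemma oriented_homeo_iff:
  assumes P: "oriented_surface P X" and Q: "oriented_surface Q Y"
    and U: "openin (top_of_set X) U" and V: "openin (top_of_set Y) V"
    and h: "homeomorphism U V \<phi> \<phi>'"
  shows "oriented_homeo P U Q V \<phi> \<longleftrightarrow> (\<forall>x\<in>U. local_degree P Q \<phi> x 1)"
proof -
  have "preserves_winding {z. \<sigma> z \<in> U \<and> \<phi> (\<sigma> z) \<in> range \<tau>} (inv \<tau> \<circ> \<phi> \<circ> \<sigma>) \<longleftrightarrow>
      (\<forall>z. \<sigma> z \<in> U \<and> \<phi> (\<sigma> z) \<in> range \<tau> \<longrightarrow> turning (inv \<tau> \<circ> \<phi> \<circ> \<sigma>) z 1)"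
    if c: "\<sigma> \<in> P" "\<tau> \<in> Q" for \<sigma> \<tau>
  proof -
    let ?A = "{z. \<sigma> z \<in> U \<and> \<phi> (\<sigma> z) \<in> range \<tau>}"
    have "V \<subseteq> Y" using V openin_imp_subset by auto
    then have *: "continuous_on U \<phi>" "\<phi> ` U \<subseteq> Y" using h by (auto simp: homeomorphism_def)
    have "inj_on (inv \<tau> \<circ> \<phi> \<circ> \<sigma>) ?A"
    proof (rule inj_onI)
      fix a b assume a: "a \<in> ?A" and b: "b \<in> ?A" and "(inv \<tau> \<circ> \<phi> \<circ> \<sigma>) a = (inv \<tau> \<circ> \<phi> \<circ> \<sigma>) b"
      then have "\<tau> (inv \<tau> (\<phi> (\<sigma> a))) = \<tau> (inv \<tau> (\<phi> (\<sigma> b)))" by simp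
      then have "\<phi> (\<sigma> a) = \<phi> (\<sigma> b)" using a b by (simp add: f_inv_into_f)
      then have "\<sigma> a = \<sigma> b" using a b h by (metis (lifting) homeomorphism_apply1 mem_Collect_eq)
      then show "a = b" using oriented_surfaceD(3)[OF P c(1)] by (simp add: inj_eq)
    qed
    then show ?thesis
      using preserves_winding_iff[OF open_coordinate_domain[OF P Q U * c]
          continuous_on_coordinates[OF P Q U * c]] by auto
  qed
  then show ?thesis
    using h unfolding oriented_homeo_def local_degree_def by (auto 0 4)
qed

lemma oriented_homeo_homeomorphism:
  assumes "oriented_homeo P U Q V \<phi>"
  obtains \<phi>' where "homeomorphism U V \<phi> \<phi>'"
  using assms by (auto simp: oriented_homeo_def)

lemma oriented_homeo_sym:
  assumes P: "oriented_surface P X" and Q: "oriented_surface Q Y"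
    and U: "openin (top_of_set X) U" and V: "openin (top_of_set Y) V"
    and h: "homeomorphism U V \<phi> \<phi>'" and o: "oriented_homeo P U Q V \<phi>"
  shows "oriented_homeo Q V P U \<phi>'"
proof -
  have d: "local_degree P Q \<phi> x 1" if "x \<in> U" for x
    using o that oriented_homeo_iff[OF P Q U V h] by auto
  have "local_degree Q P \<phi>' y 1" if "y \<in> V" for y
    unfolding local_degree_def
  proof (intro ballI allI impI)
    fix \<tau> \<sigma> z assume \<tau>: "\<tau> \<in> Q" and \<sigma>: "\<sigma> \<in> P" and z: "\<tau> z = y \<and> \<phi>' y \<in> range \<sigma>"
    then obtain w where w: "\<phi>' y = \<sigma> w" by auto
    have yw: "\<phi> (\<sigma> w) = y" "\<sigma> w \<in> U"
      using h that w by (metis homeomorphism_apply2, metis homeomorphism_def image_eqI)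
    have t: "turning (inv \<tau> \<circ> \<phi> \<circ> \<sigma>) w 1"
      using d[OF yw(2)] \<tau> \<sigma> z yw(1) unfolding local_degree_def by (metis rangeI)
    have "\<phi> (\<sigma> w) \<in> range \<tau>" using yw(1) z by (metis rangeI)
    from turning_homeomorphism_coordinates[OF P Q U V h \<sigma> \<tau> yw(2) this t]
     have "turning (inv \<sigma> \<circ> \<phi>' \<circ> \<tau>) (inv \<tau> y) 1" using yw(1) z by simp
    moreover have "inv \<tau> y = z" using z oriented_surfaceD(3)[OF Q \<tau>] by auto
    ultimately show "turning (inv \<sigma> \<circ> \<phi>' \<circ> \<tau>) z 1" by simp
  qed
  then show ?thesis
    using oriented_homeo_iff[OF Q P V U] homeomorphism_symD[OF h] by auto
qed

lemma oriented_homeo_trans: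
  assumes P: "oriented_surface P X" and Q: "oriented_surface Q Y" and R: "oriented_surface R Z"
    and U: "openin (top_of_set X) U" and V: "openin (top_of_set Y) V" and W: "openin (top_of_set Z) W"
    and o1: "oriented_homeo P U Q V \<phi>" and o2: "oriented_homeo Q V R W \<psi>"
  shows "oriented_homeo P U R W (\<psi> \<circ> \<phi>)"
proof -
  obtain \<phi>' where h1: "homeomorphism U V \<phi> \<phi>'" using o1 by (rule oriented_homeo_homeomorphism)
  obtain \<psi>' where h2: "homeomorphism V W \<psi> \<psi>'" using o2 by (rule oriented_homeo_homeomorphism)
  have "local_degree P R (\<psi> \<circ> \<phi>) x (1 * 1)" if "x \<in> U" for x
  proof (rule local_degree_compose[OF P Q U])
    have V': "\<phi> ` U = V" "continuous_on U \<phi>" using h1 by (auto simp: homeomorphism_def)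
    then show "continuous_on U \<phi>" "\<phi> ` U \<subseteq> Y" using openin_imp_subset[OF V] by auto
    show "local_degree P Q \<phi> x 1" using o1 that oriented_homeo_iff[OF P Q U V h1] by auto
    show "local_degree Q R \<psi> (\<phi> x) 1"
      using o2 that V' oriented_homeo_iff[OF Q R V W h2] by auto
  qed (use that in auto)
  then show ?thesis
    using oriented_homeo_iff[OF P R U W homeomorphism_compose[OF h1 h2]] by auto
qed

lemma oriented_homeo_restrict:
  assumes P: "oriented_surface P X" and Q: "oriented_surface Q Y"
    and U: "openin (top_of_set X) U" and V: "openin (top_of_set Y) V"
    and h: "homeomorphism U V \<phi> \<phi>'" and o: "oriented_homeo P U Q V \<phi>"
    and U': "openin (top_of_set X) U'" "U' \<subseteq> U" and V': "openin (top_of_set Y) (\<phi> ` U')"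
  shows "oriented_homeo P U' Q (\<phi> ` U') \<phi>"
proof -
  have "\<phi> ` U' \<subseteq> V" using h U'(2) by (auto simp: homeomorphism_def)
  then have "homeomorphism U' (\<phi> ` U') \<phi> \<phi>'"
    using homeomorphism_of_subsets[OF h U'(2)] by blast
  moreover have "local_degree P Q \<phi> x 1" if "x \<in> U'" for x
    using o that U'(2) oriented_homeo_iff[OF P Q U V h] by auto
  ultimately show ?thesis using oriented_homeo_iff[OF P Q U'(1) V'] by auto
qed

lemma oriented_disc_chart_transport:
  assumes P: "oriented_surface P X" and Q: "oriented_surface Q Y"
    and h: "homeomorphism X Y \<psi> \<psi>'" and o: "oriented_homeo P X Q Y \<psi>"
    and c: "oriented_disc_chart P X U \<alpha>"
  shows "oriented_disc_chart Q Y (\<psi> ` U) (\<alpha> \<circ> \<psi>')"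
proof -
  have U: "openin (top_of_set X) U" "U \<subseteq> X"
    using c openin_imp_subset by (auto simp: oriented_disc_chart_def)
  have V: "openin (top_of_set Y) (\<psi> ` U)"
    using homeomorphism_imp_open_map[OF h U(1)] .
  have bk: "\<psi>' ` \<psi> ` U = U"
  proof -
    have "\<psi>' (\<psi> u) = u" if "u \<in> U" for u using that U(2) homeomorphism_apply1[OF h] by blast
    then show ?thesis by (simp add: image_image)
  qed
  have sub: "\<psi> ` U \<subseteq> Y" using openin_imp_subset[OF V] .
  have "oriented_homeo Q (\<psi> ` U) P (\<psi>' ` \<psi> ` U) \<psi>'"
    by (rule oriented_homeo_restrict[OF Q P _ _ homeomorphism_symD[OF h]])
      (use oriented_homeo_sym[OF P Q _ _ h o] V sub U bk in auto)
  then have "oriented_homeo Q (\<psi> ` U) P U \<psi>'" by (simp add: bk)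
  moreover have "oriented_homeo P U plane_params (ball 0 1) \<alpha>"
    using c by (simp add: oriented_disc_chart_def)
  ultimately have "oriented_homeo Q (\<psi> ` U) plane_params (ball 0 1) (\<alpha> \<circ> \<psi>')"
    using oriented_homeo_trans[OF Q P oriented_surface_plane V U(1)] by auto
  then show ?thesis using V by (simp add: oriented_disc_chart_def)
qed

text \<open>Moving the source chart by \<open>\<psi>\<close> and the target chart by
  \<open>\<phi>\<close> leaves the formula in the charts untouched, so the exponent is carried over
  with them.\<close>

lemma has_local_degree_transport:
  assumes P: "oriented_surface P X" and Q: "oriented_surface Q Y"
    and h1: "homeomorphism X X \<psi> \<psi>'" and o1: "oriented_homeo P X P X \<psi>"
    and h2: "homeomorphism Y Y \<phi> \<phi>'" and o2: "oriented_homeo Q Y Q Y \<phi>"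
    and eq: "\<And>x. x \<in> X \<Longrightarrow> \<phi> (f x) = f' (\<psi> x)"
    and d: "has_local_degree P X Q Y f x d"
  shows "has_local_degree P X Q Y f' (\<psi> x) d"
proof -
  obtain U \<alpha> V \<beta> where c: "oriented_disc_chart P X U \<alpha>" "x \<in> U" "\<alpha> x = 0"
    "oriented_disc_chart Q Y V \<beta>" "f ` U \<subseteq> V" "\<beta> (f x) = 0" "\<forall>u\<in>U. \<beta> (f u) = \<alpha> u ^ d" and "0 < d"
    using d unfolding has_local_degree_def by blast
  have UX: "U \<subseteq> X" "V \<subseteq> Y" using c openin_imp_subset unfolding oriented_disc_chart_def by blast+
  have \<psi>: "\<psi>' (\<psi> u) = u" "f' (\<psi> u) = \<phi> (f u)" "\<phi>' (\<phi> (f u)) = f u" if "u \<in> U" for u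
  proof -
    have "u \<in> X" "f u \<in> Y" using that UX c(5) by auto
    then show "\<psi>' (\<psi> u) = u" "f' (\<psi> u) = \<phi> (f u)" "\<phi>' (\<phi> (f u)) = f u"
      using h1 h2 eq[of u] by (auto simp: homeomorphism_def)
  qed
  show ?thesis
    unfolding has_local_degree_def
  proof (intro conjI exI[of _ "\<psi> ` U"] exI[of _ "\<alpha> \<circ> \<psi>'"] exI[of _ "\<phi> ` V"] exI[of _ "\<beta> \<circ> \<phi>'"])
    show "oriented_disc_chart P X (\<psi> ` U) (\<alpha> \<circ> \<psi>')"
      by (rule oriented_disc_chart_transport[OF P P h1 o1 c(1)])
    show "oriented_disc_chart Q Y (\<phi> ` V) (\<beta> \<circ> \<phi>')"
      by (rule oriented_disc_chart_transport[OF Q Q h2 o2 c(4)])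
    show "f' ` \<psi> ` U \<subseteq> \<phi> ` V" using \<psi>(2) c(5) by auto
  qed (use \<psi> c \<open>0 < d\<close> in auto)
qed

text \<open>Near \<open>x\<close> the map is a power between two charts of degree 1, so the degree
  is the positive exponent. This is the only place where the orientation of a branched covering is
  extracted from its definition.\<close>

lemma branched_covering_local_degree:
  assumes P: "oriented_surface P X" and Q: "oriented_surface Q Y"
    and f: "oriented_branched_covering P X Q Y f" and x: "x \<in> X"
  shows "\<exists>d>0. local_degree P Q f x d"
proof -
  have "f x \<in> Y" using f x unfolding oriented_branched_covering_def by blast
  have "\<forall>y\<in>Y. \<exists>V \<beta>. y \<in> V \<and> oriented_disc_chart Q Y V \<beta> \<and> \<beta> y = 0 \<and>
        (\<forall>U\<in>components (X \<inter> f -` V). \<exists>\<alpha> d. 0 < d \<and> oriented_disc_chart P X U \<alpha> \<and>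
           (\<forall>x\<in>U. \<beta> (f x) = \<alpha> x ^ d))"
    using f unfolding oriented_branched_covering_def by (elim conjE)
  from bspec[OF this \<open>f x \<in> Y\<close>] obtain V \<beta> where V: "f x \<in> V" "oriented_disc_chart Q Y V \<beta>" "\<beta> (f x) = 0"
    and comp: "\<forall>U\<in>components (X \<inter> f -` V). \<exists>\<alpha> d. 0 < d \<and> oriented_disc_chart P X U \<alpha> \<and>
           (\<forall>x\<in>U. \<beta> (f x) = \<alpha> x ^ d)"
    by (elim exE conjE)
  have "x \<in> X \<inter> f -` V" using x V by auto
  then have "connected_component_set (X \<inter> f -` V) x \<in> components (X \<inter> f -` V)"
    "x \<in> connected_component_set (X \<inter> f -` V) x"
    by (rule componentsI, simp)
  then obtain U where U: "U \<in> components (X \<inter> f -` V)" "x \<in> U" by metis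
  obtain \<alpha> d where d: "0 < d" "oriented_disc_chart P X U \<alpha>" "\<forall>x\<in>U. \<beta> (f x) = \<alpha> x ^ d"
    using bspec[OF comp U(1)] by (elim exE conjE)
  have UV: "f ` U \<subseteq> V" using in_components_subset[OF U(1)] by blast
  have oU: "openin (top_of_set X) U" and \<alpha>: "oriented_homeo P U plane_params (ball 0 1) \<alpha>"
    using d(2) by (auto simp: oriented_disc_chart_def)
  have oV: "openin (top_of_set Y) V" and \<beta>: "oriented_homeo Q V plane_params (ball 0 1) \<beta>"
    using V(2) by (auto simp: oriented_disc_chart_def)
  have ball: "openin (top_of_set UNIV) (ball (0::complex) 1)" by simp
  obtain \<alpha>' where h\<alpha>: "homeomorphism U (ball 0 1) \<alpha> \<alpha>'" using \<alpha> by (rule oriented_homeo_homeomorphism)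
  obtain \<beta>' where h\<beta>: "homeomorphism V (ball 0 1) \<beta> \<beta>'" using \<beta> by (rule oriented_homeo_homeomorphism)
  \<comment> \<open>The target chart is centred at \<open>f x\<close>, which forces the source chart
    to be centred at \<open>x\<close>, the point where the degree of the power is known.\<close>
  have "\<alpha> x ^ d = 0" using d(3) U(2) V(3) by metis
  then have "\<alpha> x = 0" by simp
  have 1: "local_degree P plane_params \<alpha> x 1"
    using \<alpha> unfolding oriented_homeo_iff[OF P oriented_surface_plane oU ball h\<alpha>]
    by (rule bspec) (rule U(2))
  have 2: "local_degree plane_params plane_params (\<lambda>w. w ^ d) 0 (int d)"
    using turning_power[OF d(1)] unfolding local_degree_def plane_params_def by (simp add: comp_def)
  have "oriented_homeo plane_params (ball 0 1) Q V \<beta>'"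
    by (rule oriented_homeo_sym[OF Q oriented_surface_plane oV ball h\<beta> \<beta>])
  then have 3: "local_degree plane_params Q \<beta>' 0 1"
    unfolding oriented_homeo_iff[OF oriented_surface_plane Q ball oV homeomorphism_symD[OF h\<beta>]]
    by (rule bspec) simp
  have 4: "local_degree plane_params Q (\<beta>' \<circ> (\<lambda>w. w ^ d)) 0 (1 * int d)"
  proof (rule local_degree_compose[OF oriented_surface_plane oriented_surface_plane _ _ _ _ 2])
    show "openin (top_of_set UNIV) (UNIV::complex set)" by simp
    show "continuous_on UNIV (\<lambda>w::complex. w ^ d)" by (intro continuous_intros)
    show "local_degree plane_params Q \<beta>' (0 ^ d) 1" using 3 d(1) by (simp add: power_0_left)
  qed simp_all
  have "local_degree P Q (\<beta>' \<circ> (\<lambda>w. w ^ d) \<circ> \<alpha>) x (int d * 1)"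
  proof (rule local_degree_compose[OF P oriented_surface_plane oU _ _ U(2) 1])
    show "continuous_on U \<alpha>" using h\<alpha> by (simp add: homeomorphism_def)
    show "local_degree plane_params Q (\<beta>' \<circ> (\<lambda>w. w ^ d)) (\<alpha> x) (int d)"
      using 4 \<open>\<alpha> x = 0\<close> by simp
  qed simp
  then have "local_degree P Q f x (int d * 1)"
  proof (rule local_degree_cong[OF P _ oU U(2)])
    show "f u = (\<beta>' \<circ> (\<lambda>w. w ^ d) \<circ> \<alpha>) u" if "u \<in> U" for u
    proof -
      have "\<beta>' (\<beta> (f u)) = f u" using that UV homeomorphism_apply1[OF h\<beta>] by blast
      moreover have "\<beta> (f u) = \<alpha> u ^ d" by (rule bspec[OF d(3) that])
      ultimately have "f u = \<beta>' (\<alpha> u ^ d)" by argo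
      then show ?thesis by (simp only: comp_apply)
    qed
  qed
  then have "local_degree P Q f x (int d)" by (simp only: mult_1_right)
  moreover have "0 < int d" using d(1) by (simp only: of_nat_0_less_iff)
  ultimately show ?thesis by (intro exI[of _ "int d"] conjI)
qed

section \<open>The sphere as an oriented surface\<close>

lemma homeomorphism_param_north:
  "homeomorphism UNIV (S2 - {(0, 1)}) param_north (\<lambda>(w, t). w / of_real (1 - t))"
  unfolding homeomorphism_def
proof (intro conjI ballI)
  have pos: "(cmod w)\<^sup>2 + 1 \<noteq> 0" "complex_of_real ((cmod w)\<^sup>2 + 1) \<noteq> 0" for w
  proof -
    show "(cmod w)\<^sup>2 + 1 \<noteq> 0" by (smt (verit) zero_le_power2)
    then show "complex_of_real ((cmod w)\<^sup>2 + 1) \<noteq> 0" by (metis of_real_eq_0_iff)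
  qed
  show left: "(\<lambda>(w, t). w / of_real (1 - t)) (param_north x) = x" for x
  proof -
    have "1 - ((cmod x)\<^sup>2 - 1) / ((cmod x)\<^sup>2 + 1) = 2 / ((cmod x)\<^sup>2 + 1)"
      using pos[of x] by (simp add: field_simps)
    then have "(\<lambda>(w, t). w / of_real (1 - t)) (param_north x) =
        2 * x / of_real ((cmod x)\<^sup>2 + 1) / of_real (2 / ((cmod x)\<^sup>2 + 1))"
      by (simp only: param_north_def prod.case)
    also have "\<dots> = x" using pos(2)[of x] by (simp only: of_real_divide of_real_numeral) (simp del: of_real_add of_real_power)
    finally show ?thesis .
  qed
  have S2: "y \<in> S2 \<longleftrightarrow> (cmod (fst y))\<^sup>2 + (snd y)\<^sup>2 = 1" for y
    by (cases y) (simp add: S2_def dist_norm norm_Pair)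
  have lt: "snd y < 1" if "y \<in> S2 - {(0, 1)}" for y
  proof (rule ccontr)
    assume "\<not> snd y < 1"
    moreover have "(snd y)\<^sup>2 \<le> 1" using that S2[of y] by (smt (verit) zero_le_power2 DiffD1)
    then have "\<bar>snd y\<bar> \<le> 1" using abs_square_le_1 by blast
    ultimately have "snd y = 1" by linarith
    then have "fst y = 0" using that S2[of y] by auto
    then show False using \<open>snd y = 1\<close> that by (cases y) auto
  qed
  show right: "param_north ((\<lambda>(w, t). w / of_real (1 - t)) y) = y" if "y \<in> S2 - {(0, 1)}" for y
  proof -
    obtain w t where y: "y = (w, t)" by (cases y)
    have t: "t < 1" and wt: "(cmod w)\<^sup>2 = 1 - t\<^sup>2" using lt[OF that] S2[of y] that y by auto
    have sq: "(cmod (w / of_real (1 - t)))\<^sup>2 = (1 + t) / (1 - t)"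
    proof -
      have "(cmod (w / of_real (1 - t)))\<^sup>2 = (1 - t\<^sup>2) / (1 - t)\<^sup>2"
        using wt by (simp add: norm_divide power_divide del: of_real_diff)
      also have "1 - t\<^sup>2 = (1 + t) * (1 - t)" by (simp add: power2_eq_square algebra_simps)
      finally show ?thesis using t by (simp add: power2_eq_square)
    qed
    have "(cmod (w / of_real (1 - t)))\<^sup>2 + 1 = 2 / (1 - t)"
      "(cmod (w / of_real (1 - t)))\<^sup>2 - 1 = 2 * t / (1 - t)"
      unfolding sq using t by (simp_all add: field_simps)
    note n = this
    have "2 * (w / of_real (1 - t)) / of_real (2 / (1 - t)) = w"
      using t by (simp del: of_real_diff add: of_real_divide)
    then show ?thesis using t by (simp only: param_north_def y prod.case n) simp
  qed
  have sq1: "(cmod (2 * x / of_real ((cmod x)\<^sup>2 + 1)))\<^sup>2 + (((cmod x)\<^sup>2 - 1) / ((cmod x)\<^sup>2 + 1))\<^sup>2 = 1" for x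
  proof -
    have "(cmod (2 * x / of_real ((cmod x)\<^sup>2 + 1)))\<^sup>2 = (2 * cmod x)\<^sup>2 / ((cmod x)\<^sup>2 + 1)\<^sup>2"
      by (simp add: norm_divide norm_mult power_divide power_mult_distrib flip: of_real_power of_real_add)
    then show ?thesis using pos(1)[of x]
      by (simp add: power_divide flip: add_divide_distrib) (simp add: power2_eq_square algebra_simps)
  qed
  have mem: "param_north x \<in> S2 - {(0, 1)}" for x
    using sq1[of x] pos[of x] by (simp add: S2 param_north_def divide_eq_1_iff)
  show "param_north ` UNIV = S2 - {(0, 1)}"
  proof
    show "param_north ` UNIV \<subseteq> S2 - {(0, 1)}" by (rule image_subsetI) (rule mem)
    show "S2 - {(0, 1)} \<subseteq> param_north ` UNIV"
    proof
      fix y assume "y \<in> S2 - {(0, 1)}"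
      then have "y = param_north ((\<lambda>(w, t). w / of_real (1 - t)) y)" by (rule right[symmetric])
      then show "y \<in> param_north ` UNIV" by (rule image_eqI) simp
    qed
  qed
  show "(\<lambda>(w, t). w / of_real (1 - t)) ` (S2 - {(0, 1)}) = UNIV"
  proof (intro equalityI subsetI UNIV_I)
    fix x show "x \<in> (\<lambda>(w, t). w / of_real (1 - t)) ` (S2 - {(0, 1)})"
      by (rule image_eqI[where x = "param_north x"]) (rule left[symmetric], rule mem)
  qed
  show "continuous_on UNIV param_north"
    unfolding param_north_def using pos(1) pos(2) by (intro continuous_intros) simp_all
  show "continuous_on (S2 - {(0, 1)}) (\<lambda>(w, t). w / of_real (1 - t))"
    unfolding case_prod_unfold using lt by (intro continuous_intros) force
qed

lemma homeomorphism_param_south: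
  "homeomorphism UNIV (S2 - {(0, - 1)}) param_south (\<lambda>(w, t). cnj w / of_real (1 + t))"
proof -
  \<comment> \<open>The half turn of three-space about the real axis interchanges the poles and
    carries the first parametrization to the second.\<close>
  let ?r = "\<lambda>(w, t). (cnj w, - t) :: complex \<times> real"
  have r: "?r (?r y) = y" for y by (cases y) simp
  have "?r y \<in> S2" if "y \<in> S2" for y
    using that by (cases y) (simp add: S2_def norm_Pair)
  then have "homeomorphism (S2 - {(0, 1)}) (S2 - {(0, - 1)}) ?r ?r"
    using r by (intro homeomorphismI)
      (auto simp: case_prod_unfold complex_eq_iff prod_eq_iff intro!: continuous_intros)
  from homeomorphism_compose[OF homeomorphism_param_north this] 
  have "homeomorphism UNIV (S2 - {(0, - 1)}) (?r \<circ> param_north) ((\<lambda>(w, t). w / of_real (1 - t)) \<circ> ?r)" .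
  moreover have "?r \<circ> param_north = param_south"
    by (auto simp: fun_eq_iff param_north_def param_south_def minus_divide_left)
  moreover have "(\<lambda>(w, t). w / complex_of_real (1 - t)) \<circ> ?r = (\<lambda>(w, t). cnj w / of_real (1 + t))"
    by (auto simp: fun_eq_iff)
  ultimately show ?thesis by simp
qed

lemma oriented_surface_S2: "oriented_surface S2_params S2"
proof -
  have n: "range param_north = S2 - {(0, 1)}" and s: "range param_south = S2 - {(0, - 1)}"
    using homeomorphism_param_north homeomorphism_param_south by (auto simp: homeomorphism_def)
  have o: "openin (top_of_set S2) (S2 - {p})" for p
    by (simp add: openin_delete)
  have "S2 = (\<Union>\<sigma>\<in>S2_params. range \<sigma>)" unfolding S2_params_def using n s by auto
  then show ?thesis
    using homeomorphism_UNIV_inv[OF homeomorphism_param_north] homeomorphism_UNIV_inv[OF homeomorphism_param_south]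
      o n s unfolding oriented_surface_def S2_params_def by auto
qed

section \<open>Lattices in the plane\<close>

text \<open>Metric statements about a lattice reduce to the Gaussian integers, at the price of the
  upper and lower bounds of the linear isomorphism \<open>T\<close>.\<close>

lemma lattice_linear_image:
  assumes "is_lattice \<Lambda>"
  obtains T where "linear T" "bij T" "\<Lambda> = range (\<lambda>(m::int, n::int). T (Complex (of_int m) (of_int n)))"
proof -
  obtain a b where ab: "a \<noteq> b" "independent {a, b}" "\<Lambda> = {of_int m * a + of_int n * b | m n. True}"
    using assms unfolding is_lattice_def by metis
  define T where "T z = Re z *\<^sub>R a + Im z *\<^sub>R b" for z
  have lin: "linear T"
    by (rule linearI) (simp_all add: T_def algebra_simps)
  have "inj T"
    unfolding linear_injective_0[OF lin]
  proof (intro allI impI)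
    fix z assume z: "T z = 0"
    define u where "u x = (if x = a then Re z else Im z)" for x
    have "(\<Sum>v\<in>{a, b}. u v *\<^sub>R v) = 0" using z ab(1) by (simp add: T_def u_def)
    then have "\<forall>v\<in>{a, b}. u v = 0"
      using ab(2) unfolding independent_explicit_finite_subsets by blast
    then show "z = 0" using ab(1) by (auto simp: u_def complex_eq_iff)
  qed
  moreover then have "surj T" using linear_injective_imp_surjective[OF lin] by simp
  moreover have "\<Lambda> = range (\<lambda>(m::int, n::int). T (Complex (of_int m) (of_int n)))"
    unfolding ab(3) by (auto simp: T_def scaleR_conv_of_real image_iff)
  ultimately show thesis using that lin by (metis bij_def)
qed

lemma
  assumes "is_lattice \<Lambda>"
  shows lattice_0: "0 \<in> \<Lambda>" and lattice_add: "\<And>x y. x \<in> \<Lambda> \<Longrightarrow> y \<in> \<Lambda> \<Longrightarrow> x + y \<in> \<Lambda>"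
    and lattice_minus: "\<And>x. x \<in> \<Lambda> \<Longrightarrow> - x \<in> \<Lambda>"
    and lattice_diff: "\<And>x y. x \<in> \<Lambda> \<Longrightarrow> y \<in> \<Lambda> \<Longrightarrow> x - y \<in> \<Lambda>"
    and countable_lattice: "countable \<Lambda>"
proof -
  obtain a b where L: "\<Lambda> = {of_int m * a + of_int n * b | m n. True}"
    using assms unfolding is_lattice_def by metis
  have mem: "of_int m * a + of_int n * b \<in> \<Lambda>" for m n unfolding L by blast
  show "0 \<in> \<Lambda>" using mem[of 0 0] by simp
  show minus: "- x \<in> \<Lambda>" if x: "x \<in> \<Lambda>" for x
  proof -
    obtain m n where "x = of_int m * a + of_int n * b" using x unfolding L by blast
    then show ?thesis using mem[of "- m" "- n"] by simp
  qed
  show add: "x + y \<in> \<Lambda>" if xy: "x \<in> \<Lambda>" "y \<in> \<Lambda>" for x y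
  proof -
    obtain m n m' n' where "x = of_int m * a + of_int n * b" "y = of_int m' * a + of_int n' * b"
      using xy unfolding L by blast
    then show ?thesis using mem[of "m + m'" "n + n'"] by (simp add: algebra_simps)
  qed
  show "x - y \<in> \<Lambda>" if "x \<in> \<Lambda>" "y \<in> \<Lambda>" for x y using add[of x "- y"] minus that by simp
  have "\<Lambda> = (\<lambda>(m, n). of_int m * a + of_int n * b) ` UNIV" unfolding L by auto
  then show "countable \<Lambda>" by (metis countable_image countableI_type)
qed

lemma lattice_separated:
  assumes "is_lattice \<Lambda>"
  obtains \<delta> where "0 < \<delta>" "\<And>l. l \<in> \<Lambda> \<Longrightarrow> l \<noteq> 0 \<Longrightarrow> \<delta> \<le> cmod l"
proof -
  obtain T where T: "linear T" "bij T" "\<Lambda> = range (\<lambda>(m::int, n::int). T (Complex (of_int m) (of_int n)))"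
    using lattice_linear_image[OF assms] .
  obtain B where B: "0 < B" "\<And>x. B * cmod x \<le> cmod (T x)"
    using linear_inj_bounded_below_pos[OF T(1)] T(2) by (auto simp: bij_def)
  have "B \<le> cmod l" if l: "l \<in> \<Lambda>" "l \<noteq> 0" for l
  proof -
    obtain m n :: int where mn: "l = T (Complex (of_int m) (of_int n))" using l(1) T(3) by auto
    have "m \<noteq> 0 \<or> n \<noteq> 0"
      using l(2) mn linear_0[OF T(1)] by (metis Complex_eq_0 of_int_0)
    then have "1 \<le> \<bar>of_int m :: real\<bar> \<or> 1 \<le> \<bar>of_int n :: real\<bar>" by linarith
    then have "1 \<le> cmod (Complex (of_int m) (of_int n))"
      using abs_Re_le_cmod[of "Complex (of_int m) (of_int n)"] abs_Im_le_cmod[of "Complex (of_int m) (of_int n)"]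
      by auto
    then have "B * 1 \<le> B * cmod (Complex (of_int m) (of_int n))" using B(1) by (intro mult_left_mono) auto
    then show ?thesis using B(2)[of "Complex (of_int m) (of_int n)"] mn by simp
  qed
  then show ?thesis using that B(1) by blast
qed

lemma closed_lattice:
  assumes "is_lattice \<Lambda>"
  shows "closed \<Lambda>"
proof -
  obtain \<delta> where d: "0 < \<delta>" "\<And>l. l \<in> \<Lambda> \<Longrightarrow> l \<noteq> 0 \<Longrightarrow> \<delta> \<le> cmod l"
    using lattice_separated[OF assms] by metis
  have "y = x" if "x \<in> \<Lambda>" "y \<in> \<Lambda>" "dist y x < \<delta>" for x y
    using d(2)[of "y - x"] lattice_diff[OF assms that(2,1)] that(3) by (auto simp: dist_norm)
  then show ?thesis using discrete_imp_closed[OF d(1), of \<Lambda>] by blast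
qed

lemma lattice_cocompact:
  assumes "is_lattice \<Lambda>"
  obtains M where "\<And>x. \<exists>l\<in>\<Lambda>. cmod (x - 2 * l) \<le> M"
proof -
  obtain T where T: "linear T" "bij T" "\<Lambda> = range (\<lambda>(m::int, n::int). T (Complex (of_int m) (of_int n)))"
    using lattice_linear_image[OF assms] .
  obtain B where B: "0 < B" "\<And>x. cmod (T x) \<le> B * cmod x"
    using linear_bounded_pos[OF T(1)] by blast
  have "\<exists>l\<in>\<Lambda>. cmod (x - 2 * l) \<le> B * 4" for x
  proof -
    obtain z where z: "x = T z" using T(2) by (metis bij_pointE)
    \<comment> \<open>Rounding half the coordinates down leaves a remainder of at most 2 in each
      coordinate after subtracting twice the lattice point; this gives the bound 4.\<close>
    define m n where "m = \<lfloor>Re z / 2\<rfloor>" "n = \<lfloor>Im z / 2\<rfloor>"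
    let ?w = "Complex (of_int m) (of_int n)"
    have e: "x - 2 * T ?w = T (z - 2 *\<^sub>R ?w)"
      using linear_diff[OF T(1)] linear_cmul[OF T(1), of 2] z by (simp add: scaleR_conv_of_real)
    have "cmod (z - 2 *\<^sub>R ?w) \<le> \<bar>Re (z - 2 *\<^sub>R ?w)\<bar> + \<bar>Im (z - 2 *\<^sub>R ?w)\<bar>"
      by (rule cmod_le)
    moreover have "\<bar>Re (z - 2 *\<^sub>R ?w)\<bar> \<le> 2" "\<bar>Im (z - 2 *\<^sub>R ?w)\<bar> \<le> 2"
      unfolding m_n_def by (simp; linarith)+
    ultimately have "cmod (z - 2 *\<^sub>R ?w) \<le> 4" by linarith
    moreover have "cmod (x - 2 * T ?w) \<le> B * cmod (z - 2 *\<^sub>R ?w)"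
      unfolding e by (rule B(2))
    ultimately have "cmod (x - 2 * T ?w) \<le> B * 4"
      using mult_left_mono[of "cmod (z - 2 *\<^sub>R ?w)" 4 B] B(1) by linarith
    moreover have "T ?w \<in> \<Lambda>" unfolding T(3) by (rule range_eqI[of _ _ "(m, n)"]) simp
    ultimately show ?thesis by blast
  qed
  then show ?thesis using that by blast
qed

text \<open>Additivity on the lattice gives compatibility with integer multiples, so the values at
  the two basis vectors determine \<open>A\<close>. These vectors are independent over the reals,
  where a linear map may be prescribed.\<close>

lemma lattice_additive_extends:
  assumes "is_lattice \<Lambda>" and A: "\<And>x y. x \<in> \<Lambda> \<Longrightarrow> y \<in> \<Lambda> \<Longrightarrow> A (x + y) = A x + (A y :: complex)"
  obtains L where "linear L" "\<And>x. x \<in> \<Lambda> \<Longrightarrow> L x = A x"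
proof -
  obtain a b where ab: "a \<noteq> b" "independent {a, b}" "\<Lambda> = {of_int m * a + of_int n * b | m n. True}"
    using assms unfolding is_lattice_def by metis
  note lat = lattice_0[OF assms(1)] lattice_add[OF assms(1)] lattice_minus[OF assms(1)]
  have A0: "A 0 = 0" using A[of 0 0] lat by simp
  have Aminus: "A (- x) = - A x" if "x \<in> \<Lambda>" for x
    using A[of x "- x"] that lat A0 by (simp add: eq_neg_iff_add_eq_0 add.commute)
  have Amult: "of_int m * x \<in> \<Lambda> \<and> A (of_int m * x) = of_int m * A x" if x: "x \<in> \<Lambda>" for m x
  proof -
    have nat: "of_nat k * y \<in> \<Lambda> \<and> A (of_nat k * y) = of_nat k * A y" if "y \<in> \<Lambda>" for k y
      using that by (induction k) (simp_all add: lat A0 A distrib_right)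
    show ?thesis
    proof (cases "m \<ge> 0")
      case True then show ?thesis using nat[OF x, of "nat m"] by simp
    next
      case False then show ?thesis using nat[of "- x" "nat (- m)"] lat Aminus x by simp
    qed
  qed
  obtain L where L: "linear L" "\<forall>x\<in>{a, b}. L x = A x"
    using linear_independent_extend[OF ab(2)] by blast
  have "L x = A x" if xL: "x \<in> \<Lambda>" for x
  proof -
    obtain m n where x: "x = of_int m * a + of_int n * b" using xL unfolding ab(3) by blast
    have "of_int 1 * a + of_int 0 * b \<in> \<Lambda>" "of_int 0 * a + of_int 1 * b \<in> \<Lambda>"
      unfolding ab(3) by blast+
    then have "a \<in> \<Lambda>" "b \<in> \<Lambda>" by simp_all
    then have "A x = of_int m * A a + of_int n * A b" using A Amult x by simp
    moreover have "L (of_int m * y) = of_int m * L y" for m :: int and y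
      using linear_cmul[OF L(1), of "of_int m" y] by (simp add: scaleR_conv_of_real)
    ultimately show ?thesis using L x by (simp add: linear_add)
  qed
  then show ?thesis using that L(1) by blast
qed

lemma linear_surj_of_lattice:
  assumes "is_lattice \<Lambda>" "linear L" "\<Lambda> \<subseteq> range L"
  shows "surj L"
proof -
  obtain a b where ab: "a \<noteq> b" "independent {a, b}" "\<Lambda> = {of_int m * a + of_int n * b | m n. True}"
    using assms unfolding is_lattice_def by metis
  have "of_int 1 * a + of_int 0 * b \<in> \<Lambda>" "of_int 0 * a + of_int 1 * b \<in> \<Lambda>" unfolding ab(3) by blast+
  then have "{a, b} \<subseteq> range L" using assms(3) by auto
  moreover have "subspace (range L)" using assms(2) by (simp add: linear_subspace_image)
  ultimately have "span {a, b} \<subseteq> range L" by (rule span_minimal)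
  moreover have "card {a, b} = DIM(complex)" using ab(1) by simp
  then have "dim {a, b} = DIM(complex)" using dim_eq_card_independent[OF ab(2)] by simp
  then have "span {a, b} = UNIV" by (simp only: dim_eq_full)
  ultimately show ?thesis by auto
qed

section \<open>Lifting through the quotient by a lattice group\<close>

lemma uncountable_open_complex:
  fixes U :: "complex set"
  assumes "open U" "U \<noteq> {}"
  shows "\<not> countable U"
proof -
  obtain x e where "0 < e" "ball x e \<subseteq> U" using assms openE by blast
  then show ?thesis using uncountable_ball[of e x] countable_subset by blast
qed

text \<open>Distils what a normal branched covering with the given deck group provides: its fibres
  are the orbits of the translations by \<open>2 * l\<close> and of the half turns about lattice
  points. Orientation enters through the positive degrees alone.\<close>

locale lattice_quotient =
  fixes \<Lambda> :: "complex set" and \<pi> :: "complex \<Rightarrow> complex \<times> real"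
  assumes lattice: "is_lattice \<Lambda>"
    and continuous: "continuous_on UNIV \<pi>"
    and range_S2: "range \<pi> = S2"
    and fibre: "\<pi> x = \<pi> y \<longleftrightarrow> (\<exists>l\<in>\<Lambda>. y = 2 * l + x \<or> y = 2 * l - x)"
    and positive_degree: "\<exists>d>0. local_degree plane_params S2_params \<pi> x d"
begin

lemma translate: "l \<in> \<Lambda> \<Longrightarrow> \<pi> (2 * l + x) = \<pi> x"
  using fibre[of x "2 * l + x"] by metis

lemma reflect: "l \<in> \<Lambda> \<Longrightarrow> \<pi> (2 * l - x) = \<pi> x"
  using fibre[of x "2 * l - x"] by metis

lemma in_lattice_cong: "\<pi> x = \<pi> y \<Longrightarrow> x \<in> \<Lambda> \<longleftrightarrow> y \<in> \<Lambda>"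
proof -
  have "y \<in> \<Lambda>" if xy: "\<pi> x = \<pi> y" "x \<in> \<Lambda>" for x y
  proof -
    obtain l where l: "l \<in> \<Lambda>" "y = 2 * l + x \<or> y = 2 * l - x" using xy(1) fibre by metis
    then have "l + l + x \<in> \<Lambda>" "l + l - x \<in> \<Lambda>"
      using lattice_add[OF lattice lattice_add[OF lattice l(1) l(1)] xy(2)]
        lattice_diff[OF lattice lattice_add[OF lattice l(1) l(1)] xy(2)] by blast+
    then have "2 * l + x \<in> \<Lambda>" "2 * l - x \<in> \<Lambda>" unfolding mult_2 .
    then show ?thesis using l(2) by blast
  qed
  then show "x \<in> \<Lambda> \<longleftrightarrow> y \<in> \<Lambda>" if "\<pi> x = \<pi> y" using that[symmetric] that by blast
qed

text \<open>The group maps the lattice to itself, so the lattice is the full preimage of the branch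
  values. Conditions on branch values thereby become conditions on points of the plane.\<close>

lemma branch_value_iff: "\<pi> x \<in> \<pi> ` \<Lambda> \<longleftrightarrow> x \<in> \<Lambda>"
proof
  assume "\<pi> x \<in> \<pi> ` \<Lambda>"
  then obtain l where "l \<in> \<Lambda>" "\<pi> x = \<pi> l" by blast
  then show "x \<in> \<Lambda>" using in_lattice_cong[of x l] by simp
qed simp

text \<open>At each point the difference or the sum of the two maps lies in twice the lattice; both
  can do so only where \<open>h1\<close> takes a lattice value. Off this countable set, whose
  complement in \<open>W\<close> is still connected, one alternative holds throughout. The
  corresponding function is continuous with discrete values, hence constant, and density extends the
  equation to all of \<open>W\<close>.\<close>

lemma lift_unique:
  fixes W :: "complex set"
  assumes W: "open W" "connected W"
    and h: "continuous_on W h1" "continuous_on W h2" "\<And>x. x \<in> W \<Longrightarrow> \<pi> (h1 x) = \<pi> (h2 x)"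
    and S: "countable {x\<in>W. h1 x \<in> \<Lambda>}"
  shows "\<exists>l\<in>\<Lambda>. (\<forall>x\<in>W. h2 x = 2 * l + h1 x) \<or> (\<forall>x\<in>W. h2 x = 2 * l - h1 x)"
proof (cases "W = {}")
  case True
  then show ?thesis using lattice_0[OF lattice] by auto
next
  case False
  define V where "V = W - {x\<in>W. h1 x \<in> \<Lambda>}"
  obtain \<delta> where \<delta>: "0 < \<delta>" "\<And>l. l \<in> \<Lambda> \<Longrightarrow> l \<noteq> 0 \<Longrightarrow> \<delta> \<le> cmod l"
    using lattice_separated[OF lattice] by metis
  have V: "connected V" "V \<subseteq> W"
    using connected_open_diff_countable[OF _ W S] unfolding V_def by auto
  have dense: False if "open U" "U \<noteq> {}" "U \<subseteq> W" "U \<inter> V = {}" for U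
  proof -
    have "U \<subseteq> {x\<in>W. h1 x \<in> \<Lambda>}" using that by (auto simp: V_def)
    then have "countable U" using S countable_subset by blast
    then show False using that uncountable_open_complex by blast
  qed
  have "W \<inter> V \<noteq> {}" using dense[of W] W False by auto
  then obtain v where v: "v \<in> V" by auto
  have clos: "closed ((*) 2 ` \<Lambda>)"
    using closed_scaling[OF closed_lattice[OF lattice], of 2] by (simp add: scaleR_conv_of_real)
  define d s where "d x = h2 x - h1 x" and "s x = h2 x + h1 x" for x
  have cont: "continuous_on W d" "continuous_on W s"
    unfolding d_def s_def using h by (auto intro!: continuous_intros)
  let ?D = "{x\<in>V. d x \<in> (*) 2 ` \<Lambda>}" and ?S = "{x\<in>V. s x \<in> (*) 2 ` \<Lambda>}"
  have cl: "closedin (top_of_set V) ?D" "closedin (top_of_set V) ?S"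
    using continuous_closedin_preimage[OF continuous_on_subset[OF cont(1) V(2)] clos]
      continuous_closedin_preimage[OF continuous_on_subset[OF cont(2) V(2)] clos]
    by (simp_all add: vimage_def Int_def)
  have cover: "V \<subseteq> ?D \<union> ?S"
  proof
    fix x assume x: "x \<in> V"
    then obtain l where "l \<in> \<Lambda>" "h2 x = 2 * l + h1 x \<or> h2 x = 2 * l - h1 x"
      using h(3)[of x] V(2) fibre[of "h1 x" "h2 x"] by blast
    then have "d x = 2 * l \<or> s x = 2 * l" by (auto simp: d_def s_def)
    then show "x \<in> ?D \<union> ?S" using x \<open>l \<in> \<Lambda>\<close> by auto
  qed
  have disj: "?D \<inter> ?S = {}"
  proof (rule ccontr)
    assume "?D \<inter> ?S \<noteq> {}"
    then obtain x l l' where x: "x \<in> V" "l \<in> \<Lambda>" "l' \<in> \<Lambda>" "d x = 2 * l" "s x = 2 * l'" by blast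
    then have "2 * h1 x = 2 * (l' - l)" by (simp add: d_def s_def algebra_simps)
    then have "h1 x = l' - l" by (rule mult_left_cancel[THEN iffD1, rotated]) simp
    then have "h1 x \<in> \<Lambda>" using x lattice_diff[OF lattice] by metis
    then show False using x(1) by (auto simp: V_def)
  qed
  have all: "?D = V \<or> ?S = V"
  proof -
    have "?D = {} \<or> ?S = {}"
      using V(1) cl cover disj unfolding connected_closedin by blast
    then show ?thesis using cover by blast
  qed
  have const: "\<exists>l\<in>\<Lambda>. \<forall>x\<in>W. k x = 2 * l"
    if k: "continuous_on W k" "\<And>x. x \<in> V \<Longrightarrow> k x \<in> (*) 2 ` \<Lambda>" for k
  proof -
    have kV: "k x = k v" if "x \<in> V" for x
    proof (rule continuous_diff_in_periods_constant[where d = k and S = V and c = \<delta>])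
      show "continuous_on V k" using k(1) V(2) continuous_on_subset by blast
      show "\<delta> \<le> cmod (k x - k y)" if xy: "x \<in> V" "y \<in> V" "k x \<noteq> k y" for x y
      proof -
        obtain l l' where l: "l \<in> \<Lambda>" "l' \<in> \<Lambda>" "k x = 2 * l" "k y = 2 * l'" using k(2) xy by blast
        then have "\<delta> \<le> cmod (l - l')" using \<delta>(2)[OF lattice_diff[OF lattice l(1,2)]] xy(3) by auto
        moreover have "k x - k y = 2 * (l - l')" using l by simp
        then have "cmod (k x - k y) = 2 * cmod (l - l')" by (simp only: norm_mult norm_numeral)
        ultimately show ?thesis using norm_ge_zero[of "l - l'"] by linarith
      qed
    qed (use that v V(1) \<delta>(1) in auto)
    obtain l where l: "l \<in> \<Lambda>" "k v = 2 * l" using k(2)[OF v] by blast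
    have "k x = 2 * l" if "x \<in> W" for x
    proof (rule ccontr)
      assume ne: "k x \<noteq> 2 * l"
      have "open (W \<inter> k -` (- {2 * l}))"
        using k(1) W(1) by (intro continuous_open_preimage) auto
      moreover have "(W \<inter> k -` (- {2 * l})) \<inter> V = {}" using kV l by auto
      ultimately show False using dense[of "W \<inter> k -` (- {2 * l})"] that ne by auto
    qed
    then show ?thesis using l(1) by blast
  qed
  show ?thesis
  proof (cases "?D = V")
    case True
    then obtain l where "l \<in> \<Lambda>" "\<forall>x\<in>W. d x = 2 * l" using const[OF cont(1)] by blast
    then show ?thesis unfolding d_def by (metis diff_add_cancel)
  next
    case False
    then obtain l where "l \<in> \<Lambda>" "\<forall>x\<in>W. s x = 2 * l" using all const[OF cont(2)] by blast
    then show ?thesis unfolding s_def by (metis add_diff_cancel_right')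
  qed
qed

section \<open>Gluing lifts along growing discs\<close>

definition is_lift :: "(complex \<Rightarrow> complex \<times> real) \<Rightarrow> complex set \<Rightarrow> (complex \<Rightarrow> complex) \<Rightarrow> bool" where
  "is_lift F W h \<longleftrightarrow> continuous_on W h \<and> (\<forall>x\<in>W. \<pi> (h x) = F x)"

lemma is_lift_subset: "is_lift F W h \<Longrightarrow> V \<subseteq> W \<Longrightarrow> is_lift F V h"
  by (auto simp: is_lift_def intro: continuous_on_subset)

lemma is_lift_branch_subset:
  assumes "is_lift F W h" shows "{x\<in>W. h x \<in> \<Lambda>} \<subseteq> {x. F x \<in> \<pi> ` \<Lambda>}"
  using assms by (auto simp: is_lift_def) (metis imageI)

lemma is_lift_unique:
  fixes W :: "complex set"
  assumes "open W" "connected W" "countable {x. F x \<in> \<pi> ` \<Lambda>}" "is_lift F W h1" "is_lift F W h2"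
  shows "\<exists>l\<in>\<Lambda>. (\<forall>x\<in>W. h2 x = 2 * l + h1 x) \<or> (\<forall>x\<in>W. h2 x = 2 * l - h1 x)"
  using assms lift_unique[OF assms(1,2), of h1 h2]
    countable_subset[OF is_lift_branch_subset[OF assms(4)]] by (auto simp: is_lift_def)

lemma is_lift_move:
  assumes "is_lift F W h" "l \<in> \<Lambda>"
  shows "is_lift F W (\<lambda>x. 2 * l + h x)" "is_lift F W (\<lambda>x. 2 * l - h x)"
  using assms translate reflect by (auto simp: is_lift_def intro!: continuous_intros)

text \<open>Two lifts differ by a single deck transformation, and agreement at one point off the branch
  set forces it to be the identity.\<close>

lemma is_lift_agree:
  fixes W :: "complex set"
  assumes "open W" "connected W" "countable {x. F x \<in> \<pi> ` \<Lambda>}" "is_lift F W h1" "is_lift F W h2"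
    and U: "open U" "U \<noteq> {}" "U \<subseteq> W" "\<And>x. x \<in> U \<Longrightarrow> h1 x = h2 x"
    and x: "x \<in> W"
  shows "h1 x = h2 x"
proof -
  obtain l where l: "l \<in> \<Lambda>" "(\<forall>x\<in>W. h2 x = 2 * l + h1 x) \<or> (\<forall>x\<in>W. h2 x = 2 * l - h1 x)"
    using is_lift_unique[OF assms(1-5)] by blast
  have "\<not> countable U" using U uncountable_open_complex by blast
  then have "\<not> U \<subseteq> {x. F x \<in> \<pi> ` \<Lambda>}" using assms(3) countable_subset by blast
  then obtain u where u: "u \<in> U" "F u \<notin> \<pi> ` \<Lambda>" by blast
  then have "h1 u \<notin> \<Lambda>" using assms(4) U(3) by (auto simp: is_lift_def) (metis imageI subsetD)
  from l(2) show ?thesis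
  proof
    assume a: "\<forall>x\<in>W. h2 x = 2 * l + h1 x"
    then have "2 * l = 0" using U u by (metis add_cancel_left_left subsetD)
    then show ?thesis using a x by simp
  next
    assume a: "\<forall>x\<in>W. h2 x = 2 * l - h1 x"
    then have "h1 u = 2 * l - h1 u" using U u by (metis subsetD)
    then have "h1 u = l" by (simp add: field_simps)
    then show ?thesis using \<open>h1 u \<notin> \<Lambda>\<close> l by simp
  qed
qed

text \<open>On the connected overlap the lifts differ by one group element. Applying it to the
  second lift on its whole domain makes the two match.\<close>

lemma is_lift_adjust:
  fixes W :: "complex set"
  assumes "open W" "connected W" "countable {x. F x \<in> \<pi> ` \<Lambda>}"
    and "is_lift F V h1" "is_lift F V' h2" "W \<subseteq> V" "W \<subseteq> V'"
  shows "\<exists>h. is_lift F V' h \<and> (\<forall>x\<in>W. h x = h1 x)"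
proof -
  have "is_lift F W h1" "is_lift F W h2" using assms is_lift_subset by blast+
  from is_lift_unique[OF assms(1-3) this(2,1)]
  obtain l where "l \<in> \<Lambda>" "(\<forall>x\<in>W. h1 x = 2 * l + h2 x) \<or> (\<forall>x\<in>W. h1 x = 2 * l - h2 x)"
    by blast
  then show ?thesis using is_lift_move[OF assms(5)] by metis
qed

lemma is_lift_local:
  assumes loc: "\<And>x. x \<in> W \<Longrightarrow> \<exists>U g. open U \<and> x \<in> U \<and> is_lift F U g \<and> (\<forall>y\<in>U. h y = g y)"
  shows "is_lift F W h"
  unfolding is_lift_def
proof
  have "isCont h x" if xW: "x \<in> W" for x
  proof -
    obtain U g where U: "open U" "x \<in> U" "is_lift F U g" "\<forall>y\<in>U. h y = g y"
      using loc[OF xW] by blast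
    then have "continuous_on U h" by (auto simp: is_lift_def cong: continuous_on_cong_simp)
    then show ?thesis using U continuous_on_eq_continuous_at by blast
  qed
  then show "continuous_on W h" by (simp add: continuous_at_imp_continuous_on)
  show "\<forall>x\<in>W. \<pi> (h x) = F x" using loc unfolding is_lift_def by metis
qed

text \<open>Discs of radius \<open>\<delta>\<close> centred on the boundary circle cover the new
  annulus. Each carries a lift adjusted to \<open>h\<close> on its convex overlap with the old disc.
  Two adjusted lifts agree wherever both are defined, because the intersection of their discs is
  convex and reaches into the old disc, where both equal \<open>h\<close>.\<close>

lemma is_lift_ball_step:
  assumes F: "countable {x. F x \<in> \<pi> ` \<Lambda>}" and r: "0 < r" "0 < \<delta>"
    and h: "is_lift F (ball 0 r) h"
    and loc: "\<And>p. p \<in> sphere 0 r \<Longrightarrow> \<exists>k. is_lift F (ball p \<delta>) k"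
  shows "\<exists>h'. is_lift F (ball 0 (r + \<delta>)) h' \<and> (\<forall>x\<in>ball 0 r. h' x = h x)"
proof -
  let ?B = "ball (0::complex) r"
  have "\<forall>p\<in>sphere 0 r. \<exists>k. is_lift F (ball p \<delta>) k \<and> (\<forall>x\<in>?B \<inter> ball p \<delta>. k x = h x)"
  proof
    fix p :: complex assume "p \<in> sphere 0 r"
    then obtain k where "is_lift F (ball p \<delta>) k" using loc by blast
    from is_lift_adjust[OF _ _ F h this, of "?B \<inter> ball p \<delta>"]
    show "\<exists>k. is_lift F (ball p \<delta>) k \<and> (\<forall>x\<in>?B \<inter> ball p \<delta>. k x = h x)"
      by (simp add: open_Int convex_connected convex_Int)
  qed
  then obtain k where k: "\<And>p. p \<in> sphere 0 r \<Longrightarrow> is_lift F (ball p \<delta>) (k p)"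
    "\<And>p x. p \<in> sphere 0 r \<Longrightarrow> x \<in> ?B \<Longrightarrow> x \<in> ball p \<delta> \<Longrightarrow> k p x = h x"
    by (metis IntI)
  have agree: "k p x = k q x"
    if pq: "p \<in> sphere 0 r" "q \<in> sphere 0 r" "x \<in> ball p \<delta>" "x \<in> ball q \<delta>" for p q x
  proof (cases "p = q")
    case False
    let ?W = "ball p \<delta> \<inter> ball q \<delta>" and ?m = "midpoint p q"
    have "dist p q < 2 * \<delta>" using pq(3,4) dist_triangle2[of p q x] by (simp add: dist_commute)
    then have "?m \<in> ?W" by (simp add: dist_midpoint)
    moreover have "cmod ?m < r"
    proof -
      have "?m = (1/2) *\<^sub>R p + (1/2) *\<^sub>R q" by (simp add: midpoint_def scaleR_right_distrib)
      moreover have "(1/2) *\<^sub>R p + (1/2) *\<^sub>R q \<in> ?B"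
      proof (rule ccontr)
        assume "\<not> (1/2) *\<^sub>R p + (1/2) *\<^sub>R q \<in> ?B"
        then have "r \<le> cmod (p + q) / 2" by (simp flip: scaleR_add_right)
        then have "(2 * r)\<^sup>2 \<le> (cmod (p + q))\<^sup>2" using r by (intro power_mono) auto
        \<comment> \<open>The parallelogram law: the midpoint of two distinct points of the circle
          lies strictly inside. This midpoint is the common point of both small discs and the old
          disc.\<close>
        moreover have "(cmod (p + q))\<^sup>2 + (cmod (p - q))\<^sup>2 = 2 * (cmod p)\<^sup>2 + 2 * (cmod q)\<^sup>2"
          by (simp add: power2_norm_eq_inner inner_add inner_diff algebra_simps)
        ultimately have "(cmod (p - q))\<^sup>2 \<le> 0" using pq(1,2) by (simp add: power2_eq_square)
        then show False using False by simp
      qed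
      ultimately show ?thesis by simp
    qed
    ultimately have ne: "?m \<in> ?W \<inter> ?B" by simp
    have lifts: "is_lift F ?W (k p)" "is_lift F ?W (k q)"
      using k(1) pq is_lift_subset by (meson inf_le1, meson inf_le2)
    show ?thesis
    proof (rule is_lift_agree[OF _ _ F lifts])
      show "open (?W \<inter> ?B)" "?W \<inter> ?B \<subseteq> ?W" "open ?W" by auto
      show "?W \<inter> ?B \<noteq> {}" using ne by blast
      show "connected ?W" by (intro convex_connected convex_Int convex_ball)
    qed (use k(2) pq in auto)
  qed simp
  \<comment> \<open>The choice of the centre is harmless, since all lifts available at
    \<open>x\<close> have the same value there.\<close>
  define h' where "h' x = (if x \<in> ?B then h x else k (SOME p. p \<in> sphere 0 r \<and> x \<in> ball p \<delta>) x)" for x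
  have h'k: "h' x = k p x" if px: "p \<in> sphere 0 r" "x \<in> ball p \<delta>" for p x
  proof (cases "x \<in> ?B")
    case True then show ?thesis using k(2) px by (simp add: h'_def)
  next
    case False
    define q where "q = (SOME p. p \<in> sphere 0 r \<and> x \<in> ball p \<delta>)"
    have "q \<in> sphere 0 r \<and> x \<in> ball q \<delta>"
      unfolding q_def by (rule someI[of _ p]) (use px in blast)
    then have "k q x = k p x" using agree px by blast
    then show ?thesis using False by (simp only: h'_def q_def if_False)
  qed
  have cover: "\<exists>p\<in>sphere 0 r. x \<in> ball p \<delta>" if x: "x \<in> ball 0 (r + \<delta>)" "x \<notin> ?B" for x
  proof -
    have n: "r \<le> cmod x" "cmod x < r + \<delta>" using x by auto
    then have x0: "cmod x > 0" using r by linarith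
    define p where "p = of_real (r / cmod x) * x"
    have pr: "cmod p = r" using x0 r by (simp add: p_def norm_mult norm_divide)
    have "p - x = of_real (r / cmod x - 1) * x" by (simp add: p_def algebra_simps)
    then have "cmod (p - x) = \<bar>r / cmod x - 1\<bar> * cmod x" by (simp only: norm_mult norm_of_real)
    also have "\<dots> = cmod x - r" using x0 n by (simp add: abs_if field_simps)
    finally have "cmod (p - x) = cmod x - r" .
    then have "x \<in> ball p \<delta>" using n by (simp add: dist_norm)
    then show ?thesis using pr by (intro bexI[of _ p]) auto
  qed
  have "\<exists>U g. open U \<and> x \<in> U \<and> is_lift F U g \<and> (\<forall>y\<in>U. h' y = g y)" if "x \<in> ball 0 (r + \<delta>)" for x
  proof (cases "x \<in> ?B")
    case True
    then show ?thesis using h by (intro exI[of _ ?B] exI[of _ h]) (auto simp: h'_def)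
  next
    case False
    then have "\<exists>p\<in>sphere 0 r. x \<in> ball p \<delta>" using cover that by blast
    then obtain p where "p \<in> sphere 0 r" "x \<in> ball p \<delta>" by blast
    then show ?thesis using k(1) h'k by (intro exI[of _ "ball p \<delta>"] exI[of _ "k p"]) auto
  qed
  then have "is_lift F (ball 0 (r + \<delta>)) h'"
    by (rule is_lift_local)
  then show ?thesis by (intro exI[of _ h']) (auto simp: h'_def)
qed

text \<open>A Lebesgue number of the cover of the larger closed disc by discs with lifts gives one
  step width \<open>\<delta>\<close> for every boundary circle met on the way, so finitely many
  steps suffice.\<close>

lemma is_lift_ball_extend:
  assumes F: "countable {x. F x \<in> \<pi> ` \<Lambda>}"
    and loc: "\<And>p. \<exists>r>0. \<exists>k. is_lift F (ball p r) k"
    and r: "0 < r" and h: "is_lift F (ball 0 r) h"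
  shows "\<exists>h'. is_lift F (ball 0 (r + 1)) h' \<and> (\<forall>x\<in>ball 0 r. h' x = h x)"
proof -
  let ?G = "{ball p s | p s. \<exists>k. is_lift F (ball p s) k}"
  have "cball 0 (r + 1) \<subseteq> \<Union>?G"
  proof
    fix x :: complex
    obtain s k where "0 < s" "is_lift F (ball x s) k" using loc by metis
    then show "x \<in> \<Union>?G" by (intro UnionI[of "ball x s"]) auto
  qed
  then obtain \<delta> where \<delta>: "0 < \<delta>" "\<And>x. x \<in> cball 0 (r + 1) \<Longrightarrow> \<exists>G\<in>?G. ball x \<delta> \<subseteq> G"
    by (rule Heine_Borel_lemma[OF compact_cball]) auto
  have loc': "\<exists>k. is_lift F (ball p \<delta>) k" if p: "p \<in> cball 0 (r + 1)" for p
  proof -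
    obtain q s k where "ball p \<delta> \<subseteq> ball q s" "is_lift F (ball q s) k" using \<delta>(2)[OF p] by blast
    then show ?thesis using is_lift_subset by blast
  qed
  \<comment> \<open>Capping the radius at \<open>r + 1\<close> keeps all boundary circles inside the
    compact disc for which \<open>\<delta>\<close> was chosen.\<close>
  have step: "\<exists>h'. is_lift F (ball 0 (min (r + real k * \<delta>) (r + 1))) h' \<and> (\<forall>x\<in>ball 0 r. h' x = h x)" for k
  proof (induction k)
    case 0
    then show ?case using h by (intro exI[of _ h]) simp
  next
    case (Suc k)
    let ?s = "min (r + real k * \<delta>) (r + 1)"
    obtain h' where h': "is_lift F (ball 0 ?s) h'" "\<forall>x\<in>ball 0 r. h' x = h x" using Suc.IH by blast
    have s: "r \<le> ?s" "?s \<le> r + 1" using \<delta>(1) by auto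
    have "\<exists>h''. is_lift F (ball 0 (?s + \<delta>)) h'' \<and> (\<forall>x\<in>ball 0 ?s. h'' x = h' x)"
    proof (rule is_lift_ball_step[OF F _ \<delta>(1) h'(1)])
      show "0 < ?s" using s(1) r by linarith
      show "\<exists>k. is_lift F (ball p \<delta>) k" if "p \<in> sphere 0 ?s" for p
        by (rule loc') (use that s(2) in auto)
    qed
    then obtain h'' where h'': "is_lift F (ball 0 (?s + \<delta>)) h''" "\<forall>x\<in>ball 0 ?s. h'' x = h' x" by blast
    have "min (r + real (Suc k) * \<delta>) (r + 1) \<le> ?s + \<delta>" using \<delta>(1) by (auto simp: min_def algebra_simps)
    then have "is_lift F (ball 0 (min (r + real (Suc k) * \<delta>) (r + 1))) h''"
      using h''(1) is_lift_subset subset_ball by blast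
    moreover have "h'' x = h x" if "x \<in> ball 0 r" for x
    proof -
      have "x \<in> ball 0 ?s" using that s(1) by auto
      then show ?thesis using h''(2) h'(2) that by simp
    qed
    ultimately show ?case by blast
  qed
  obtain k :: nat where "1 / \<delta> < real k" using reals_Archimedean2 by blast
  then have "1 \<le> real k * \<delta>" using \<delta>(1) by (simp add: field_simps)
  then have "min (r + real k * \<delta>) (r + 1) = r + 1" by simp
  then show ?thesis using step[of k] by simp
qed

text \<open>Each chosen lift extends the previous one and the radius grows by 1, so the lifts have a
  union on the whole plane. Growing discs take the place of a monodromy argument.\<close>

lemma lift_exists:
  assumes F: "countable {x. F x \<in> \<pi> ` \<Lambda>}"
    and loc: "\<And>p. \<exists>r>0. \<exists>k. is_lift F (ball p r) k"
  shows "\<exists>h. is_lift F UNIV h"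
proof -
  obtain r k where r: "0 < r" and k: "is_lift F (ball 0 r) k" using loc by blast
  obtain H where H: "\<And>n. is_lift F (ball 0 (r + real n)) (H n)"
    "\<And>n x. x \<in> ball 0 (r + real n) \<Longrightarrow> H (Suc n) x = H n x"
  proof -
    have "\<exists>H. \<forall>n. is_lift F (ball 0 (r + real n)) (H n) \<and> (\<forall>x\<in>ball 0 (r + real n). H (Suc n) x = H n x)"
    proof (rule dependent_nat_choice)
      show "\<exists>h. is_lift F (ball 0 (r + real 0)) h" using k by auto
      show "\<exists>h'. is_lift F (ball 0 (r + real (Suc n))) h' \<and> (\<forall>x\<in>ball 0 (r + real n). h' x = h x)"
        if "is_lift F (ball 0 (r + real n)) h" for h n
        using is_lift_ball_extend[OF F loc _ that] r by (simp add: add.commute add.left_commute)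
    qed
    then show thesis using that by blast
  qed
  have mono: "H m x = H n x" if "n \<le> m" "x \<in> ball 0 (r + real n)" for m n x
    using that(1)
  proof (induction m rule: dec_induct)
    case (step i)
    then have "x \<in> ball 0 (r + real i)" using that(2) by auto
    then show ?case using H(2) step by simp
  qed simp
  \<comment> \<open>With this index \<open>x\<close> is strictly inside the disc, as the radius
    exceeds the index by \<open>r > 0\<close>.\<close>
  define h where "h x = H (nat \<lceil>cmod x\<rceil>) x" for x
  have "is_lift F UNIV h"
  proof (rule is_lift_local)
    fix x :: complex
    let ?n = "nat \<lceil>cmod x\<rceil> + 1"
    have "h y = H ?n y" if "y \<in> ball 0 (r + real ?n) \<inter> ball 0 (real ?n)" for y
      unfolding h_def
    proof (rule mono[symmetric])
      have "cmod y \<le> real ?n" using that by simp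
      then show "nat \<lceil>cmod y\<rceil> \<le> ?n" by (simp only: nat_le_iff ceiling_le_iff of_int_of_nat_eq)
      have "cmod y \<le> real (nat \<lceil>cmod y\<rceil>)" by (rule real_nat_ceiling_ge)
      then have "cmod y < r + real (nat \<lceil>cmod y\<rceil>)" using r by linarith
      then show "y \<in> ball 0 (r + real (nat \<lceil>cmod y\<rceil>))" by (simp only: mem_ball dist_0_norm)
    qed
    moreover have "x \<in> ball 0 (r + real ?n) \<inter> ball 0 (real ?n)"
    proof -
      have "cmod x \<le> real (nat \<lceil>cmod x\<rceil>)" by (rule real_nat_ceiling_ge)
      then have "cmod x < r + real ?n" "cmod x < real ?n" using r by linarith+
      then show ?thesis by (simp only: mem_ball dist_0_norm Int_iff)
    qed
    ultimately show "\<exists>U g. open U \<and> x \<in> U \<and> is_lift F U g \<and> (\<forall>y\<in>U. h y = g y)"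
      using is_lift_subset[OF H(1)[of ?n]]
      by (intro exI[of _ "ball 0 (r + real ?n) \<inter> ball 0 (real ?n)"] exI[of _ "H ?n"]) auto
  qed
  then show ?thesis by blast
qed

section \<open>Local lifts at unbranched and at branched points\<close>

text \<open>The saturation \<open>V\<close> of \<open>U\<close> is a union of open sets, one for
  each group element. A large closed disc meets every orbit, so the complement of the image of
  \<open>U\<close> is the image of the compact set left after removing \<open>V\<close> from that
  disc, and hence closed.\<close>

lemma open_map:
  assumes "open U"
  shows "openin (top_of_set S2) (\<pi> ` U)"
proof -
  obtain M where M: "\<And>x. \<exists>l\<in>\<Lambda>. cmod (x - 2 * l) \<le> M" using lattice_cocompact[OF lattice] by metis
  define V where "V = {x. \<pi> x \<in> \<pi> ` U}"
  have V: "V = (\<Union>l\<in>\<Lambda>. (\<lambda>x. 2 * l + x) -` U) \<union> (\<Union>l\<in>\<Lambda>. (\<lambda>x. 2 * l - x) -` U)"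
    unfolding V_def image_iff fibre by blast
  have "open V" unfolding V
    using assms by (intro open_Un open_UN ballI open_vimage continuous_intros)
  then have "compact (cball 0 M - V)" by (simp add: compact_diff)
  then have "compact (\<pi> ` (cball 0 M - V))"
    using continuous continuous_on_subset compact_continuous_image by blast
  then have "closedin (top_of_set S2) (\<pi> ` (cball 0 M - V))"
    using range_S2 by (intro closed_subset compact_imp_closed) auto
  moreover have "S2 - \<pi> ` (cball 0 M - V) = \<pi> ` U"
  proof
    show "\<pi> ` U \<subseteq> S2 - \<pi> ` (cball 0 M - V)"
    proof (intro subsetI DiffI notI)
      fix y assume "y \<in> \<pi> ` U"
      then show "y \<in> S2" using range_S2 by blast
      assume "y \<in> \<pi> ` (cball 0 M - V)"
      then show False using \<open>y \<in> \<pi> ` U\<close> unfolding V_def by blast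
    qed
    show "S2 - \<pi> ` (cball 0 M - V) \<subseteq> \<pi> ` U"
    proof
      fix y assume y: "y \<in> S2 - \<pi> ` (cball 0 M - V)"
      then obtain x where x: "y = \<pi> x" using range_S2 by auto
      obtain l where l: "l \<in> \<Lambda>" "cmod (x - 2 * l) \<le> M" using M by blast
      have "\<pi> (x - 2 * l) = y" using translate[OF l(1), of "x - 2 * l"] x by simp
      moreover have "x - 2 * l \<in> cball 0 M" using l(2) by simp
      ultimately have "x - 2 * l \<in> V" using y by blast
      then show "y \<in> \<pi> ` U" using \<open>\<pi> (x - 2 * l) = y\<close> unfolding V_def by simp
    qed
  qed
  ultimately show ?thesis using openin_diff[OF openin_subtopology_self] by metis
qed

text \<open>Two points of a ball with the same image are related by a translation or a half turn.
  The bound \<open>\<delta>\<close> excludes nontrivial translations. A half turn has the midpoint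
  of the two points as its centre, a lattice point in the ball, which the bound
  \<open>\<eta>\<close> excludes.\<close>

lemma inj_on_small_ball:
  assumes "y \<notin> \<Lambda>"
  shows "\<exists>e>0. inj_on \<pi> (ball y e)"
proof -
  obtain \<delta> where \<delta>: "0 < \<delta>" "\<And>l. l \<in> \<Lambda> \<Longrightarrow> l \<noteq> 0 \<Longrightarrow> \<delta> \<le> cmod l"
    using lattice_separated[OF lattice] by metis
  obtain \<eta> where \<eta>: "0 < \<eta>" "ball y \<eta> \<subseteq> - \<Lambda>"
    using closed_lattice[OF lattice] assms openE[of "- \<Lambda>" y] by (auto simp: closed_def)
  define e where "e = min \<delta> \<eta>"
  have "inj_on \<pi> (ball y e)"
  proof (rule inj_onI)
    fix u v assume uv: "u \<in> ball y e" "v \<in> ball y e" "\<pi> u = \<pi> v"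
    then obtain l where l: "l \<in> \<Lambda>" "v = 2 * l + u \<or> v = 2 * l - u" using fibre by blast
    from l(2) show "u = v"
    proof
      assume v: "v = 2 * l + u"
      have "dist u v < 2 * e" using uv(1,2) dist_triangle3[of u v y] by simp
      then have "cmod l < \<delta>" using v by (simp add: dist_norm norm_mult e_def)
      then have "l = 0" using \<delta>(2) l(1) by force
      then show ?thesis using v by simp
    next
      assume v: "v = 2 * l - u"
      then have "l = midpoint u v" by (simp add: midpoint_def scaleR_conv_of_real)
      moreover have "midpoint u v \<in> ball y e"
        using uv(1,2) convex_ball[of y e] midpoint_in_closed_segment closed_segment_subset by blast
      ultimately show ?thesis using \<eta>(2) l(1) by (auto simp: e_def)
    qed
  qed
  moreover have "0 < e" using \<delta> \<eta> by (simp add: e_def)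
  ultimately show ?thesis by blast
qed

lemma local_lift_unbranched:
  assumes F: "continuous_on UNIV F" "range F \<subseteq> S2" and x: "F x \<notin> \<pi> ` \<Lambda>"
  shows "\<exists>r>0. \<exists>k. is_lift F (ball x r) k"
proof -
  obtain y where y: "\<pi> y = F x" using F(2) range_S2 by (metis UNIV_I image_iff subsetD)
  have "y \<notin> \<Lambda>" using x unfolding y[symmetric] by blast
  then obtain e where e: "0 < e" "inj_on \<pi> (ball y e)" using inj_on_small_ball by blast
  let ?g = "the_inv_into (ball y e) \<pi>"
  obtain W where W: "open W" "\<pi> ` ball y e = S2 \<inter> W"
    using open_map[of "ball y e"] by (auto simp: openin_open)
  have "continuous_on (\<pi> ` ball y e) ?g"
  proof (rule continuous_on_inverse_open_map)
    show "openin (top_of_set (\<pi> ` ball y e)) (\<pi> ` U)" if "openin (top_of_set (ball y e)) U" for U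
    proof -
      have U: "open U" "U \<subseteq> ball y e" using that by (auto simp: openin_open_eq)
      show ?thesis
        by (rule openin_subset_trans[OF open_map[OF U(1)]]) (use U(2) range_S2 in blast)+
    qed
    show "continuous_on (ball y e) \<pi>" by (rule continuous_on_subset[OF continuous]) simp
    show "?g (\<pi> u) = u" if "u \<in> ball y e" for u by (rule the_inv_into_f_f[OF e(2) that])
  qed simp
  have "open (F -` W)" using F(1) W(1) by (metis open_vimage)
  moreover have "x \<in> F -` W" using y W(2) e(1) 
    using centre_in_ball[of y e] imageI[of y "ball y e" \<pi>] by auto
  ultimately obtain r where r: "0 < r" "ball x r \<subseteq> F -` W" using openE by blast
  have sub: "F ` ball x r \<subseteq> \<pi> ` ball y e" using r(2) W(2) F(2) by blast
  have "is_lift F (ball x r) (?g \<circ> F)"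
    unfolding is_lift_def
  proof
    show "continuous_on (ball x r) (?g \<circ> F)"
      using F(1) continuous_on_subset
      by (intro continuous_on_compose continuous_on_subset[OF \<open>continuous_on (\<pi> ` ball y e) ?g\<close> sub]) blast
    show "\<forall>x\<in>ball x r. \<pi> ((?g \<circ> F) x) = F x"
    proof
      fix u assume "u \<in> ball x r"
      then have "F u \<in> \<pi> ` ball y e" using sub by blast
      then show "\<pi> ((?g \<circ> F) u) = F u" using f_the_inv_into_f[OF e(2)] by simp
    qed
  qed
  then show ?thesis using r(1) by blast
qed

lemma near_lattice_point:
  assumes "l \<in> \<Lambda>" "\<pi> y \<in> \<pi> ` ball l e"
  shows "\<exists>m\<in>\<Lambda>. \<pi> m = \<pi> l \<and> y \<in> ball m e"
proof -
  obtain v where v: "v \<in> ball l e" "\<pi> v = \<pi> y" using assms(2) by auto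
  obtain k where k: "k \<in> \<Lambda>" "y = 2 * k + v \<or> y = 2 * k - v" using v(2) fibre by blast
  have "k + k + l \<in> \<Lambda>" "k + k - l \<in> \<Lambda>"
    using lattice_add[OF lattice lattice_add[OF lattice k(1) k(1)] assms(1)]
      lattice_diff[OF lattice lattice_add[OF lattice k(1) k(1)] assms(1)] by blast+
  then have "2 * k + l \<in> \<Lambda>" "2 * k - l \<in> \<Lambda>" unfolding mult_2 .
  moreover have "\<pi> (2 * k + l) = \<pi> l" "\<pi> (2 * k - l) = \<pi> l"
    using translate[OF k(1)] reflect[OF k(1)] by auto
  moreover have "y \<in> ball (2 * k + l) e \<or> y \<in> ball (2 * k - l) e"
    using k(2) v(1) by (auto simp: dist_norm norm_minus_commute)
  ultimately show ?thesis by blast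
qed

text \<open>Near a branch point the map is even.  On a punctured disc, uniformized by the exponential
  function, the half turn acts on a lift by a deck transformation that fixes a lattice point and
  hence is an involution, so the lift is invariant under the full turn.\<close>

lemma local_lift_branched:
  assumes F: "continuous_on UNIV F" "range F \<subseteq> S2" and x: "F x0 \<in> \<pi> ` \<Lambda>"
    and even: "\<And>w. F (x0 - w) = F (x0 + w)"
    and isolated: "0 < \<epsilon>0" "\<And>w. w \<noteq> 0 \<Longrightarrow> cmod w < \<epsilon>0 \<Longrightarrow> F (x0 + w) \<notin> \<pi> ` \<Lambda>"
  shows "\<exists>r>0. \<exists>k. is_lift F (ball x0 r) k"
proof -
  obtain l0 where l0: "l0 \<in> \<Lambda>" "F x0 = \<pi> l0" using x by blast
  obtain \<delta> where \<delta>: "0 < \<delta>" "\<And>l. l \<in> \<Lambda> \<Longrightarrow> l \<noteq> 0 \<Longrightarrow> \<delta> \<le> cmod l"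
    using lattice_separated[OF lattice] by metis
  \<comment> \<open>One of the two balls is closed: this makes the set of parameters that stay near
    a given lattice point both open and closed below.\<close>
  have same: "m = m'" if "m \<in> \<Lambda>" "m' \<in> \<Lambda>" "y \<in> cball m (\<delta> / 2)" "y \<in> ball m' (\<delta> / 2)" for m m' y
  proof -
    have "dist m m' < \<delta>" using dist_triangle2[of m m' y] that(3,4) by simp
    then show ?thesis using \<delta>(2)[OF lattice_diff[OF lattice that(1,2)]] by (force simp: dist_norm)
  qed
  have near: "\<exists>\<epsilon>>0. \<forall>u\<in>ball x0 \<epsilon>. F u \<in> \<pi> ` ball l0 \<eta>" if \<eta>: "0 < \<eta>" for \<eta>
  proof -
    obtain W where W: "open W" "\<pi> ` ball l0 \<eta> = S2 \<inter> W"
      using open_map[of "ball l0 \<eta>"] by (auto simp: openin_open)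
    have "open (F -` W)" using F(1) W(1) by (metis open_vimage)
    moreover have "x0 \<in> F -` W"
      using l0(2) W(2) \<eta> centre_in_ball[of l0 \<eta>] imageI[of l0 "ball l0 \<eta>" \<pi>] by auto
    ultimately obtain r where r: "0 < r" "ball x0 r \<subseteq> F -` W" using openE by blast
    have "F u \<in> \<pi> ` ball l0 \<eta>" if "u \<in> ball x0 r" for u using that r(2) W(2) F(2) by blast
    then show ?thesis using r(1) by blast
  qed
  obtain \<epsilon>1 where \<epsilon>1: "0 < \<epsilon>1" "\<And>u. u \<in> ball x0 \<epsilon>1 \<Longrightarrow> F u \<in> \<pi> ` ball l0 (\<delta> / 2)"
    using near[of "\<delta> / 2"] \<delta>(1) by auto
  define \<epsilon> where "\<epsilon> = min \<epsilon>0 \<epsilon>1"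
  have \<epsilon>: "0 < \<epsilon>" "\<epsilon> \<le> \<epsilon>0" "\<epsilon> \<le> \<epsilon>1" using isolated(1) \<epsilon>1(1) by (auto simp: \<epsilon>_def)
  \<comment> \<open>A parametrization of the punctured disc of radius \<open>\<epsilon>\<close> by
    the whole plane instead of a half-plane, so that the global existence result applies. It keeps
    the argument of \<open>exp s\<close> and compresses the modulus; adding \<open>\<i>\<close>
    times \<open>pi\<close> still changes the sign.\<close>
  define W where "W s = of_real (\<epsilon> / (1 + exp (Re s))) * exp s" for s :: complex
  define G where "G s = F (x0 + W s)" for s
  have pos: "0 < 1 + exp t" for t :: real using exp_gt_zero[of t] by linarith
  have W0: "W s \<noteq> 0" for s using \<epsilon>(1) pos[of "Re s"] unfolding W_def mult_eq_0_iff of_real_eq_0_iff by simp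
  have W\<epsilon>: "cmod (W s) < \<epsilon>" for s
  proof -
    have "cmod (W s) = \<epsilon> / (1 + exp (Re s)) * exp (Re s)"
      unfolding W_def norm_mult norm_of_real norm_exp_eq_Re using \<epsilon>(1) pos[of "Re s"] by simp
    also have "\<dots> < \<epsilon>" using \<epsilon>(1) pos[of "Re s"] by (simp add: field_simps)
    finally show ?thesis .
  qed
  have Wpi: "W (s + of_real pi * \<i>) = - W s" for s
    unfolding W_def by (simp add: exp_add)
  have contW: "continuous_on UNIV W"
  proof -
    have "1 + exp (Re s) \<noteq> 0" for s using pos[of "Re s"] by simp
    then show ?thesis unfolding W_def by (intro continuous_intros) simp_all
  qed
  have contG: "continuous_on UNIV G" unfolding G_def
    by (intro continuous_on_compose2[OF F(1)] continuous_intros contW) auto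
  have "G s \<notin> \<pi> ` \<Lambda>" for s
    unfolding G_def using isolated(2)[OF W0] W\<epsilon>[of s] \<epsilon>(2) by simp
  then have noG: "{s. G s \<in> \<pi> ` \<Lambda>} = {}" by blast
  have rG: "range G \<subseteq> S2" using F(2) by (auto simp: G_def)
  have "\<exists>H. is_lift G UNIV H"
  proof (rule lift_exists)
    show "\<exists>r>0. \<exists>k. is_lift G (ball p r) k" for p
      using local_lift_unbranched[OF contG rG] noG by blast
  qed (simp add: noG)
  then obtain H where H: "is_lift G UNIV H" by blast
  then have contH: "continuous_on UNIV H" and \<pi>H: "\<And>s. \<pi> (H s) = G s" by (auto simp: is_lift_def)
  have "is_lift G UNIV (\<lambda>s. H (s + of_real pi * \<i>))"
    unfolding is_lift_def
  proof (intro conjI ballI)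
    show "continuous_on UNIV (\<lambda>s. H (s + of_real pi * \<i>))"
      by (intro continuous_on_compose2[OF contH] continuous_intros) auto
    show "\<pi> (H (s + of_real pi * \<i>)) = G s" for s
      using even[of "W s"] unfolding \<pi>H unfolding G_def Wpi by simp
  qed
  then obtain l where l: "l \<in> \<Lambda>"
    "(\<forall>s. H (s + of_real pi * \<i>) = 2 * l + H s) \<or> (\<forall>s. H (s + of_real pi * \<i>) = 2 * l - H s)"
    using is_lift_unique[OF open_UNIV connected_UNIV _ H] noG by force
  have "\<exists>m\<in>\<Lambda>. \<pi> m = \<pi> l0 \<and> H s \<in> ball m (\<delta> / 2)" for s
  proof (rule near_lattice_point[OF l0(1)])
    show "\<pi> (H s) \<in> \<pi> ` ball l0 (\<delta> / 2)"
      unfolding \<pi>H unfolding G_def using W\<epsilon>[of s] \<epsilon>(3) by (intro \<epsilon>1(2)) (simp add: dist_norm)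
  qed
  note Hnear = this
  obtain m where m: "m \<in> \<Lambda>" "H 0 \<in> ball m (\<delta> / 2)" "\<pi> m = \<pi> l0" using Hnear by blast
  have mono: "H s \<in> ball m (\<delta> / 2)" if "H s \<in> cball m (\<delta> / 2)" for s
    using Hnear[of s] same[OF m(1) _ that] by blast
  \<comment> \<open>Connectedness of the plane keeps the lift near the single lattice point
    \<open>m\<close>, which becomes its value at the puncture.\<close>
  have "H -` ball m (\<delta> / 2) = H -` cball m (\<delta> / 2)"
    using mono by auto
  moreover have "open (H -` ball m (\<delta> / 2))" "closed (H -` cball m (\<delta> / 2))"
    using contH by (auto intro: open_vimage closed_vimage)
  moreover have "H -` ball m (\<delta> / 2) \<noteq> {}" using m(2) by blast
  ultimately have "H -` ball m (\<delta> / 2) = UNIV" using clopen by metis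
  then have Hm: "H s \<in> ball m (\<delta> / 2)" for s by blast
  have period: "H (s + of_real pi * \<i> + of_real pi * \<i>) = H s" for s
    using l(2)
  proof
    \<comment> \<open>Both values lie within \<open>\<delta> / 2\<close> of \<open>m\<close>, so the
      translation is too short to be nontrivial. In the other case a half turn is applied
      twice.\<close>
    assume a: "\<forall>s. H (s + of_real pi * \<i>) = 2 * l + H s"
    have "dist (H (0 + of_real pi * \<i>)) (H 0) < \<delta>"
      using dist_triangle3[of "H (0 + of_real pi * \<i>)" "H 0" m] Hm[of 0] Hm[of "0 + of_real pi * \<i>"] by simp
    moreover have "dist (H (0 + of_real pi * \<i>)) (H 0) = 2 * cmod l"
      unfolding spec[OF a] by (simp add: dist_norm norm_mult)
    ultimately have "cmod l < \<delta>" using norm_ge_zero[of l] by linarith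
    then have "l = 0" using \<delta>(2)[OF l(1)] by force
    then show ?thesis using spec[OF a, of "s + of_real pi * \<i>"] spec[OF a, of s] by (simp only: mult_zero_right add_0)
  next
    assume a: "\<forall>s. H (s + of_real pi * \<i>) = 2 * l - H s"
    show ?thesis using spec[OF a, of "s + of_real pi * \<i>"] spec[OF a, of s] by (simp only: diff_diff_eq2 add_diff_cancel_left')
  qed
  \<comment> \<open>A right inverse of \<open>W\<close> on the punctured disc, found by solving for
    the modulus: \<open>exp (Re s)\<close> must be
    \<open>cmod w / (\<epsilon> - cmod w)\<close>.\<close>
  define L where "L w = Ln w - of_real (ln (\<epsilon> - cmod w))" for w
  have WL: "W (Ln w + z - of_real (ln (\<epsilon> - cmod w))) = w * exp z"
    if w: "w \<noteq> 0" "cmod w < \<epsilon>" and z: "Re z = 0" for w z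
  proof -
    have e: "exp (Ln w + z - of_real (ln (\<epsilon> - cmod w))) = w * exp z / of_real (\<epsilon> - cmod w)"
      using w by (simp add: exp_diff exp_add exp_of_real)
    have "exp (Re (Ln w + z - of_real (ln (\<epsilon> - cmod w)))) = cmod w / (\<epsilon> - cmod w)"
      using w z by (simp add: exp_diff)
    then have "1 + exp (Re (Ln w + z - of_real (ln (\<epsilon> - cmod w)))) = \<epsilon> / (\<epsilon> - cmod w)"
      using w by (simp add: field_simps)
    then show ?thesis
      unfolding W_def e using w \<epsilon>(1)
      by (simp only: of_real_divide) (simp del: of_real_diff)
  qed
  have WLz: "W (L w) = w" if "w \<noteq> 0" "cmod w < \<epsilon>" for w
    using WL[OF that, of 0] by (simp add: L_def)
  define h where "h u = (if u = x0 then m else H (L (u - x0)))" for u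
  have \<pi>h: "\<pi> (h u) = F u" if u: "u \<in> ball x0 \<epsilon>" for u
  proof (cases "u = x0")
    case True
    then show ?thesis using m(3) l0(2) by (simp add: h_def)
  next
    case False
    then show ?thesis using u \<pi>H[of "L (u - x0)"] WLz[of "u - x0"]
      by (simp add: h_def G_def dist_norm norm_minus_commute)
  qed
  have cont_ne: "isCont h u" if u: "u \<in> ball x0 \<epsilon>" "u \<noteq> x0" for u
  proof -
    have contHk: "continuous_on U (\<lambda>u. H (Ln (k u) + z - of_real (ln (\<epsilon> - cmod (u - x0)))))"
      if "U \<subseteq> ball x0 \<epsilon>" "continuous_on U k" "\<And>u. u \<in> U \<Longrightarrow> k u \<notin> \<real>\<^sub>\<le>\<^sub>0" for U k z
    proof (rule continuous_on_compose2[OF contH])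
      have "\<epsilon> - cmod (u - x0) > 0" if "u \<in> U" for u
        using that \<open>U \<subseteq> ball x0 \<epsilon>\<close> by (auto simp: dist_norm norm_minus_commute)
      then have "\<epsilon> - cmod (u - x0) \<noteq> 0" if "u \<in> U" for u using that by fastforce
      then show "continuous_on U (\<lambda>u. Ln (k u) + z - of_real (ln (\<epsilon> - cmod (u - x0))))"
        using that by (intro continuous_intros) auto
    qed simp
    show ?thesis
    proof (cases "u - x0 \<in> \<real>\<^sub>\<le>\<^sub>0")
      case False
      define U where "U = ball x0 \<epsilon> \<inter> (\<lambda>u. u - x0) -` (- \<real>\<^sub>\<le>\<^sub>0)"
      have "open U" unfolding U_def
        by (intro open_Int open_vimage continuous_intros open_Compl closed_nonpos_Reals_complex) simp
      moreover have "u \<in> U" using u False by (simp add: U_def)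
      moreover have "continuous_on U (\<lambda>u. H (Ln (u - x0) + 0 - of_real (ln (\<epsilon> - cmod (u - x0)))))"
        by (rule contHk) (auto simp: U_def intro!: continuous_intros)
      then have "continuous_on U h"
        by (rule continuous_on_eq) (auto simp: U_def h_def L_def)
      ultimately show ?thesis using continuous_on_eq_continuous_at by blast
    next
      case True
      \<comment> \<open>Near the cut of \<open>Ln\<close> the branch \<open>Ln (x0 - u)\<close> plus
        \<open>\<i>\<close> times \<open>pi\<close> is continuous. It differs from
        \<open>Ln (u - x0)\<close> by nothing or a full turn, which \<open>H\<close> does not
        notice.\<close>
      define U where "U = ball x0 \<epsilon> \<inter> (\<lambda>u. x0 - u) -` (- \<real>\<^sub>\<le>\<^sub>0)"
      have "open U" unfolding U_def
        by (intro open_Int open_vimage continuous_intros open_Compl closed_nonpos_Reals_complex) simp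
      moreover have "u \<in> U" using u True by (auto simp: U_def complex_nonpos_Reals_iff complex_eq_iff)
      moreover have "continuous_on U (\<lambda>u. H (Ln (x0 - u) + of_real pi * \<i> - of_real (ln (\<epsilon> - cmod (u - x0)))))"
        by (rule contHk) (auto simp: U_def intro!: continuous_intros)
      then have "continuous_on U h"
      proof (rule continuous_on_eq)
        fix v assume v: "v \<in> U"
        then have "v \<noteq> x0" by (auto simp: U_def)
        then have L1: "Ln (- (v - x0)) = (if Im (v - x0) \<le> 0 \<and> \<not> (Re (v - x0) < 0 \<and> Im (v - x0) = 0)
            then Ln (v - x0) + \<i> * of_real pi else Ln (v - x0) - \<i> * of_real pi)"
          by (subst Ln_minus) simp_all
        let ?c = "of_real (ln (\<epsilon> - cmod (v - x0)))"
        have "H (Ln (- (v - x0)) + of_real pi * \<i> - ?c) = H (Ln (v - x0) - ?c)"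
          using period[of "Ln (v - x0) - ?c"] unfolding L1 by (simp add: algebra_simps)
        then show "H (Ln (x0 - v) + of_real pi * \<i> - ?c) = h v"
          using \<open>v \<noteq> x0\<close> by (simp add: h_def L_def)
      qed
      ultimately show ?thesis using continuous_on_eq_continuous_at by blast
    qed
  qed
  have "isCont h x0"
    unfolding continuous_at_eps_delta
  proof (intro allI impI)
    fix e :: real assume e: "0 < e"
    then obtain d where d: "0 < d" "\<And>u. u \<in> ball x0 d \<Longrightarrow> F u \<in> \<pi> ` ball l0 (min e (\<delta> / 2))"
      using near[of "min e (\<delta> / 2)"] \<delta>(1) by auto
    show "\<exists>d>0. \<forall>u. dist u x0 < d \<longrightarrow> dist (h u) (h x0) < e"
    proof (intro exI[of _ "min d \<epsilon>"] conjI allI impI)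
      show "0 < min d \<epsilon>" using d(1) \<epsilon>(1) by simp
      fix u assume u: "dist u x0 < min d \<epsilon>"
      show "dist (h u) (h x0) < e"
      proof (cases "u = x0")
        case False
        have "F u \<in> \<pi> ` ball l0 (min e (\<delta> / 2))"
          by (rule d(2)) (use u in \<open>simp add: dist_commute\<close>)
        moreover have "\<pi> (h u) = F u" by (rule \<pi>h) (use u in \<open>simp add: dist_commute\<close>)
        ultimately have "\<exists>m'\<in>\<Lambda>. \<pi> m' = \<pi> l0 \<and> h u \<in> ball m' (min e (\<delta> / 2))"
          by (intro near_lattice_point[OF l0(1)]) simp
        then obtain m' where m': "m' \<in> \<Lambda>" "h u \<in> ball m' (min e (\<delta> / 2))" by blast
        have "h u \<in> ball m (\<delta> / 2)" using Hm False by (simp add: h_def)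
        then have "m = m'" using same[OF m(1) m'(1), of "h u"] m'(2) by simp
        then show ?thesis using m'(2) by (simp add: h_def dist_commute)
      qed (use e in simp)
    qed
  qed
  then have "continuous_on (ball x0 \<epsilon>) h"
    using cont_ne by (intro continuous_at_imp_continuous_on) blast
  then have "is_lift F (ball x0 \<epsilon>) h" using \<pi>h by (simp add: is_lift_def)
  then show ?thesis using \<epsilon>(1) by blast
qed

lemma quotient_turning:
  assumes "\<sigma> \<in> S2_params" "\<pi> x \<in> range \<sigma>"
  shows "\<exists>d>0. turning (inv \<sigma> \<circ> \<pi>) x d"
  using positive_degree[of x] assms unfolding local_degree_def plane_params_def by auto

lemma turning_through_quotient:
  assumes \<sigma>: "\<sigma> \<in> S2_params" "\<pi> x = \<sigma> z" and d: "turning (inv \<sigma> \<circ> \<pi>) x d"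
    and n: "turning (h \<circ> \<sigma>) z n"
  shows "turning (h \<circ> \<pi>) x (n * d)"
proof -
  have "inv \<sigma> (\<sigma> z) = z" using oriented_surfaceD(3)[OF oriented_surface_S2 \<sigma>(1)] by simp
  then have "turning (h \<circ> \<pi> \<circ> id) x (n * d)"
    using continuous range_S2 \<sigma> d n
    by (intro turning_through_coordinate[OF oriented_surface_plane oriented_surface_S2, of UNIV _ _ _ \<sigma>])
      (auto simp: plane_params_def)
  then show ?thesis by simp
qed

end

section \<open>Orientation of real-linear maps\<close>

text \<open>No orientation is assumed: the degree exists by injectivity and has an inverse among the
  integers. This leaves just a sign to be determined.\<close>

lemma homeomorphism_turning_cases:
  assumes P: "oriented_surface P X" and Q: "oriented_surface Q Y"
    and U: "openin (top_of_set X) U" and V: "openin (top_of_set Y) V"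
    and h: "homeomorphism U V \<phi> \<phi>'"
    and c: "\<sigma> \<in> P" "\<tau> \<in> Q" "\<sigma> z \<in> U" "\<phi> (\<sigma> z) \<in> range \<tau>"
  shows "\<exists>n. turning (inv \<tau> \<circ> \<phi> \<circ> \<sigma>) z n \<and> (n = 1 \<or> n = -1)"
proof -
  let ?D = "{z. \<sigma> z \<in> U \<and> \<phi> (\<sigma> z) \<in> range \<tau>}"
  have "V \<subseteq> Y" using V openin_imp_subset by auto
  then have *: "continuous_on U \<phi>" "\<phi> ` U \<subseteq> Y" using h by (auto simp: homeomorphism_def)
  have "(inv \<tau> \<circ> \<phi> \<circ> \<sigma>) w \<noteq> (inv \<tau> \<circ> \<phi> \<circ> \<sigma>) z" if w: "w \<in> ?D - {z}" for w
  proof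
    assume "(inv \<tau> \<circ> \<phi> \<circ> \<sigma>) w = (inv \<tau> \<circ> \<phi> \<circ> \<sigma>) z"
    then have "\<tau> (inv \<tau> (\<phi> (\<sigma> w))) = \<tau> (inv \<tau> (\<phi> (\<sigma> z)))" by simp
    then have "\<phi> (\<sigma> w) = \<phi> (\<sigma> z)" using w c(4) by (simp add: f_inv_into_f)
    then have "\<phi>' (\<phi> (\<sigma> w)) = \<phi>' (\<phi> (\<sigma> z))" by simp
    then have "\<sigma> w = \<sigma> z" using w c(3) homeomorphism_apply1[OF h] by simp
    then show False using w oriented_surfaceD(3)[OF P c(1)] by (simp add: inj_eq)
  qed
  then obtain n where n: "turning (inv \<tau> \<circ> \<phi> \<circ> \<sigma>) z n"
    using turning_exists[OF open_coordinate_domain[OF P Q U * c(1,2)] _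
        continuous_on_coordinates[OF P Q U * c(1,2)], of z] c(3,4) by blast
  then obtain m where "m * n = 1" using turning_homeomorphism_coordinates[OF P Q U V h c n] by blast
  then show ?thesis using n zmult_eq_1_iff[of m n] by auto
qed

lemma linear_Re_Im:
  assumes "linear L"
  shows "L z = of_real (Re z) * L 1 + of_real (Im z) * (L \<i> :: complex)"
proof -
  have "z = Re z *\<^sub>R 1 + Im z *\<^sub>R \<i>" by (simp add: complex_eq_iff)
  then have "L z = L (Re z *\<^sub>R 1 + Im z *\<^sub>R \<i>)" by (rule arg_cong)
  also have "\<dots> = of_real (Re z) * L 1 + of_real (Im z) * L \<i>"
    unfolding linear_add[OF assms] linear_cmul[OF assms] by (simp only: scaleR_conv_of_real)
  finally show ?thesis .
qed

text \<open>The complex-linear and antilinear parts of \<open>L\<close>. The sign of the determinant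
  tells which of the two coefficients has the larger modulus.\<close>

lemma linear_complex_form:
  assumes "linear L"
  obtains p q where "\<And>z. L z = p * z + q * cnj z" "plane_det L = (cmod p)\<^sup>2 - (cmod q)\<^sup>2"
proof -
  define p q where "p = (L 1 - \<i> * L \<i>) / 2" and "q = (L 1 + \<i> * L \<i>) / 2"
  have "L z = p * z + q * cnj z" for z
  proof -
    have "L z = of_real (Re z) * L 1 + of_real (Im z) * L \<i>" by (rule linear_Re_Im[OF assms])
    also have "\<dots> = p * z + q * cnj z"
      by (simp add: p_def q_def complex_eq_iff field_simps)
    finally show ?thesis .
  qed
  moreover have "plane_det L = (cmod p)\<^sup>2 - (cmod q)\<^sup>2"
    unfolding plane_det_def p_def q_def cmod_power2 by (simp add: power2_eq_square field_simps)
  ultimately show thesis using that by blast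
qed

text \<open>The part with the larger coefficient dominates the other on the circle, as in Rouche's
  theorem, so the winding number is that of a circle run forwards or backwards.\<close>

lemma linear_winding_number:
  assumes L: "linear L" and r: "0 < r"
  shows "0 < plane_det L \<Longrightarrow> winding_number (L \<circ> circlepath 0 r) 0 = 1"
    and "plane_det L < 0 \<Longrightarrow> winding_number (L \<circ> circlepath 0 r) 0 = - 1"
proof -
  obtain p q where pq: "\<And>z. L z = p * z + q * cnj z" "plane_det L = (cmod p)\<^sup>2 - (cmod q)\<^sup>2"
    using linear_complex_form[OF L] by metis
  have cl: "continuous_on UNIV L" using L linear_continuous_on linear_conv_bounded_linear by blast
  have pL: "path (L \<circ> circlepath 0 r)" "pathfinish (L \<circ> circlepath 0 r) = pathstart (L \<circ> circlepath 0 r)"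
    using continuous_on_subset[OF cl] by (auto intro!: path_continuous_image simp: pathfinish_compose pathstart_compose)
  \<comment> \<open>Here \<open>a\<close> is the dominant coefficient, \<open>s\<close> the
    direction of rotation and \<open>e\<close> the contribution of the smaller part.\<close>
  have near: "winding_number (L \<circ> circlepath 0 r) 0 = winding_number (\<lambda>t. 0 + exp (Ln (a * of_real r) + s * (2 * of_real pi * \<i> * of_real t))) 0"
    if a: "a \<noteq> 0" "\<And>t. L (circlepath 0 r t) - a * of_real r * exp (s * (2 * of_real pi * \<i> * of_real t)) = e t"
      "\<And>t. cmod (e t) < cmod a * r" and s: "s = 1 \<or> s = - 1" for a s e
  proof -
    have eq: "exp (Ln (a * of_real r) + s * (2 * of_real pi * \<i> * of_real t)) = a * of_real r * exp (s * (2 * of_real pi * \<i> * of_real t))" for t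
      using a r by (simp add: exp_add)
    show ?thesis
    proof (rule winding_number_nearby_loops_eq)
      show "path (\<lambda>t. 0 + exp (Ln (a * of_real r) + s * (2 * of_real pi * \<i> * of_real t)))"
        unfolding path_def by (intro continuous_intros)
      show "pathfinish (\<lambda>t. 0 + exp (Ln (a * of_real r) + s * (2 * of_real pi * \<i> * of_real t))) =
            pathstart (\<lambda>t. 0 + exp (Ln (a * of_real r) + s * (2 * of_real pi * \<i> * of_real t)))"
        using s by (auto simp: pathfinish_def pathstart_def exp_add exp_minus)
      show "cmod ((L \<circ> circlepath 0 r) t - (0 + exp (Ln (a * of_real r) + s * (2 * of_real pi * \<i> * of_real t))))
          < cmod (0 + exp (Ln (a * of_real r) + s * (2 * of_real pi * \<i> * of_real t)) - 0)" for t
      proof -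
        have n1: "cmod (exp (s * (2 * of_real pi * \<i> * of_real t))) = 1" using s by auto
        have "cmod (a * of_real r * exp (s * (2 * of_real pi * \<i> * of_real t))) = cmod a * r"
          unfolding norm_mult n1 using r by simp
        then show ?thesis unfolding eq add_0 comp_apply a(2) diff_zero using a(3)[of t] by simp
      qed
    qed (use pL in auto)
  qed
  have val: "winding_number (\<lambda>t. 0 + exp (c + s * (2 * of_real pi * \<i> * of_real t))) 0 = s" for c s
    by (subst winding_number_exp) (auto simp: path_def pathfinish_def pathstart_def intro!: continuous_intros)
  have ct: "circlepath 0 r t = of_real r * exp (2 * of_real pi * \<i> * of_real t)" for t
    by (simp add: circlepath)
  have cnj: "cnj (exp (2 * of_real pi * \<i> * of_real t)) = exp (- 1 * (2 * of_real pi * \<i> * of_real t))" for t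
    by (simp add: exp_cnj)
  show "winding_number (L \<circ> circlepath 0 r) 0 = 1" if "0 < plane_det L"
  proof -
    have "cmod q < cmod p" using that pq(2) by (simp add: power2_less_imp_less)
    then have "winding_number (L \<circ> circlepath 0 r) 0 =
        winding_number (\<lambda>t. 0 + exp (Ln (p * of_real r) + 1 * (2 * of_real pi * \<i> * of_real t))) 0"
      using r by (intro near[where e = "\<lambda>t. q * cnj (circlepath 0 r t)"])
        (auto simp: pq(1) ct norm_mult)
    then show ?thesis using val by metis
  qed
  show "winding_number (L \<circ> circlepath 0 r) 0 = - 1" if "plane_det L < 0"
  proof -
    have "cmod p < cmod q" using that pq(2) by (simp add: power2_less_imp_less)
    then have "winding_number (L \<circ> circlepath 0 r) 0 =
        winding_number (\<lambda>t. 0 + exp (Ln (q * of_real r) + - 1 * (2 * of_real pi * \<i> * of_real t))) 0"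
      using r by (intro near[where e = "\<lambda>t. p * circlepath 0 r t"])
        (auto simp: pq(1) ct norm_mult exp_cnj)
    then show ?thesis using val by metis
  qed
qed

lemma linear_inj_of_plane_det:
  assumes "linear L" "plane_det L \<noteq> 0"
  shows "inj L"
proof -
  obtain p q where pq: "\<And>z. L z = p * z + q * cnj z" "plane_det L = (cmod p)\<^sup>2 - (cmod q)\<^sup>2"
    using linear_complex_form[OF assms(1)] by metis
  have "z = 0" if "L z = 0" for z
  proof -
    have "p * z = - (q * cnj z)" using that pq(1) by (simp add: eq_neg_iff_add_eq_0)
    then have "cmod (p * z) = cmod (q * cnj z)" by simp
    then have "cmod p * cmod z = cmod q * cmod z" by (simp add: norm_mult)
    then show ?thesis using pq(2) assms(2) by auto
  qed
  then show ?thesis using linear_injective_0[OF assms(1)] by blast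
qed

lemma plane_det_compose:
  assumes "linear K" "linear L"
  shows "plane_det (K \<circ> L) = plane_det K * plane_det L"
proof -
  note K = linear_Re_Im[OF assms(1)]
  show ?thesis
    unfolding plane_det_def comp_apply K[of "L 1"] K[of "L \<i>"] by (simp add: algebra_simps)
qed

lemma linear_inverse_plane_det:
  assumes "linear L" "inj L"
  obtains K where "linear K" "\<And>x. K (L x) = x" "\<And>x. L (K x) = x" "plane_det K * plane_det L = 1"
proof -
  obtain K where K: "linear K" "\<forall>x. K (L x) = x" "\<forall>x. L (K x) = x"
    using linear_injective_isomorphism[OF assms] by blast
  have "K \<circ> L = id" using K by auto
  then have "plane_det K * plane_det L = 1"
    using plane_det_compose[OF K(1) assms(1)] by (simp add: plane_det_def)
  then show thesis using that K by blast
qed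

lemma turning_affine:
  assumes L: "linear L" and det: "0 < plane_det L"
  shows "turning (\<lambda>x. L x + b) z 1"
proof -
  have cl: "continuous_on UNIV L" using L linear_continuous_on linear_conv_bounded_linear by blast
  have inj: "inj L" by (rule linear_inj_of_plane_det) (use assms in auto)
  have "\<exists>n. turning_on 2 (\<lambda>x. L x + b) z n"
    by (rule turning_on_exists)
      (use inj in \<open>auto simp: inj_eq intro!: continuous_intros continuous_on_subset[OF cl]\<close>)
  then obtain n where n: "turning_on 2 (\<lambda>x. L x + b) z n" by blast
  then have "of_int n = winding_number ((\<lambda>x. L x + b) \<circ> circlepath z 1) (L z + b)"
    using turning_on_circlepath[OF n, of 1] by simp
  also have "\<dots> = winding_number (\<lambda>w. ((\<lambda>x. L x + b) \<circ> circlepath z 1) w - (L z + b)) 0"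
    by (rule winding_number_offset)
  also have "(\<lambda>w. ((\<lambda>x. L x + b) \<circ> circlepath z 1) w - (L z + b)) = L \<circ> circlepath 0 1"
    using linear_add[OF L] by (auto simp: fun_eq_iff circlepath)
  also have "winding_number \<dots> 0 = 1" using linear_winding_number(1)[OF L _ det] by simp
  finally have "n = 1" by (simp only: of_int_eq_1_iff)
  then show ?thesis using n by (auto simp: turning_def)
qed

section \<open>Lifting and descending homeomorphisms\<close>

locale lattice_quotient_pair =
  A: lattice_quotient \<Lambda> \<pi> + B: lattice_quotient \<Lambda>' \<pi>' for \<Lambda> \<pi> \<Lambda>' \<pi>'
begin

text \<open>The composite is even about each lattice point because of the half turn there, and
  lattice points are isolated; these are the requirements for a local lift at a branch point.
  Elsewhere the hypothesis keeps the composite away from branch values.\<close>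

lemma lift_map:
  assumes \<psi>: "continuous_on S2 \<psi>" "\<psi> ` S2 \<subseteq> S2" "\<And>x. \<psi> (\<pi> x) \<in> \<pi>' ` \<Lambda>' \<longleftrightarrow> x \<in> \<Lambda>"
  shows "\<exists>h. continuous_on UNIV h \<and> (\<forall>x. \<pi>' (h x) = \<psi> (\<pi> x))"
proof -
  define F where "F = \<psi> \<circ> \<pi>"
  have F: "continuous_on UNIV F" "range F \<subseteq> S2"
  proof -
    show "continuous_on UNIV F"
      unfolding F_def by (rule continuous_on_compose[OF A.continuous]) (simp add: A.range_S2 \<psi>(1))
    show "range F \<subseteq> S2" using \<psi>(2) A.range_S2 unfolding F_def by auto
  qed
  have br: "F x \<in> \<pi>' ` \<Lambda>' \<longleftrightarrow> x \<in> \<Lambda>" for x using \<psi>(3) by (simp add: F_def)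
  obtain \<delta> where \<delta>: "0 < \<delta>" "\<And>l. l \<in> \<Lambda> \<Longrightarrow> l \<noteq> 0 \<Longrightarrow> \<delta> \<le> cmod l"
    using lattice_separated[OF A.lattice] by metis
  have "\<exists>h. B.is_lift F UNIV h"
  proof (rule B.lift_exists)
    show "countable {x. F x \<in> \<pi>' ` \<Lambda>'}" using countable_lattice[OF A.lattice] br by simp
    show "\<exists>r>0. \<exists>k. B.is_lift F (ball x r) k" for x
    proof (cases "x \<in> \<Lambda>")
      case False
      then show ?thesis using B.local_lift_unbranched[OF F] br by blast
    next
      case True
      show ?thesis
      proof (rule B.local_lift_branched[OF F])
        show "F x \<in> \<pi>' ` \<Lambda>'" using True br by blast
        show "F (x - w) = F (x + w)" for w
          using A.reflect[OF True, of "x + w"] by (simp add: F_def)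
        show "F (x + w) \<notin> \<pi>' ` \<Lambda>'" if "w \<noteq> 0" "cmod w < \<delta>" for w
        proof
          assume "F (x + w) \<in> \<pi>' ` \<Lambda>'"
          then have "(x + w) - x \<in> \<Lambda>" using br lattice_diff[OF A.lattice] True by blast
          then show False using \<delta>(2)[of w] that by simp
        qed
      qed (rule \<delta>(1))
    qed
  qed
  then show ?thesis unfolding B.is_lift_def F_def by auto
qed

text \<open>An open continuous surjection is a quotient map, so continuity downstairs follows from
  continuity in the plane.\<close>

lemma descend_map:
  assumes \<Psi>: "continuous_on UNIV \<Psi>" "\<And>x y. \<pi> x = \<pi> y \<Longrightarrow> \<pi>' (\<Psi> x) = \<pi>' (\<Psi> y)"
  shows "\<exists>\<phi>. continuous_on S2 \<phi> \<and> \<phi> ` S2 \<subseteq> S2 \<and> (\<forall>x. \<phi> (\<pi> x) = \<pi>' (\<Psi> x))"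
proof -
  define \<phi> where "\<phi> y = \<pi>' (\<Psi> (SOME x. \<pi> x = y))" for y
  have \<phi>: "\<phi> (\<pi> x) = \<pi>' (\<Psi> x)" for x
    unfolding \<phi>_def by (rule \<Psi>(2)) (rule someI[of "\<lambda>u. \<pi> u = \<pi> x"], rule refl)
  have c: "continuous_on UNIV (\<pi>' \<circ> \<Psi>)"
    by (rule continuous_on_compose[OF \<Psi>(1) continuous_on_subset[OF B.continuous]]) simp
  have "continuous_on S2 \<phi>"
    unfolding continuous_on_open
  proof (intro allI impI)
    fix T assume "openin (top_of_set (\<phi> ` S2)) T"
    then obtain W where W: "open W" "T = \<phi> ` S2 \<inter> W" by (auto simp: openin_open)
    have "S2 \<inter> \<phi> -` T = \<pi> ` ((\<pi>' \<circ> \<Psi>) -` W)"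
      using W(2) \<phi> by (auto simp flip: A.range_S2)
    moreover have "open ((\<pi>' \<circ> \<Psi>) -` W)" using c W(1) by (metis open_vimage)
    ultimately show "openin (top_of_set S2) (S2 \<inter> \<phi> -` T)" using A.open_map by simp
  qed
  moreover have "\<phi> ` S2 \<subseteq> S2" using \<phi> B.range_S2 by (auto simp flip: A.range_S2)
  ultimately show ?thesis using \<phi> by blast
qed

end

lemma lattice_quotient_pairI:
  "lattice_quotient \<Lambda> \<pi> \<Longrightarrow> lattice_quotient \<Lambda>' \<pi>' \<Longrightarrow> lattice_quotient_pair \<Lambda> \<pi> \<Lambda>' \<pi>'"
  by (simp add: lattice_quotient_pair_def)

context lattice_quotient_pair
begin

text \<open>Lifts of \<open>\<psi>\<close> and \<open>\<psi>'\<close> compose to lifts of the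
  identity, which are group elements by uniqueness. Correcting the second lift by such an element
  turns it into an inverse of the first.\<close>

lemma lift_homeomorphism:
  assumes h: "homeomorphism S2 S2 \<psi> \<psi>'" and br: "\<psi> ` \<pi> ` \<Lambda> = \<pi>' ` \<Lambda>'"
  shows "\<exists>h h'. homeomorphism UNIV UNIV h h' \<and> (\<forall>x. \<pi>' (h x) = \<psi> (\<pi> x))"
proof -
  have S: "\<pi> x \<in> S2" "\<pi>' x \<in> S2" for x using A.range_S2 B.range_S2 by auto
  note inv1 = homeomorphism_apply1[OF h S(1)] and inv2 = homeomorphism_apply2[OF h S(2)]
  have b1: "\<psi> (\<pi> x) \<in> \<pi>' ` \<Lambda>' \<longleftrightarrow> x \<in> \<Lambda>" for x
  proof
    assume "\<psi> (\<pi> x) \<in> \<pi>' ` \<Lambda>'"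
    then obtain l where "l \<in> \<Lambda>" "\<psi> (\<pi> x) = \<psi> (\<pi> l)" unfolding br[symmetric] by blast
    then have "\<pi> x = \<pi> l" using inv1 by metis
    then show "x \<in> \<Lambda>" using A.in_lattice_cong \<open>l \<in> \<Lambda>\<close> by blast
  qed (use br in blast)
  have b2: "\<psi>' (\<pi>' x) \<in> \<pi> ` \<Lambda> \<longleftrightarrow> x \<in> \<Lambda>'" for x
  proof -
    obtain y where y: "\<psi>' (\<pi>' x) = \<pi> y"
      using homeomorphism_image2[OF h] S(2)[of x] A.range_S2 by blast
    have "\<pi>' x = \<psi> (\<pi> y)" using y inv2 by metis
    then show ?thesis using b1[of y] A.branch_value_iff[of y] B.branch_value_iff[of x] y by simp
  qed
  interpret R: lattice_quotient_pair \<Lambda>' \<pi>' \<Lambda> \<pi>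
    by (intro lattice_quotient_pairI A.lattice_quotient_axioms B.lattice_quotient_axioms)
  obtain f where f: "continuous_on UNIV f" "\<And>x. \<pi>' (f x) = \<psi> (\<pi> x)"
    using lift_map[OF homeomorphism_cont1[OF h] _ b1] homeomorphism_image1[OF h] by blast
  obtain k where k: "continuous_on UNIV k" "\<And>x. \<pi> (k x) = \<psi>' (\<pi>' x)"
    using R.lift_map[OF homeomorphism_cont2[OF h] _ b2] homeomorphism_image2[OF h] by blast
  have "\<exists>l\<in>\<Lambda>. (\<forall>x\<in>UNIV. k (f x) = 2 * l + x) \<or> (\<forall>x\<in>UNIV. k (f x) = 2 * l - x)"
  proof (rule A.lift_unique)
    show "continuous_on UNIV (\<lambda>x. k (f x))"
      by (rule continuous_on_compose2[OF k(1) f(1)]) simp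
    show "\<pi> x = \<pi> (k (f x))" for x using f(2) k(2) inv1 by simp
    show "countable {x \<in> UNIV. x \<in> \<Lambda>}" using countable_lattice[OF A.lattice] by simp
  qed auto
  then obtain l where l: "(\<forall>x. k (f x) = 2 * l + x) \<or> (\<forall>x. k (f x) = 2 * l - x)" by auto
  have "\<exists>l\<in>\<Lambda>'. (\<forall>x\<in>UNIV. f (k x) = 2 * l + x) \<or> (\<forall>x\<in>UNIV. f (k x) = 2 * l - x)"
  proof (rule B.lift_unique)
    show "continuous_on UNIV (\<lambda>x. f (k x))"
      by (rule continuous_on_compose2[OF f(1) k(1)]) simp
    show "\<pi>' x = \<pi>' (f (k x))" for x using f(2) k(2) inv2 by simp
    show "countable {x \<in> UNIV. x \<in> \<Lambda>'}" using countable_lattice[OF B.lattice] by simp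
  qed auto
  then obtain l' where "(\<forall>x. f (k x) = 2 * l' + x) \<or> (\<forall>x. f (k x) = 2 * l' - x)" by auto
  then have surj: "\<exists>x. f x = y" for y
  proof
    assume "\<forall>x. f (k x) = 2 * l' + x"
    then have "f (k (y - 2 * l')) = y" by simp
    then show ?thesis by blast
  next
    assume "\<forall>x. f (k x) = 2 * l' - x"
    then have "f (k (2 * l' - y)) = y" by simp
    then show ?thesis by blast
  qed
  have "\<exists>g. continuous_on UNIV g \<and> (\<forall>x. g (f x) = x)"
    using l
  proof
    assume a: "\<forall>x. k (f x) = 2 * l + x"
    show ?thesis
      by (intro exI[of _ "\<lambda>y. k y - 2 * l"] conjI continuous_intros k(1)) (use a in simp)
  next
    assume a: "\<forall>x. k (f x) = 2 * l - x"
    show ?thesis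
      by (intro exI[of _ "\<lambda>y. 2 * l - k y"] conjI continuous_intros k(1)) (use a in simp)
  qed
  then obtain g where g: "continuous_on UNIV g" "\<And>x. g (f x) = x" by blast
  have "f (g y) = y" for y using surj[of y] g(2) by metis
  then have "homeomorphism UNIV UNIV f g" using f(1) g by (intro homeomorphismI) auto
  then show ?thesis using f(2) by blast
qed

interpretation R: lattice_quotient_pair \<Lambda>' \<pi>' \<Lambda> \<pi>
  by (intro lattice_quotient_pairI A.lattice_quotient_axioms B.lattice_quotient_axioms)

text \<open>The local degrees of the two quotient maps are positive, so a homeomorphism covered by or
  covering an orientation-preserving one has positive local degree, hence degree one.\<close>

lemma oriented_homeo_of_lift:
  assumes h: "homeomorphism S2 S2 \<phi> \<phi>'" and \<Psi>: "\<And>x. \<phi> (\<pi> x) = \<pi>' (\<Psi> x)"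
    and t: "\<And>x. turning \<Psi> x 1"
  shows "oriented_homeo S2_params S2 S2_params S2 \<phi>"
proof -
  note S = oriented_surface_S2
  have S2: "openin (top_of_set S2) S2" by simp
  have "local_degree S2_params S2_params \<phi> y 1" if y: "y \<in> S2" for y
    unfolding local_degree_def
  proof (intro ballI allI impI)
    fix \<sigma> \<tau> z assume c: "\<sigma> \<in> S2_params" "\<tau> \<in> S2_params" and z: "\<sigma> z = y \<and> \<phi> y \<in> range \<tau>"
    obtain x where x: "\<pi> x = \<sigma> z" using z y A.range_S2 by (metis imageE)
    obtain n where n: "turning (inv \<tau> \<circ> \<phi> \<circ> \<sigma>) z n" "n = 1 \<or> n = -1"
      using homeomorphism_turning_cases[OF S S S2 S2 h c, of z] z y by blast
    obtain d where d: "0 < d" "turning (inv \<sigma> \<circ> \<pi>) x d"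
      using A.quotient_turning[OF c(1), of x] x by auto
    have "\<pi>' (\<Psi> x) \<in> range \<tau>" using z x \<Psi>[of x] by auto
    then obtain e where e: "0 < e" "turning (inv \<tau> \<circ> \<pi>') (\<Psi> x) e"
      using B.quotient_turning[OF c(2)] by blast
    have "turning (inv \<tau> \<circ> \<phi> \<circ> \<pi>) x (n * d)"
      by (rule A.turning_through_quotient[OF c(1) x d(2) n(1)])
    moreover have "turning (inv \<tau> \<circ> \<pi>' \<circ> \<Psi>) x (e * 1)" by (rule turning_compose[OF t e(2)])
    moreover have "inv \<tau> \<circ> \<pi>' \<circ> \<Psi> = inv \<tau> \<circ> \<phi> \<circ> \<pi>" using \<Psi> by auto
    ultimately have "n * d = e" using turning_unique by fastforce
    then have "n = 1" using n(2) d(1) e(1) by auto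
    then show "turning (inv \<tau> \<circ> \<phi> \<circ> \<sigma>) z 1" using n(1) by simp
  qed
  then show ?thesis using oriented_homeo_iff[OF S S S2 S2 h] by blast
qed

lemma turning_of_lift:
  assumes h: "homeomorphism UNIV UNIV h h'" and \<phi>: "oriented_homeo S2_params S2 S2_params S2 \<phi>"
    and eq: "\<And>x. \<pi>' (h x) = \<phi> (\<pi> x)"
  shows "turning h x 1"
proof -
  note S = oriented_surface_S2
  have S2: "openin (top_of_set S2) S2" by simp
  obtain \<phi>' where h\<phi>: "homeomorphism S2 S2 \<phi> \<phi>'" using \<phi> by (rule oriented_homeo_homeomorphism)
  have xS: "\<pi> x \<in> S2" "\<phi> (\<pi> x) \<in> S2" using A.range_S2 B.range_S2 eq[of x] by (auto, metis rangeI)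
  then obtain \<sigma> z \<tau> where c: "\<sigma> \<in> S2_params" "\<tau> \<in> S2_params" "\<pi> x = \<sigma> z" "\<phi> (\<pi> x) \<in> range \<tau>"
    using S unfolding oriented_surface_def by blast
  have "turning (inv id \<circ> h \<circ> id) x n \<Longrightarrow> turning h x n" for n by (simp add: inv_id)
  then obtain n where n: "turning h x n" "n = 1 \<or> n = -1"
    using homeomorphism_turning_cases[OF oriented_surface_plane oriented_surface_plane _ _ h, of id id x]
    by (auto simp: plane_params_def)
  obtain d where d: "0 < d" "turning (inv \<sigma> \<circ> \<pi>) x d"
    using A.quotient_turning[OF c(1), of x] c(3) by auto
  obtain e where e: "0 < e" "turning (inv \<tau> \<circ> \<pi>') (h x) e"
    using B.quotient_turning[OF c(2), of "h x"] c(4) eq by auto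
  have "local_degree S2_params S2_params \<phi> (\<pi> x) 1"
    using \<phi> xS(1) oriented_homeo_iff[OF S S S2 S2 h\<phi>] by blast
  then have "turning (inv \<tau> \<circ> \<phi> \<circ> \<sigma>) z 1" using c by (auto simp: local_degree_def)
  then have "turning (inv \<tau> \<circ> \<phi> \<circ> \<pi>) x (1 * d)"
    by (rule A.turning_through_quotient[OF c(1,3) d(2)])
  moreover have "turning (inv \<tau> \<circ> \<pi>' \<circ> h) x (e * n)" by (rule turning_compose[OF n(1) e(2)])
  moreover have "inv \<tau> \<circ> \<pi>' \<circ> h = inv \<tau> \<circ> \<phi> \<circ> \<pi>" using eq by auto
  ultimately have "e * n = d" using turning_unique by fastforce
  then have "n = 1" using n(2) d(1) e(1) by auto
  then show ?thesis using n(1) by simp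
qed

text \<open>The affine map carries the half turn about \<open>l\<close> to the half turn about
  \<open>L l + b\<close>. It carries the translation by \<open>2 * l\<close> to that by
  \<open>2 * L l\<close>, an allowed one because \<open>b\<close> is the image of 0 and hence lies
  in the target lattice. The inverse descends for the same reason.\<close>

lemma descend_affine:
  assumes L: "linear L" "0 < plane_det L" and \<Psi>: "(\<lambda>x. L x + b) ` \<Lambda> = \<Lambda>'"
  shows "\<exists>\<phi>. oriented_homeo S2_params S2 S2_params S2 \<phi> \<and> (\<forall>x. \<phi> (\<pi> x) = \<pi>' (L x + b))"
proof -
  obtain K where K: "linear K" "\<And>x. K (L x) = x" "\<And>x. L (K x) = x"
    using linear_inverse_plane_det[OF L(1) linear_inj_of_plane_det] L by (metis less_irrefl)
  have cL: "continuous_on UNIV L" "continuous_on UNIV K"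
    using L(1) K(1) linear_continuous_on linear_conv_bounded_linear by blast+
  have mem: "L l + b \<in> \<Lambda>'" if "l \<in> \<Lambda>" for l using \<Psi> that by blast
  have b: "b \<in> \<Lambda>'" using mem[OF lattice_0[OF A.lattice]] linear_0[OF L(1)] by simp
  have Lmem: "L l \<in> \<Lambda>'" if "l \<in> \<Lambda>" for l using lattice_diff[OF B.lattice mem[OF that] b] by simp
  have L2: "L (2 * l) = 2 * L l" for l using linear_add[OF L(1), of l l] by (simp only: mult_2)
  have K2: "K (2 * l) = 2 * K l" for l using linear_add[OF K(1), of l l] by (simp only: mult_2)
  have Kmem: "K (l - b) \<in> \<Lambda>" if l: "l \<in> \<Lambda>'" for l
  proof -
    obtain x where "x \<in> \<Lambda>" "l = L x + b" using l \<Psi> by blast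
    then show ?thesis using K(2) by simp
  qed
  have "\<exists>\<phi>. continuous_on S2 \<phi> \<and> \<phi> ` S2 \<subseteq> S2 \<and> (\<forall>x. \<phi> (\<pi> x) = \<pi>' (L x + b))"
  proof (rule descend_map)
    show "continuous_on UNIV (\<lambda>x. L x + b)" by (intro continuous_intros cL)
    show "\<pi>' (L x + b) = \<pi>' (L y + b)" if "\<pi> x = \<pi> y" for x y
    proof -
      obtain l where l: "l \<in> \<Lambda>" "y = 2 * l + x \<or> y = 2 * l - x" using \<open>\<pi> x = \<pi> y\<close> A.fibre by blast
      have "L y = 2 * L l + L x \<or> L y = 2 * L l - L x"
        using l(2) linear_add[OF L(1)] linear_diff[OF L(1)] L2 by metis
      then have "L y + b = 2 * L l + (L x + b) \<or> L y + b = 2 * (L l + b) - (L x + b)"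
        by (elim disjE) simp_all
      then show ?thesis
        using B.translate[OF Lmem[OF l(1)], of "L x + b"] B.reflect[OF mem[OF l(1)], of "L x + b"] by metis
    qed
  qed
  then obtain \<phi> where \<phi>: "continuous_on S2 \<phi>" "\<phi> ` S2 \<subseteq> S2" "\<And>x. \<phi> (\<pi> x) = \<pi>' (L x + b)" by blast
  have "\<exists>\<phi>. continuous_on S2 \<phi> \<and> \<phi> ` S2 \<subseteq> S2 \<and> (\<forall>x. \<phi> (\<pi>' x) = \<pi> (K (x - b)))"
  proof (rule R.descend_map)
    show "continuous_on UNIV (\<lambda>x. K (x - b))"
      by (intro continuous_on_compose2[OF cL(2)] continuous_intros) auto
    show "\<pi> (K (x - b)) = \<pi> (K (y - b))" if "\<pi>' x = \<pi>' y" for x y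
    proof -
      obtain l where l: "l \<in> \<Lambda>'" "y = 2 * l + x \<or> y = 2 * l - x" using \<open>\<pi>' x = \<pi>' y\<close> B.fibre by blast
      have l': "K l \<in> \<Lambda>" using Kmem[OF lattice_add[OF B.lattice l(1) b]] by simp
      have "y - b = 2 * l + (x - b) \<or> y - b = 2 * (l - b) - (x - b)"
        using l(2) by (auto simp: algebra_simps)
      then have "K (y - b) = 2 * K l + K (x - b) \<or> K (y - b) = 2 * K (l - b) - K (x - b)"
        using linear_add[OF K(1)] linear_diff[OF K(1)] K2 by metis
      then show ?thesis
        using A.translate[OF l', of "K (x - b)"] A.reflect[OF Kmem[OF l(1)], of "K (x - b)"] by metis
    qed
  qed
  then obtain \<phi>' where \<phi>': "continuous_on S2 \<phi>'" "\<phi>' ` S2 \<subseteq> S2" "\<And>x. \<phi>' (\<pi>' x) = \<pi> (K (x - b))" by blast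
  have h: "homeomorphism S2 S2 \<phi> \<phi>'"
  proof (rule homeomorphismI[OF \<phi>(1) \<phi>'(1) \<phi>(2) \<phi>'(2)])
    show "\<phi>' (\<phi> y) = y" if y: "y \<in> S2" for y
    proof -
      obtain x where "y = \<pi> x" using y A.range_S2 by blast
      then show ?thesis using \<phi>(3) \<phi>'(3) K(2) by simp
    qed
    show "\<phi> (\<phi>' y) = y" if y: "y \<in> S2" for y
    proof -
      obtain x where "y = \<pi>' x" using y B.range_S2 by blast
      then show ?thesis using \<phi>(3) \<phi>'(3) K(3) by simp
    qed
  qed
  have "oriented_homeo S2_params S2 S2_params S2 \<phi>"
    by (rule oriented_homeo_of_lift[OF h \<phi>(3) turning_affine[OF L]])
  then show ?thesis using \<phi>(3) by blast
qed

lemma lift_is_affine_on_lattice: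
  assumes h: "homeomorphism UNIV UNIV h h'" and \<phi>: "oriented_homeo S2_params S2 S2_params S2 \<phi>"
    and eq: "\<And>x. \<pi>' (h x) = \<phi> (\<pi> x)" and br: "\<phi> ` \<pi> ` \<Lambda> = \<pi>' ` \<Lambda>'"
  shows "h ` \<Lambda> = \<Lambda>' \<and> (\<exists>L. linear L \<and> 0 < plane_det L \<and> (\<forall>l\<in>\<Lambda>. h l = L l + h 0))"
proof -
  obtain \<phi>' where h\<phi>: "homeomorphism S2 S2 \<phi> \<phi>'" using \<phi> by (rule oriented_homeo_homeomorphism)
  have inj: "h x = h y \<Longrightarrow> x = y" for x y using h by (metis UNIV_I homeomorphism_apply1)
  have surj: "\<exists>x. y = h x" for y using h by (metis UNIV_I homeomorphism_apply2)
  have hc: "continuous_on UNIV h" by (rule homeomorphism_cont1[OF h])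
  have mem: "h x \<in> \<Lambda>' \<longleftrightarrow> x \<in> \<Lambda>" for x
  proof -
    have "h x \<in> \<Lambda>' \<longleftrightarrow> \<phi> (\<pi> x) \<in> \<phi> ` \<pi> ` \<Lambda>"
      using B.branch_value_iff[of "h x"] eq br by simp
    also have "\<dots> \<longleftrightarrow> \<pi> x \<in> \<pi> ` \<Lambda>"
    proof
      assume "\<phi> (\<pi> x) \<in> \<phi> ` \<pi> ` \<Lambda>"
      then obtain l where "l \<in> \<Lambda>" "\<phi> (\<pi> x) = \<phi> (\<pi> l)" by blast
      moreover have "\<pi> x \<in> S2" "\<pi> l \<in> S2" using A.range_S2 by auto
      ultimately have "\<pi> x = \<pi> l" using homeomorphism_apply1[OF h\<phi>] by metis
      then show "\<pi> x \<in> \<pi> ` \<Lambda>" using \<open>l \<in> \<Lambda>\<close> by blast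
    qed blast
    finally show ?thesis using A.branch_value_iff by simp
  qed
  have im: "h ` \<Lambda> = \<Lambda>'"
  proof
    show "h ` \<Lambda> \<subseteq> \<Lambda>'" using mem by auto
    show "\<Lambda>' \<subseteq> h ` \<Lambda>"
    proof
      fix y assume y: "y \<in> \<Lambda>'"
      obtain x where "y = h x" using surj by blast
      then show "y \<in> h ` \<Lambda>" using mem[of x] y by simp
    qed
  qed
  have refl: "h (2 * l - x) = 2 * h l - h x" if l: "l \<in> \<Lambda>" for l x
  proof -
    have "\<exists>k\<in>\<Lambda>'. (\<forall>x\<in>UNIV. h (2 * l - x) = 2 * k + h x) \<or> (\<forall>x\<in>UNIV. h (2 * l - x) = 2 * k - h x)"
    proof (rule B.lift_unique)
      show "continuous_on UNIV (\<lambda>x. h (2 * l - x))"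
        by (intro continuous_on_compose2[OF hc] continuous_intros) simp
      show "\<pi>' (h x) = \<pi>' (h (2 * l - x))" for x unfolding eq A.reflect[OF l] ..
      show "countable {x \<in> UNIV. h x \<in> \<Lambda>'}" using mem countable_lattice[OF A.lattice] by simp
    qed (use hc in auto)
    then obtain k where "(\<forall>x. h (2 * l - x) = 2 * k + h x) \<or> (\<forall>x. h (2 * l - x) = 2 * k - h x)" by auto
    then show ?thesis
    proof
      \<comment> \<open>The half turn fixes \<open>l\<close>, so a translation induced by it would
        be trivial. Then \<open>l - 1\<close> and \<open>l + 1\<close> would have the same image,
        against injectivity.\<close>
      assume a: "\<forall>x. h (2 * l - x) = 2 * k + h x"
      then have "h l = 2 * k + h l" using spec[OF a, of l] by simp
      then have k0: "2 * k = 0" by simp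
      have "h (2 * l - (l + 1)) = h (l + 1)" using spec[OF a, of "l + 1"] unfolding k0 by (simp only: add_0)
      then have "2 * l - (l + 1) = l + 1" by (rule inj)
      then show ?thesis by (simp add: complex_eq_iff)
    next
      assume a: "\<forall>x. h (2 * l - x) = 2 * k - h x"
      then have "h l = 2 * k - h l" using spec[OF a, of l] by simp
      then have "2 * h l = 2 * k" by (metis add.commute diff_eq_eq mult_2)
      then show ?thesis using spec[OF a, of x] by metis
    qed
  qed
  note l0 = lattice_0[OF A.lattice]
  define D where "D l = h l - h 0" for l
  \<comment> \<open>The translation by \<open>2 * l\<close> is the half turn about 0 followed by the
    half turn about \<open>l\<close>.\<close>
  have shift: "h (x + 2 * l) = h x + 2 * D l" if l: "l \<in> \<Lambda>" for l x
  proof -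
    have "h (2 * l - (2 * 0 - x)) = 2 * h l - (2 * h 0 - h x)" using refl[OF l] refl[OF l0] by metis
    then show ?thesis by (simp add: D_def algebra_simps)
  qed
  have "D (l + m) = D l + D m" if lm: "l \<in> \<Lambda>" "m \<in> \<Lambda>" for l m
  proof -
    \<comment> \<open>Additivity of \<open>D\<close> comes from performing one translation in two
      stages.\<close>
    have "h 0 + 2 * D (l + m) = h (0 + 2 * (l + m))" 
      by (rule shift[OF lattice_add[OF A.lattice lm], symmetric])
    also have "\<dots> = h ((0 + 2 * l) + 2 * m)" by (simp add: algebra_simps)
    also have "\<dots> = h 0 + 2 * (D l + D m)" unfolding shift[OF lm(2)] shift[OF lm(1)] by (simp add: algebra_simps)
    finally have "2 * D (l + m) = 2 * (D l + D m)" by (rule add_left_imp_eq)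
    then show ?thesis by (rule mult_left_cancel[THEN iffD1, rotated]) simp
  qed
  then obtain L where L: "linear L" "\<And>l. l \<in> \<Lambda> \<Longrightarrow> L l = D l"
    using lattice_additive_extends[OF A.lattice, of D] by blast
  have hL: "h l = L l + h 0" if "l \<in> \<Lambda>" for l using L(2)[OF that] by (simp add: D_def)
  have "\<Lambda>' \<subseteq> range L"
  proof
    fix y assume y: "y \<in> \<Lambda>'"
    have "h 0 \<in> \<Lambda>'" using mem l0 by blast
    then have "y + h 0 \<in> h ` \<Lambda>" using im lattice_add[OF B.lattice y] by blast
    then obtain l where "l \<in> \<Lambda>" "y + h 0 = h l" by blast
    then have "y = L l" using hL by simp
    then show "y \<in> range L" by blast
  qed
  then have "surj L" by (rule linear_surj_of_lattice[OF B.lattice L(1)])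
  then have injL: "inj L" using linear_surjective_imp_injective[OF L(1)] by blast
  obtain K where "plane_det K * plane_det L = 1" using linear_inverse_plane_det[OF L(1) injL] by metis
  then have det0: "plane_det L \<noteq> 0" by auto
  have cL: "continuous_on UNIV L" using L(1) linear_continuous_on linear_conv_bounded_linear by blast
  obtain c where c: "0 < c" "\<And>x. c * cmod x \<le> cmod (L x)"
    using linear_inj_bounded_below_pos[OF L(1) injL] by blast
  \<comment> \<open>Both maps shift alike under twice the lattice, so their difference is periodic
    and is bounded by its supremum over a compact set of representatives.\<close>
  define e where "e x = h x - (L x + h 0)" for x
  obtain M where M: "\<And>x. \<exists>l\<in>\<Lambda>. cmod (x - 2 * l) \<le> M" using lattice_cocompact[OF A.lattice] by metis
  have "continuous_on UNIV e" unfolding e_def by (intro continuous_intros hc cL)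
  then have "compact (e ` cball 0 M)"
    by (intro compact_continuous_image compact_cball continuous_on_subset[of UNIV e "cball 0 M"]) simp_all
  then have "bounded (e ` cball 0 M)" by (rule compact_imp_bounded)
  then obtain N where N: "\<And>x. x \<in> cball 0 M \<Longrightarrow> cmod (e x) \<le> N"
    unfolding bounded_iff by blast
  have eN: "cmod (e x) \<le> N" for x
  proof -
    obtain l where l: "l \<in> \<Lambda>" "cmod (x - 2 * l) \<le> M" using M by blast
    have "L (x - 2 * l) = L x - 2 * L l"
      using linear_diff[OF L(1)] linear_add[OF L(1), of l l] by (simp only: mult_2)
    moreover have "h (x - 2 * l) = h x - 2 * L l" using shift[OF l(1), of "x - 2 * l"] L(2)[OF l(1)] by simp
    ultimately have "e x = e (x - 2 * l)" by (simp add: e_def)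
    then show ?thesis using N[of "x - 2 * l"] l(2) by simp
  qed
  \<comment> \<open>On the circle of this radius \<open>L\<close> has modulus at least
    \<open>c * r\<close>, which exceeds the error bound \<open>N\<close>.\<close>
  define r where "r = (\<bar>N\<bar> + 1) / c"
  have "c * r = \<bar>N\<bar> + 1" using c(1) by (simp add: r_def)
  then have r: "0 < r" "N < c * r" using c(1) by (auto simp: r_def intro!: divide_pos_pos)
  \<comment> \<open>Since \<open>h\<close> is injective on the whole plane, its degree on this large
    disc exists and equals the local degree at 0. The orientation known near a point thus reaches
    the large circle.\<close>
  obtain n where n: "turning_on (r + 1) h 0 n"
    using turning_on_exists[of "r + 1" 0 h] r(1) continuous_on_subset[OF hc subset_UNIV] inj by auto
  have "turning h 0 1" by (rule turning_of_lift[OF h \<phi> eq])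
  then have "n = 1" using n turning_unique unfolding turning_def by blast
  then have "1 = winding_number (h \<circ> circlepath 0 r) (h 0)"
    using turning_on_circlepath[OF n, of r] r(1) by simp
  also have "\<dots> = winding_number (\<lambda>t. (L \<circ> circlepath 0 r) t + h 0) (h 0)"
  proof (rule winding_number_nearby_loops_eq)
    have "path (L \<circ> circlepath 0 r)" 
      by (intro path_continuous_image continuous_on_subset[OF cL subset_UNIV]) simp
    then show "path (\<lambda>t. (L \<circ> circlepath 0 r) t + h 0)" 
      unfolding path_def by (rule continuous_on_add[OF _ continuous_on_const])
    show "path (h \<circ> circlepath 0 r)" 
      by (intro path_continuous_image continuous_on_subset[OF hc subset_UNIV]) simp
    show "cmod ((h \<circ> circlepath 0 r) t - ((L \<circ> circlepath 0 r) t + h 0))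
        < cmod ((L \<circ> circlepath 0 r) t + h 0 - h 0)" for t
    proof -
      have "cmod (circlepath 0 r t) = r" using r(1) by (simp add: circlepath norm_mult)
      then have "c * r \<le> cmod (L (circlepath 0 r t))" using c(2)[of "circlepath 0 r t"] by simp
      then show ?thesis using eN[of "circlepath 0 r t"] r(2) by (simp add: e_def)
    qed
  qed (auto simp: pathfinish_def pathstart_def circlepath)
  also have "\<dots> = winding_number (L \<circ> circlepath 0 r) 0"
    by (subst winding_number_offset) (simp add: comp_def)
  finally have w: "winding_number (L \<circ> circlepath 0 r) 0 = 1" by simp
  have "0 < plane_det L"
  proof (rule ccontr)
    assume "\<not> 0 < plane_det L"
    then have "plane_det L < 0" using det0 by simp
    then have "winding_number (L \<circ> circlepath 0 r) 0 = - 1" by (rule linear_winding_number(2)[OF L(1) r(1)])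
    then show False using w by simp
  qed
  then show ?thesis using im L(1) hL by blast
qed

end

section \<open>Presentations and Hurwitz classes\<close>

text \<open>Normality says that fibres are orbits of the deck group, and the deck group is
  prescribed by the lattice.\<close>

lemma lattice_quotientI:
  assumes \<Lambda>: "is_lattice \<Lambda>" and n: "oriented_normal_branched_covering \<pi>"
    and d: "deck_group \<pi> = Gamma_group \<Lambda>"
  shows "lattice_quotient \<Lambda> \<pi>"
proof
  have bc: "oriented_branched_covering plane_params UNIV S2_params S2 \<pi>"
    and nb: "\<And>x y. \<pi> x = \<pi> y \<Longrightarrow> \<exists>g\<in>deck_group \<pi>. g x = y"
    using n by (auto simp: oriented_normal_branched_covering_def)
  show "continuous_on UNIV \<pi>" "range \<pi> = S2" using bc by (auto simp: oriented_branched_covering_def)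
  show "\<exists>d>0. local_degree plane_params S2_params \<pi> x d" for x
    by (rule branched_covering_local_degree[OF oriented_surface_plane oriented_surface_S2 bc]) simp
  show "\<pi> x = \<pi> y \<longleftrightarrow> (\<exists>l\<in>\<Lambda>. y = 2 * l + x \<or> y = 2 * l - x)" for x y
  proof
    assume "\<pi> x = \<pi> y"
    then obtain g where "g \<in> Gamma_group \<Lambda>" "g x = y" using nb d by metis
    then show "\<exists>l\<in>\<Lambda>. y = 2 * l + x \<or> y = 2 * l - x" by (auto simp: Gamma_group_def)
  next
    assume "\<exists>l\<in>\<Lambda>. y = 2 * l + x \<or> y = 2 * l - x"
    then obtain g where g: "g \<in> Gamma_group \<Lambda>" "g x = y" by (auto simp: Gamma_group_def)
    then have "\<pi> \<circ> g = \<pi>" using d by (auto simp: deck_group_def)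
    then have "\<pi> (g x) = \<pi> x" by (metis comp_apply)
    then show "\<pi> x = \<pi> y" using g(2) by simp
  qed
qed (rule \<Lambda>)

lemma postcritical_set_forward: "x \<in> postcritical_set f \<Longrightarrow> f x \<in> postcritical_set f"
proof -
  assume "x \<in> postcritical_set f"
  then obtain k c where "1 \<le> k" "c \<in> critical_points f" "x = (f ^^ k) c"
    by (auto simp: postcritical_set_def)
  then have "Suc k \<in> {1..}" "f x \<in> (f ^^ Suc k) ` critical_points f" by auto
  then show "f x \<in> postcritical_set f" unfolding postcritical_set_def by blast
qed

lemma NET_map_surj: "NET_map f \<Longrightarrow> f ` S2 = S2"
  by (auto simp: NET_map_def Thurston_map_def oriented_branched_covering_def)

lemma postcritical_set_subset:
  assumes "NET_map f" shows "postcritical_set f \<subseteq> S2"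
proof -
  have "(f ^^ k) c \<in> S2" if "c \<in> S2" for k c
    using that NET_map_surj[OF assms] by (induction k) auto
  then show ?thesis unfolding postcritical_set_def critical_points_def by blast
qed

text \<open>Intertwining homeomorphisms transport the local power charts, hence match critical points.\<close>

lemma P1_set_transport:
  assumes h1: "homeomorphism S2 S2 \<phi> \<phi>'" and o1: "oriented_homeo S2_params S2 S2_params S2 \<phi>"
    and h2: "homeomorphism S2 S2 \<psi> \<psi>'" and o2: "oriented_homeo S2_params S2 S2_params S2 \<psi>"
    and eq: "\<And>x. x \<in> S2 \<Longrightarrow> \<phi> (f x) = f' (\<psi> x)"
    and f: "f ` S2 = S2" and P: "\<phi> ` postcritical_set f = postcritical_set f'" "postcritical_set f \<subseteq> S2"
  shows "\<psi> ` P1_set f = P1_set f'"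
proof -
  note S = oriented_surface_S2
  have S2: "openin (top_of_set S2) S2" by simp
  have \<psi>: "\<psi> x \<in> S2" "\<psi>' x \<in> S2" "\<psi>' (\<psi> x) = x" "\<psi> (\<psi>' x) = x" "f x \<in> S2" if "x \<in> S2" for x
    using that h2 f by (auto simp: homeomorphism_def)
  have eq': "\<phi>' (f' y) = f (\<psi>' y)" if "y \<in> S2" for y
    using eq[of "\<psi>' y"] \<psi>(2)[OF that] \<psi>(4)[OF that] \<psi>(5)[of "\<psi>' y"] homeomorphism_apply1[OF h1] by metis
  have o1': "oriented_homeo S2_params S2 S2_params S2 \<phi>'" by (rule oriented_homeo_sym[OF S S S2 S2 h1 o1])
  have o2': "oriented_homeo S2_params S2 S2_params S2 \<psi>'" by (rule oriented_homeo_sym[OF S S S2 S2 h2 o2])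
  have crit: "\<psi> x \<in> critical_points f' \<longleftrightarrow> x \<in> critical_points f" if x: "x \<in> S2" for x
  proof
    assume "x \<in> critical_points f"
    then show "\<psi> x \<in> critical_points f'"
      using has_local_degree_transport[where f = f and f' = f', OF S S h2 o2 h1 o1 eq] \<psi>(1)[OF x]
      unfolding critical_points_def by blast
  next
    assume "\<psi> x \<in> critical_points f'"
    then obtain d where "2 \<le> d" "has_local_degree S2_params S2 S2_params S2 f' (\<psi> x) d"
      unfolding critical_points_def by blast
    note d = this
    have "has_local_degree S2_params S2 S2_params S2 f (\<psi>' (\<psi> x)) d"
    proof (rule has_local_degree_transport[where f = f' and f' = f,
          OF S S homeomorphism_symD[OF h2] o2' homeomorphism_symD[OF h1] o1' _ d(2)])
      show "\<phi>' (f' y) = f (\<psi>' y)" if "y \<in> S2" for y by (rule eq'[OF that])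
    qed
    then show "x \<in> critical_points f"
      using x \<psi>(3)[OF x] d(1) unfolding critical_points_def by auto
  qed
  have post: "f' (\<psi> x) \<in> postcritical_set f' \<longleftrightarrow> f x \<in> postcritical_set f" if x: "x \<in> S2" for x
  proof
    assume "f' (\<psi> x) \<in> postcritical_set f'"
    then have "\<phi> (f x) \<in> \<phi> ` postcritical_set f" using eq[OF x] P(1) by simp
    then obtain p where p: "p \<in> postcritical_set f" "\<phi> (f x) = \<phi> p" by blast
    then have "f x = p" using P(2) \<psi>(5)[OF x] homeomorphism_apply1[OF h1] by (metis subsetD)
    then show "f x \<in> postcritical_set f" using p by simp
  next
    assume "f x \<in> postcritical_set f"
    then show "f' (\<psi> x) \<in> postcritical_set f'" using eq[OF x] P(1) by (metis imageI)
  qed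
  show ?thesis
  proof
    show "\<psi> ` P1_set f \<subseteq> P1_set f'" using \<psi>(1) crit post by (auto simp: P1_set_def)
    show "P1_set f' \<subseteq> \<psi> ` P1_set f"
    proof
      fix y assume y: "y \<in> P1_set f'"
      then have yS: "y \<in> S2" by (simp add: P1_set_def)
      have "\<psi>' y \<in> P1_set f"
        using y crit[OF \<psi>(2)[OF yS]] post[OF \<psi>(2)[OF yS]] \<psi>(2,4)[OF yS] by (simp add: P1_set_def)
      then show "y \<in> \<psi> ` P1_set f" using \<psi>(4)[OF yS] by (metis imageI)
    qed
  qed
qed

section \<open>Equivalence of Hurwitz structure sets\<close>

text \<open>The translation part \<open>b\<close> is the image of 0 and so lies in the target
  lattice. Hence the linear part alone already maps one lattice onto the other, and cosets go to
  whole cosets.\<close>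

lemma affine_image_coset2:
  assumes L: "linear L" and \<Psi>: "(\<lambda>x. L x + b) ` \<Lambda> = \<Lambda>'" and \<Lambda>: "is_lattice \<Lambda>" "is_lattice \<Lambda>'"
  shows "(\<lambda>x. L x + b) ` coset2 \<Lambda> x = coset2 \<Lambda>' (L x + b)"
proof -
  have b: "b \<in> \<Lambda>'" using \<Psi> lattice_0[OF \<Lambda>(1)] linear_0[OF L] by force
  have L2: "L (2 * l) = 2 * L l" for l using linear_add[OF L, of l l] by (simp only: mult_2)
  have "L ` \<Lambda> = \<Lambda>'"
  proof
    show "L ` \<Lambda> \<subseteq> \<Lambda>'"
    proof
      fix y assume "y \<in> L ` \<Lambda>"
      then have "y + b \<in> \<Lambda>'" using \<Psi> by blast
      then show "y \<in> \<Lambda>'" using lattice_diff[OF \<Lambda>(2) _ b] by fastforce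
    qed
    show "\<Lambda>' \<subseteq> L ` \<Lambda>"
    proof
      fix y assume "y \<in> \<Lambda>'"
      then have "y + b \<in> (\<lambda>x. L x + b) ` \<Lambda>" using lattice_add[OF \<Lambda>(2) _ b] \<Psi> by blast
      then show "y \<in> L ` \<Lambda>" by auto
    qed
  qed
  have "coset2 \<Lambda>' (L x + b) = (\<lambda>l. L x + b + 2 * l) ` L ` \<Lambda>"
    unfolding \<open>L ` \<Lambda> = \<Lambda>'\<close> coset2_def by blast
  also have "\<dots> = (\<lambda>x. L x + b) ` coset2 \<Lambda> x"
  proof -
    have "L x + b + 2 * L l = L (x + 2 * l) + b" for l using linear_add[OF L] L2 by simp
    note eq = this
    have "coset2 \<Lambda> x = (\<lambda>l. x + 2 * l) ` \<Lambda>" unfolding coset2_def by blast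
    then show ?thesis by (simp only: image_image eq)
  qed
  finally show ?thesis by simp
qed

lemma affine_image_coset2_family:
  assumes L: "linear L" and \<Psi>: "(\<lambda>x. L x + b) ` \<Lambda> = \<Lambda>'" and \<Lambda>: "is_lattice \<Lambda>" "is_lattice \<Lambda>'"
  shows "(\<lambda>h. (\<lambda>x. L x + b) ` h) ` coset2 \<Lambda> ` D = coset2 \<Lambda>' ` (\<lambda>x. L x + b) ` D"
  unfolding image_image by (rule image_cong[OF refl]) (rule affine_image_coset2[OF assms])

lemma equivalent_structures_refl: "equivalent_structures s s"
proof -
  obtain \<Lambda>1 \<Lambda>2 H where s: "s = (\<Lambda>1, \<Lambda>2, H)" by (metis prod_cases3)
  have "linear (\<lambda>x::complex. x)" by (rule linearI) simp_all
  moreover have "0 < plane_det (\<lambda>x. x)" by (simp add: plane_det_def)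
  ultimately show ?thesis
    unfolding equivalent_structures_def s prod.case
    by (intro exI[of _ "\<lambda>x. x + 0"] exI[of _ "\<lambda>x. x"] exI[of _ 0]) simp
qed

lemma equivalent_structures_sym:
  assumes "equivalent_structures s t" shows "equivalent_structures t s"
proof -
  obtain \<Lambda>1 \<Lambda>2 H \<Lambda>1' \<Lambda>2' H' where st: "s = (\<Lambda>1, \<Lambda>2, H)" "t = (\<Lambda>1', \<Lambda>2', H')" by (metis prod_cases3)
  obtain L b where L: "linear L" "0 < plane_det L" "(\<lambda>x. L x + b) ` \<Lambda>2 = \<Lambda>2'" "(\<lambda>x. L x + b) ` \<Lambda>1 = \<Lambda>1'"
    "(\<lambda>h. (\<lambda>x. L x + b) ` h) ` H = H'"
    using assms unfolding st equivalent_structures_def by auto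
  have "inj L" by (rule linear_inj_of_plane_det) (use L in auto)
  then obtain K where K: "linear K" "\<And>x. K (L x) = x" "\<And>x. L (K x) = x" "plane_det K * plane_det L = 1"
    using linear_inverse_plane_det[OF L(1)] by metis
  have "0 < plane_det K" using K(4) L(2) by (metis zero_less_mult_pos2 zero_less_one)
  have inv: "K (L x + b) + - K b = x" for x using linear_add[OF K(1)] K(2) by simp
  have "(\<lambda>x. K x + - K b) ` (\<lambda>x. L x + b) ` A = A" for A
    unfolding image_image inv by simp
  note im = this
  have "(\<lambda>x. K x + - K b) ` \<Lambda>2' = \<Lambda>2" "(\<lambda>x. K x + - K b) ` \<Lambda>1' = \<Lambda>1"
    unfolding L(3,4)[symmetric] by (rule im)+
  moreover have "(\<lambda>h. (\<lambda>x. K x + - K b) ` h) ` H' = H"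
    unfolding L(5)[symmetric]
      image_image[of "\<lambda>h. (\<lambda>x. K x + - K b) ` h" "\<lambda>h. (\<lambda>x. L x + b) ` h" H] im by simp
  ultimately show ?thesis
    unfolding st equivalent_structures_def prod.case using K(1) \<open>0 < plane_det K\<close> by blast
qed

lemma equivalent_structures_trans:
  assumes "equivalent_structures s t" "equivalent_structures t u" shows "equivalent_structures s u"
proof -
  obtain \<Lambda>1 \<Lambda>2 H \<Lambda>1' \<Lambda>2' H' \<Lambda>1'' \<Lambda>2'' H'' where st: "s = (\<Lambda>1, \<Lambda>2, H)" "t = (\<Lambda>1', \<Lambda>2', H')" "u = (\<Lambda>1'', \<Lambda>2'', H'')"
    by (metis prod_cases3)
  obtain L b where L: "linear L" "0 < plane_det L" "(\<lambda>x. L x + b) ` \<Lambda>2 = \<Lambda>2'" "(\<lambda>x. L x + b) ` \<Lambda>1 = \<Lambda>1'"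
    "(\<lambda>h. (\<lambda>x. L x + b) ` h) ` H = H'"
    using assms(1) unfolding st equivalent_structures_def by auto
  obtain K c where K: "linear K" "0 < plane_det K" "(\<lambda>x. K x + c) ` \<Lambda>2' = \<Lambda>2''" "(\<lambda>x. K x + c) ` \<Lambda>1' = \<Lambda>1''"
    "(\<lambda>h. (\<lambda>x. K x + c) ` h) ` H' = H''"
    using assms(2) unfolding st equivalent_structures_def by auto
  have eq: "K (L x + b) + c = (K \<circ> L) x + (K b + c)" for x using linear_add[OF K(1)] by simp
  have im: "(\<lambda>x. K x + c) ` (\<lambda>x. L x + b) ` A = (\<lambda>x. (K \<circ> L) x + (K b + c)) ` A" for A
    unfolding image_image eq ..
  have "linear (K \<circ> L)" using L K by (simp add: linear_compose)
  moreover have "0 < plane_det (K \<circ> L)" using L K by (simp add: plane_det_compose)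
  moreover have "(\<lambda>x. (K \<circ> L) x + (K b + c)) ` \<Lambda>2 = \<Lambda>2''" "(\<lambda>x. (K \<circ> L) x + (K b + c)) ` \<Lambda>1 = \<Lambda>1''"
    unfolding im[symmetric] L(3,4) K(3,4) by (rule refl)+
  moreover have "(\<lambda>h. (\<lambda>x. (K \<circ> L) x + (K b + c)) ` h) ` H = H''"
    unfolding im[symmetric]
      image_image[of "\<lambda>h. (\<lambda>x. K x + c) ` h" "\<lambda>h. (\<lambda>x. L x + b) ` h" H, symmetric] L(5) K(5) by (rule refl)
  ultimately show ?thesis unfolding st equivalent_structures_def prod.case by blast
qed

lemma structure_class_eq:
  assumes "equivalent_structures s t" shows "structure_class s = structure_class t"
proof -
  have "equivalent_structures s u \<longleftrightarrow> equivalent_structures t u" for u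
    using equivalent_structures_trans[OF assms, of u]
      equivalent_structures_trans[OF equivalent_structures_sym[OF assms], of u] by blast
  then show ?thesis by (simp only: structure_class_def)
qed

section \<open>Hurwitz equivalence, and the structure set of a presentation\<close>

lemma Hurwitz_equivalentE:
  assumes "Hurwitz_equivalent f f'"
  obtains \<phi> \<psi> where "oriented_homeo S2_params S2 S2_params S2 \<phi>"
    "oriented_homeo S2_params S2 S2_params S2 \<psi>"
    "\<phi> ` postcritical_set f = postcritical_set f'" "\<psi> ` postcritical_set f = postcritical_set f'"
    "\<forall>x\<in>S2. \<phi> (f x) = f' (\<psi> x)"
proof -
  from assms obtain \<phi> \<psi> where a: "oriented_homeo S2_params S2 S2_params S2 \<phi> \<and>
      oriented_homeo S2_params S2 S2_params S2 \<psi> \<and> \<phi> ` postcritical_set f = postcritical_set f' \<and>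
      \<psi> ` postcritical_set f = postcritical_set f' \<and> (\<forall>x\<in>S2. \<phi> (f x) = f' (\<psi> x))"
    unfolding Hurwitz_equivalent_def by (elim exE)
  show thesis by (rule that[of \<phi> \<psi>]) (use a in simp_all)
qed

lemma Hurwitz_equivalent_sym:
  assumes "Hurwitz_equivalent f f'" "f ` S2 = S2" "postcritical_set f \<subseteq> S2"
  shows "Hurwitz_equivalent f' f"
proof -
  note S = oriented_surface_S2
  have S2: "openin (top_of_set S2) S2" by simp
  obtain \<phi> \<psi> where o: "oriented_homeo S2_params S2 S2_params S2 \<phi>" "oriented_homeo S2_params S2 S2_params S2 \<psi>"
    and P: "\<phi> ` postcritical_set f = postcritical_set f'" "\<psi> ` postcritical_set f = postcritical_set f'"
    and eq0: "\<forall>x\<in>S2. \<phi> (f x) = f' (\<psi> x)"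
    using assms(1) by (rule Hurwitz_equivalentE)
  note eq = bspec[OF eq0]
  obtain \<phi>' where h1: "homeomorphism S2 S2 \<phi> \<phi>'" using o(1) by (rule oriented_homeo_homeomorphism)
  obtain \<psi>' where h2: "homeomorphism S2 S2 \<psi> \<psi>'" using o(2) by (rule oriented_homeo_homeomorphism)
  have im: "\<alpha>' ` \<alpha> ` postcritical_set f = postcritical_set f" if "homeomorphism S2 S2 \<alpha> \<alpha>'" for \<alpha> \<alpha>'
  proof -
    have "\<alpha>' (\<alpha> x) = x" if "x \<in> postcritical_set f" for x
      using homeomorphism_apply1[OF \<open>homeomorphism S2 S2 \<alpha> \<alpha>'\<close>] that assms(3) by blast
    then show ?thesis by (simp add: image_image)
  qed
  show ?thesis
    unfolding Hurwitz_equivalent_def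
  proof (intro exI conjI ballI)
    show "oriented_homeo S2_params S2 S2_params S2 \<phi>'" by (rule oriented_homeo_sym[OF S S S2 S2 h1 o(1)])
    show "oriented_homeo S2_params S2 S2_params S2 \<psi>'" by (rule oriented_homeo_sym[OF S S S2 S2 h2 o(2)])
    show "\<phi>' ` postcritical_set f' = postcritical_set f" "\<psi>' ` postcritical_set f' = postcritical_set f"
      using im[OF h1] im[OF h2] P by simp_all
    show "\<phi>' (f' y) = f (\<psi>' y)" if y: "y \<in> S2" for y
    proof -
      have x: "\<psi>' y \<in> S2" using h2 y by (auto simp: homeomorphism_def)
      then have "f (\<psi>' y) \<in> S2" using assms(2) by blast
      then have "\<phi>' (\<phi> (f (\<psi>' y))) = f (\<psi>' y)" by (rule homeomorphism_apply1[OF h1])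
      then show ?thesis using eq[OF x] homeomorphism_apply2[OF h2 y] by simp
    qed
  qed
qed

lemma Hurwitz_equivalent_trans:
  assumes "Hurwitz_equivalent f g" "Hurwitz_equivalent g h"
  shows "Hurwitz_equivalent f h"
proof -
  note S = oriented_surface_S2
  have S2: "openin (top_of_set S2) S2" by simp
  obtain \<phi> \<psi> where o: "oriented_homeo S2_params S2 S2_params S2 \<phi>" "oriented_homeo S2_params S2 S2_params S2 \<psi>"
    and P: "\<phi> ` postcritical_set f = postcritical_set g" "\<psi> ` postcritical_set f = postcritical_set g"
    and eq0: "\<forall>x\<in>S2. \<phi> (f x) = g (\<psi> x)"
    using assms(1) by (rule Hurwitz_equivalentE)
  note eq = bspec[OF eq0]
  obtain \<phi>' \<psi>' where o': "oriented_homeo S2_params S2 S2_params S2 \<phi>'" "oriented_homeo S2_params S2 S2_params S2 \<psi>'"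
    and P': "\<phi>' ` postcritical_set g = postcritical_set h" "\<psi>' ` postcritical_set g = postcritical_set h"
    and eq'0: "\<forall>x\<in>S2. \<phi>' (g x) = h (\<psi>' x)"
    using assms(2) by (rule Hurwitz_equivalentE)
  note eq' = bspec[OF eq'0]
  have "\<psi> x \<in> S2" if "x \<in> S2" for x
    using o(2) that by (auto simp: oriented_homeo_def homeomorphism_def)
  then have "(\<phi>' \<circ> \<phi>) (f x) = h ((\<psi>' \<circ> \<psi>) x)" if "x \<in> S2" for x using that eq eq' by simp
  moreover have "(\<phi>' \<circ> \<phi>) ` postcritical_set f = postcritical_set h" "(\<psi>' \<circ> \<psi>) ` postcritical_set f = postcritical_set h"
    unfolding image_comp[symmetric] P P' by (rule refl)+
  ultimately show ?thesis
    unfolding Hurwitz_equivalent_def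
    using oriented_homeo_trans[OF S S S S2 S2 S2 o(1) o'(1)] oriented_homeo_trans[OF S S S S2 S2 S2 o(2) o'(2)]
    by (intro exI[of _ "\<phi>' \<circ> \<phi>"] exI[of _ "\<psi>' \<circ> \<psi>"] conjI ballI)
qed

locale presentation =
  fixes f :: sphere_map and \<Lambda>1 \<Lambda>2 \<pi>1 \<pi>2
  assumes NET: "NET_map f" and presentation: "is_presentation f \<Lambda>1 \<Lambda>2 \<pi>1 \<pi>2"
begin

sublocale Q1: lattice_quotient \<Lambda>1 \<pi>1
  using presentation by (intro lattice_quotientI) (auto simp: is_presentation_def)

sublocale Q2: lattice_quotient \<Lambda>2 \<pi>2
  using presentation by (intro lattice_quotientI) (auto simp: is_presentation_def)

lemma f_\<pi>1: "f (\<pi>1 x) = \<pi>2 x"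
  using presentation unfolding is_presentation_def by (metis comp_apply)

lemma images: "\<pi>1 ` \<Lambda>1 = P1_set f" "\<pi>2 ` \<Lambda>2 = postcritical_set f"
  and subset: "\<Lambda>1 \<subseteq> \<Lambda>2"
  using presentation unfolding is_presentation_def by blast+

text \<open>The postcritical set is forward invariant, so \<open>f \<circ> \<pi>1 = \<pi>2\<close>
  sends these points to postcritical points, and the preimage of those under \<open>\<pi>2\<close>
  is the lattice.\<close>

lemma preimage_postcritical_subset: "\<pi>1 -` postcritical_set f \<subseteq> \<Lambda>2"
proof
  fix x assume "x \<in> \<pi>1 -` postcritical_set f"
  then have "\<pi>2 x \<in> postcritical_set f" using postcritical_set_forward f_\<pi>1 by (metis vimageD)
  then show "x \<in> \<Lambda>2" using Q2.branch_value_iff images(2) by simp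
qed

end

context lattice_quotient
begin

lemma coset2_self: "x \<in> coset2 \<Lambda> x"
  using lattice_0[OF lattice] unfolding coset2_def by force

lemma coset2_shift:
  assumes l: "l \<in> \<Lambda>" shows "coset2 \<Lambda> (2 * l + x) = coset2 \<Lambda> x"
proof -
  have "\<exists>k'\<in>\<Lambda>. 2 * l + x + 2 * k = x + 2 * k'" if "k \<in> \<Lambda>" for k
    by (rule bexI[OF _ lattice_add[OF lattice l that]]) (simp add: algebra_simps)
  moreover have "\<exists>k'\<in>\<Lambda>. x + 2 * k = 2 * l + x + 2 * k'" if "k \<in> \<Lambda>" for k
    by (rule bexI[OF _ lattice_diff[OF lattice that l]]) (simp add: algebra_simps)
  ultimately show ?thesis unfolding coset2_def by blast
qed

lemma uminus_coset2: "uminus ` coset2 \<Lambda> x = coset2 \<Lambda> (- x)"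
proof -
  have "\<exists>k'\<in>\<Lambda>. - (x + 2 * k) = - x + 2 * k'" if "k \<in> \<Lambda>" for k
    by (rule bexI[OF _ lattice_minus[OF lattice that]]) simp
  moreover have "\<exists>k'\<in>\<Lambda>. - x + 2 * k = - (x + 2 * k')" if "k \<in> \<Lambda>" for k
    by (rule bexI[OF _ lattice_minus[OF lattice that]]) simp
  ultimately show ?thesis unfolding coset2_def by (blast 7)
qed

lemma quotient_coset2: "y \<in> coset2 \<Lambda> x \<Longrightarrow> \<pi> y = \<pi> x"
  using translate[of _ x] by (auto simp: coset2_def add.commute)

lemma coset2_eq_imp: "coset2 \<Lambda> x = coset2 \<Lambda> y \<Longrightarrow> \<pi> x = \<pi> y"
  using coset2_self[of x] quotient_coset2 by metis

lemma even_quotient: "\<pi> (- x) = \<pi> x"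
  using reflect[OF lattice_0[OF lattice], of x] by simp

text \<open>Together with \<open>coset2_eq_imp\<close> and \<open>even_quotient\<close> this
  identifies points of the sphere with pairs of opposite cosets.\<close>

lemma quotient_eq_imp_coset2:
  assumes "\<pi> x = \<pi> y"
  shows "coset2 \<Lambda> y = coset2 \<Lambda> x \<or> coset2 \<Lambda> y = uminus ` coset2 \<Lambda> x"
proof -
  obtain l where "l \<in> \<Lambda>" "y = 2 * l + x \<or> y = 2 * l + - x" using assms fibre by auto
  then show ?thesis unfolding uminus_coset2 using coset2_shift by metis
qed

end

context presentation
begin

text \<open>Each of the four postcritical points yields one pair of opposite cosets, and distinct
  points yield disjoint pairs.\<close>

lemma Hurwitz_structure_set: "is_Hurwitz_structure_set \<Lambda>1 \<Lambda>2 (Hurwitz_structure_set_of f \<Lambda>1 \<pi>1)"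
proof -
  let ?P = "postcritical_set f"
  have card: "card ?P = 4" using NET by (simp add: NET_map_def)
  then have "finite ?P" by (metis card.infinite zero_neq_numeral)
  then obtain p where p: "bij_betw p {0..<4::nat} ?P" using ex_bij_betw_nat_finite card by metis
  have "\<exists>x. \<pi>1 x = p i" if "i < 4" for i
  proof -
    have "p i \<in> S2" using p that postcritical_set_subset[OF NET] unfolding bij_betw_def by fastforce
    then show ?thesis using Q1.range_S2 by (metis imageE)
  qed
  then obtain x where x: "\<And>i. i < 4 \<Longrightarrow> \<pi>1 (x i) = p i" by metis
  have pP: "p i \<in> ?P" if "i < 4" for i using p that unfolding bij_betw_def by fastforce
  define h where "h i = coset2 \<Lambda>1 (x i)" for i
  have \<Delta>: "x i \<in> \<pi>1 -` ?P" "- x i \<in> \<pi>1 -` ?P" if "i < 4" for i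
    using x[OF that] pP[OF that] Q1.even_quotient by simp_all
  have mh: "uminus ` h i = coset2 \<Lambda>1 (- x i)" for i unfolding h_def by (rule Q1.uminus_coset2)
  show ?thesis
    unfolding is_Hurwitz_structure_set_def
  proof (intro exI[of _ h] conjI allI impI)
    show "h i \<in> quotient2 \<Lambda>1 \<Lambda>2" if "i < 4" for i
      using \<Delta>(1)[OF that] preimage_postcritical_subset unfolding h_def quotient2_def by blast
    show "Hurwitz_structure_set_of f \<Lambda>1 \<pi>1 = (\<Union>i<4. {h i, uminus ` h i})"
    proof
      show "Hurwitz_structure_set_of f \<Lambda>1 \<pi>1 \<subseteq> (\<Union>i<4. {h i, uminus ` h i})"
      proof
        fix c assume "c \<in> Hurwitz_structure_set_of f \<Lambda>1 \<pi>1"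
        then obtain y where y: "c = coset2 \<Lambda>1 y" "\<pi>1 y \<in> ?P" unfolding Hurwitz_structure_set_of_def by blast
        then obtain i where i: "i < 4" "\<pi>1 y = p i" using p unfolding bij_betw_def by force
        then have "c = h i \<or> c = uminus ` h i"
          using Q1.quotient_eq_imp_coset2[of "x i" y] x y unfolding h_def by simp
        then show "c \<in> (\<Union>i<4. {h i, uminus ` h i})" using i(1) by blast
      qed
      show "(\<Union>i<4. {h i, uminus ` h i}) \<subseteq> Hurwitz_structure_set_of f \<Lambda>1 \<pi>1"
      proof
        fix c assume "c \<in> (\<Union>i<4. {h i, uminus ` h i})"
        then obtain i where i: "i < 4" "c = h i \<or> c = uminus ` h i" by blast
        then show "c \<in> Hurwitz_structure_set_of f \<Lambda>1 \<pi>1"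
          unfolding Hurwitz_structure_set_of_def mh unfolding h_def using \<Delta>[OF i(1)] by (metis imageI)
      qed
    qed
    show "{h i, uminus ` h i} \<inter> {h j, uminus ` h j} = {}" if ij: "i < 4" "j < 4" "i \<noteq> j" for i j
    proof (rule ccontr)
      assume "{h i, uminus ` h i} \<inter> {h j, uminus ` h j} \<noteq> {}"
      then obtain c where "c = h i \<or> c = uminus ` h i" "c = h j \<or> c = uminus ` h j" by blast
      then obtain a b where "a = x i \<or> a = - x i" "b = x j \<or> b = - x j" "coset2 \<Lambda>1 a = coset2 \<Lambda>1 b"
        unfolding mh unfolding h_def by metis
      then have "\<pi>1 (x i) = \<pi>1 (x j)" using Q1.coset2_eq_imp[of a b] Q1.even_quotient by metis
      then have "p i = p j" using x ij by simp
      then show False using p ij unfolding bij_betw_def inj_on_def by auto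
    qed
  qed
qed

text \<open>A class contains only genuine Hurwitz structure sets, so this membership rests on
  \<open>Hurwitz_structure_set\<close>. It lets an equality of classes be turned back into an
  equivalence of representatives.\<close>

lemma structure_in_class:
  "equivalent_structures s (\<Lambda>1, \<Lambda>2, Hurwitz_structure_set_of f \<Lambda>1 \<pi>1) \<longleftrightarrow>
     (\<Lambda>1, \<Lambda>2, Hurwitz_structure_set_of f \<Lambda>1 \<pi>1) \<in> structure_class s"
  using Q1.lattice Q2.lattice subset Hurwitz_structure_set by (simp add: structure_class_def)

end

locale presentation_pair =
  D: presentation f \<Lambda>1 \<Lambda>2 \<pi>1 \<pi>2 + D': presentation f' \<Lambda>1' \<Lambda>2' \<pi>1' \<pi>2'
  for f \<Lambda>1 \<Lambda>2 \<pi>1 \<pi>2 f' \<Lambda>1' \<Lambda>2' \<pi>1' \<pi>2'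
begin

sublocale P1: lattice_quotient_pair \<Lambda>1 \<pi>1 \<Lambda>1' \<pi>1' ..
sublocale P2: lattice_quotient_pair \<Lambda>2 \<pi>2 \<Lambda>2' \<pi>2' ..

text \<open>One map \<open>h\<close> lifts \<open>\<psi>\<close> for the first pair of quotients and
  \<open>\<phi>\<close> for the second. The second makes it affine on \<open>\<Lambda>2\<close>; the
  first makes it match the smaller lattices and the preimages of the postcritical sets.\<close>

lemma equivalent_structures_of_Hurwitz_equivalent:
  assumes "Hurwitz_equivalent f f'"
  shows "equivalent_structures (\<Lambda>1, \<Lambda>2, Hurwitz_structure_set_of f \<Lambda>1 \<pi>1)
    (\<Lambda>1', \<Lambda>2', Hurwitz_structure_set_of f' \<Lambda>1' \<pi>1')"
proof -
  let ?\<Delta> = "\<pi>1 -` postcritical_set f" and ?\<Delta>' = "\<pi>1' -` postcritical_set f'"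
  obtain \<phi> \<psi> where o: "oriented_homeo S2_params S2 S2_params S2 \<phi>" "oriented_homeo S2_params S2 S2_params S2 \<psi>"
    and P: "\<phi> ` postcritical_set f = postcritical_set f'" "\<psi> ` postcritical_set f = postcritical_set f'"
    and eq0: "\<forall>x\<in>S2. \<phi> (f x) = f' (\<psi> x)"
    using assms by (rule Hurwitz_equivalentE)
  note eq = bspec[OF eq0]
  obtain \<phi>' where h1: "homeomorphism S2 S2 \<phi> \<phi>'" using o(1) by (rule oriented_homeo_homeomorphism)
  obtain \<psi>' where h2: "homeomorphism S2 S2 \<psi> \<psi>'" using o(2) by (rule oriented_homeo_homeomorphism)
  have "\<psi> ` P1_set f = P1_set f'"
    by (rule P1_set_transport[OF h1 o(1) h2 o(2) _ NET_map_surj[OF D.NET] P(1) postcritical_set_subset[OF D.NET]])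
      (rule eq)
  then have br1: "\<psi> ` \<pi>1 ` \<Lambda>1 = \<pi>1' ` \<Lambda>1'" using D.images(1) D'.images(1) by simp
  have br2: "\<phi> ` \<pi>2 ` \<Lambda>2 = \<pi>2' ` \<Lambda>2'" using D.images(2) D'.images(2) P(1) by simp
  obtain h h' where h: "homeomorphism UNIV UNIV h h'" "\<And>x. \<pi>1' (h x) = \<psi> (\<pi>1 x)"
    using P1.lift_homeomorphism[OF h2 br1] by blast
  have h\<phi>: "\<pi>2' (h x) = \<phi> (\<pi>2 x)" for x
  proof -
    have "\<pi>1 x \<in> S2" using D.Q1.range_S2 by blast
    then have "\<phi> (f (\<pi>1 x)) = f' (\<psi> (\<pi>1 x))" by (rule eq)
    then show ?thesis unfolding D.f_\<pi>1 h(2)[symmetric] D'.f_\<pi>1 by (rule sym)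
  qed
  obtain L where L: "linear L" "0 < plane_det L" "\<And>l. l \<in> \<Lambda>2 \<Longrightarrow> h l = L l + h 0"
    and im2: "h ` \<Lambda>2 = \<Lambda>2'"
    using P2.lift_is_affine_on_lattice[OF h(1) o(1) h\<phi> br2] by blast
  have im1: "h ` \<Lambda>1 = \<Lambda>1'" using P1.lift_is_affine_on_lattice[OF h(1) o(2) h(2) br1] by blast
  have mem: "h x \<in> ?\<Delta>' \<longleftrightarrow> x \<in> ?\<Delta>" for x
  proof
    assume "h x \<in> ?\<Delta>'"
    then have "\<psi> (\<pi>1 x) \<in> \<psi> ` postcritical_set f" using h(2) P(2) by simp
    then obtain p where p: "p \<in> postcritical_set f" "\<psi> (\<pi>1 x) = \<psi> p" by blast
    have "\<pi>1 x \<in> S2" "p \<in> S2" using D.Q1.range_S2 p(1) postcritical_set_subset[OF D.NET] by blast+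
    then have "\<pi>1 x = p" using p(2) homeomorphism_apply1[OF h2] by metis
    then show "x \<in> ?\<Delta>" using p(1) by simp
  next
    assume "x \<in> ?\<Delta>"
    then have "\<psi> (\<pi>1 x) \<in> postcritical_set f'" using P(2) by blast
    then show "h x \<in> ?\<Delta>'" using h(2) by simp
  qed
  have im\<Delta>: "h ` ?\<Delta> = ?\<Delta>'"
  proof
    show "h ` ?\<Delta> \<subseteq> ?\<Delta>'" using mem by blast
    show "?\<Delta>' \<subseteq> h ` ?\<Delta>"
    proof
      fix y assume y: "y \<in> ?\<Delta>'"
      have "y = h (h' y)" using homeomorphism_apply2[OF h(1)] by simp
      then show "y \<in> h ` ?\<Delta>" using y mem[of "h' y"] by (metis imageI)
    qed
  qed
  \<comment> \<open>Both lattices and the preimage of the postcritical set lie in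
    \<open>\<Lambda>2\<close>, so on each of them \<open>h\<close> can be replaced by the affine
    map.\<close>
  have affine: "(\<lambda>x. L x + h 0) ` A = h ` A" if "A \<subseteq> \<Lambda>2" for A
    using that L(3) by (intro image_cong) auto
  have e1: "(\<lambda>x. L x + h 0) ` \<Lambda>1 = \<Lambda>1'" using affine[OF D.subset] im1 by simp
  have e2: "(\<lambda>x. L x + h 0) ` \<Lambda>2 = \<Lambda>2'" using affine[OF order_refl] im2 by simp
  have e3: "(\<lambda>x. L x + h 0) ` ?\<Delta> = ?\<Delta>'"
    using affine[OF D.preimage_postcritical_subset] im\<Delta> by simp
  have "(\<lambda>c. (\<lambda>x. L x + h 0) ` c) ` Hurwitz_structure_set_of f \<Lambda>1 \<pi>1 = Hurwitz_structure_set_of f' \<Lambda>1' \<pi>1'"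
    unfolding Hurwitz_structure_set_of_def
      affine_image_coset2_family[OF L(1) e1 D.Q1.lattice D'.Q1.lattice] e3 by (rule refl)
  then show ?thesis
    unfolding equivalent_structures_def prod.case using L(1,2) e1 e2
    by (intro exI[of _ "\<lambda>x. L x + h 0"] exI[of _ L] exI[of _ "h 0"] conjI refl)
qed

text \<open>The same affine map descends at both levels, and
  \<open>f \<circ> \<pi>1 = \<pi>2\<close> makes the two descended maps intertwine \<open>f\<close>
  and \<open>f'\<close>. As \<open>\<pi>1'\<close> is constant on cosets, equality of the sets of
  cosets is enough for \<open>\<psi>\<close> to match the postcritical sets.\<close>

lemma Hurwitz_equivalent_of_equivalent_structures:
  assumes "equivalent_structures (\<Lambda>1, \<Lambda>2, Hurwitz_structure_set_of f \<Lambda>1 \<pi>1)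
    (\<Lambda>1', \<Lambda>2', Hurwitz_structure_set_of f' \<Lambda>1' \<pi>1')"
  shows "Hurwitz_equivalent f f'"
proof -
  let ?\<Delta> = "\<pi>1 -` postcritical_set f" and ?\<Delta>' = "\<pi>1' -` postcritical_set f'"
  obtain L b where L: "linear L" "0 < plane_det L" and e2: "(\<lambda>x. L x + b) ` \<Lambda>2 = \<Lambda>2'"
    and e1: "(\<lambda>x. L x + b) ` \<Lambda>1 = \<Lambda>1'"
    and H: "(\<lambda>h. (\<lambda>x. L x + b) ` h) ` Hurwitz_structure_set_of f \<Lambda>1 \<pi>1 = Hurwitz_structure_set_of f' \<Lambda>1' \<pi>1'"
    using assms unfolding equivalent_structures_def prod.case by auto
  obtain \<phi> where \<phi>: "oriented_homeo S2_params S2 S2_params S2 \<phi>" "\<And>x. \<phi> (\<pi>2 x) = \<pi>2' (L x + b)"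
    using P2.descend_affine[OF L e2] by blast
  obtain \<psi> where \<psi>: "oriented_homeo S2_params S2 S2_params S2 \<psi>" "\<And>x. \<psi> (\<pi>1 x) = \<pi>1' (L x + b)"
    using P1.descend_affine[OF L e1] by blast
  have cosets: "coset2 \<Lambda>1' ` (\<lambda>x. L x + b) ` ?\<Delta> = coset2 \<Lambda>1' ` ?\<Delta>'"
    using H unfolding Hurwitz_structure_set_of_def
      affine_image_coset2_family[OF L(1) e1 D.Q1.lattice D'.Q1.lattice] .
  have sub: "postcritical_set f \<subseteq> range \<pi>1" "postcritical_set f' \<subseteq> range \<pi>1'"
    using postcritical_set_subset[OF D.NET] postcritical_set_subset[OF D'.NET] D.Q1.range_S2 D'.Q1.range_S2
    by simp_all
  have "\<psi> ` postcritical_set f = postcritical_set f'"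
  proof
    show "\<psi> ` postcritical_set f \<subseteq> postcritical_set f'"
    proof
      fix q assume "q \<in> \<psi> ` postcritical_set f"
      then obtain x where x: "x \<in> ?\<Delta>" "q = \<psi> (\<pi>1 x)" using sub(1) by blast
      then have "coset2 \<Lambda>1' (L x + b) \<in> coset2 \<Lambda>1' ` ?\<Delta>'" unfolding cosets[symmetric] by blast
      then obtain y where "y \<in> ?\<Delta>'" "coset2 \<Lambda>1' (L x + b) = coset2 \<Lambda>1' y" by blast
      then show "q \<in> postcritical_set f'" using D'.Q1.coset2_eq_imp[of "L x + b" y] x(2) \<psi>(2) by simp
    qed
    show "postcritical_set f' \<subseteq> \<psi> ` postcritical_set f"
    proof
      fix q assume "q \<in> postcritical_set f'"
      then obtain y where y: "y \<in> ?\<Delta>'" "q = \<pi>1' y" using sub(2) by blast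
      then have "coset2 \<Lambda>1' y \<in> coset2 \<Lambda>1' ` (\<lambda>x. L x + b) ` ?\<Delta>" unfolding cosets by blast
      then obtain x where "x \<in> ?\<Delta>" "coset2 \<Lambda>1' y = coset2 \<Lambda>1' (L x + b)" by blast
      then have "q = \<psi> (\<pi>1 x)" "\<pi>1 x \<in> postcritical_set f"
        using D'.Q1.coset2_eq_imp[of y "L x + b"] y(2) \<psi>(2)[of x] by simp_all
      then show "q \<in> \<psi> ` postcritical_set f" by (rule image_eqI)
    qed
  qed
  moreover have "\<phi> ` postcritical_set f = postcritical_set f'"
    unfolding D.images(2)[symmetric] D'.images(2)[symmetric] e2[symmetric] image_image \<phi>(2) by (rule refl)
  moreover have "\<phi> (f y) = f' (\<psi> y)" if y: "y \<in> S2" for y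
  proof -
    obtain x where "y = \<pi>1 x" using y D.Q1.range_S2 by blast
    then show ?thesis using \<phi>(2) \<psi>(2) D.f_\<pi>1 D'.f_\<pi>1 by simp
  qed
  ultimately show ?thesis
    unfolding Hurwitz_equivalent_def using \<phi>(1) \<psi>(1) by (intro exI[of _ \<phi>] exI[of _ \<psi>] conjI ballI)
qed

end

text \<open>The presentations behind \<open>C\<close> and \<open>C'\<close> are arbitrary, so the
  case of equal maps contains the independence of the invariant from the presentation.\<close>

theorem theorem6p1:
  fixes f f' :: sphere_map
    and C C' :: "(complex set \<times> complex set \<times> complex set set) set"
  assumes "NET_map f" and "NET_map f'"
    and "is_Hurwitz_invariant f C" and "is_Hurwitz_invariant f' C'"
  shows "(Hurwitz_equivalent f f' \<longrightarrow> C = C') \<and>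
         (C = C' \<longrightarrow> modular_Hurwitz_class f = modular_Hurwitz_class f') \<and>
         (modular_Hurwitz_class f = modular_Hurwitz_class f' \<longleftrightarrow> C = C')"
proof -
  obtain \<Lambda>1 \<Lambda>2 \<pi>1 \<pi>2 where p: "is_presentation f \<Lambda>1 \<Lambda>2 \<pi>1 \<pi>2"
    and C: "C = structure_class (\<Lambda>1, \<Lambda>2, Hurwitz_structure_set_of f \<Lambda>1 \<pi>1)"
    using assms(3) unfolding is_Hurwitz_invariant_def by blast
  obtain \<Lambda>1' \<Lambda>2' \<pi>1' \<pi>2' where p': "is_presentation f' \<Lambda>1' \<Lambda>2' \<pi>1' \<pi>2'"
    and C': "C' = structure_class (\<Lambda>1', \<Lambda>2', Hurwitz_structure_set_of f' \<Lambda>1' \<pi>1')"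
    using assms(4) unfolding is_Hurwitz_invariant_def by blast
  interpret D: presentation_pair f \<Lambda>1 \<Lambda>2 \<pi>1 \<pi>2 f' \<Lambda>1' \<Lambda>2' \<pi>1' \<pi>2'
    using assms(1,2) p p' by unfold_locales
  \<comment> \<open>Pairing \<open>f'\<close> with itself yields reflexivity of Hurwitz equivalence
    from the identity as affine map; this puts \<open>f'\<close> into its own class.\<close>
  interpret D': presentation_pair f' \<Lambda>1' \<Lambda>2' \<pi>1' \<pi>2' f' \<Lambda>1' \<Lambda>2' \<pi>1' \<pi>2' ..
  have invariant: "C = C'" if "Hurwitz_equivalent f f'"
    unfolding C C' by (rule structure_class_eq[OF D.equivalent_structures_of_Hurwitz_equivalent[OF that]])
  have refl: "Hurwitz_equivalent f' f'"
    by (rule D'.Hurwitz_equivalent_of_equivalent_structures[OF equivalent_structures_refl])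
  have complete: "Hurwitz_equivalent f f'" if "C = C'"
  proof (rule D.Hurwitz_equivalent_of_equivalent_structures)
    \<comment> \<open>Equality of the classes moves this member of \<open>C'\<close> into
      \<open>C\<close>, which is the required equivalence.\<close>
    have "(\<Lambda>1', \<Lambda>2', Hurwitz_structure_set_of f' \<Lambda>1' \<pi>1') \<in> C'"
      unfolding C' D.D'.structure_in_class[symmetric] by (rule equivalent_structures_refl)
    then show "equivalent_structures (\<Lambda>1, \<Lambda>2, Hurwitz_structure_set_of f \<Lambda>1 \<pi>1)
        (\<Lambda>1', \<Lambda>2', Hurwitz_structure_set_of f' \<Lambda>1' \<pi>1')"
      unfolding that[symmetric] C D.D'.structure_in_class .
  qed
  have classes: "modular_Hurwitz_class f = modular_Hurwitz_class f'" if "Hurwitz_equivalent f f'"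
  proof -
    have "Hurwitz_equivalent f' f"
      by (rule Hurwitz_equivalent_sym[OF that NET_map_surj postcritical_set_subset]) (rule assms(1))+
    then have "Hurwitz_equivalent f g \<longleftrightarrow> Hurwitz_equivalent f' g" for g
      using that Hurwitz_equivalent_trans by blast
    then show ?thesis by (simp add: modular_Hurwitz_class_def)
  qed
  have "Hurwitz_equivalent f f'" if "modular_Hurwitz_class f = modular_Hurwitz_class f'"
  proof -
    have "f' \<in> modular_Hurwitz_class f'" using refl assms(2) by (simp add: modular_Hurwitz_class_def)
    then show ?thesis unfolding that[symmetric] by (simp add: modular_Hurwitz_class_def)
  qed
  then show ?thesis using invariant complete classes by blast
qed

end
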